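(* Let $\mathfrak g=\mathfrak{sl}(2,\mathbb R)\ltimes\mathfrak h_3(\mathbb R)$ and let $q\in\mathbb Z_4=\{0,1,2,3\}$. With $H_l$, $H_l^\pm$, $H=\bigoplus_{l\ge0}H_l$ and $H^\pm=\bigoplus_{l\ge2}H_l^\pm$ as defined in the context for this $q$, the space $H$ is a $\mathfrak g$-module and, as $\mathfrak g$-modules: 1. If $q=0$ or $q=2$, the composition series of $H$ is $$0\subset H_0\oplus H_1\subset H.$$ 2. If $q=1$, the composition series of $H$ is $$0\subset H_0^-\oplus H_1^-\subset H_0\oplus H_1\subset H_0\oplus H_1\oplus H^-\subset H.$$ 3. If $q=3$, the composition series of $H$ is $$0\subset H_0^+\oplus H_1^+\subset H_0\oplus H_1\subset H_0\oplus H_1\oplus H^+\subset H.$$ (That is, all spaces in each chain are $\mathfrak g$-submodules and all successive quotients are irreducible $\mathfrak g$-modules.)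
   Context: Fix $q\in\mathbb Z_4$, $r=-1/2$, $s=i/2$. Let $I''(q,r,s)$ be the complex vector space of all $F\in C^\infty(\mathbb R^2)$, $F=F(\theta,y)$ complex valued, with $F(\theta+j\pi,(-1)^jy)=i^{-jq}F(\theta,y)$ for all $j\in\mathbb Z$. (This is the "compact picture" of a representation of $\widetilde{SL(2,\mathbb R)}\ltimes H_3$ smoothly induced from a character of a parabolic-like subgroup.) The group $K\cong\mathbb R/4\pi\mathbb Z$ acts by translation in $\theta$. A nonzero $F$ of the form $F(\theta,y)=e^{-im\theta/2}\tilde F(y)$, $m\in\mathbb Z$, is a weight vector of weight $m$; a vector is $K$-finite if it is a finite linear combination of weight vectors. Action of $\mathfrak{sl}_2$: let $\{h,e^+,e^-\}$ be the standard $\mathfrak{sl}_2$-triple, $\kappa=i(e^--e^+)$, $\eta^\pm=\tfrac12\bigl(h\pm i(e^++e^-)\bigr)$. These act by $$\kappa=i\partial_\theta,\qquad \eta^\pm=\tfrac12e^{\mp2i\theta}\Bigl(-y\partial_y\mp i\partial_\theta-\tfrac12\pm y^2\Bigr).$$ Action of the Heisenberg algebra: $\mathfrak h_3(\mathbb R)=\{(u,v,w)\}$ is the Lie algebra of the Heisenberg group $H_3$ with product $(v_1,v_2,v_3)(v_1',v_2',v_3')=(v_1+v_1',v_2+v_2',v_3+v_3'+v_1v_2'-v_2v_1')$, and $\mathfrak{sl}(2,\mathbb R)$ acts on it by the standard action on $(u,v)$ and trivially on $w$. The element $(u,v,w)$ acts on $I''(q,r,s)$ by $$-u(\cos\theta\,\partial_y+iy\sin\theta)+v(\sin\theta\,\partial_y-iy\cos\theta)+\tfrac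 i2w.$$ (This is the transfer to the compact picture, at $s=i/2$, of the operator $(tv-u)\partial_x+s(w-2vx)$ on functions of $(t,x)$.) Let $\Omega=\tfrac12h^2-h+2e^+e^-$. The element $\Omega'=2\Omega-r(r+2)$ acts on $I''(q,r,s)$ by $\Omega''=y^2(2i\partial_\theta-y^2+\partial_y^2)$. Definition of $H_l$, $l\in\mathbb Z_{\ge0}$: for $l\ge2$ put $\lambda=l(l-1)/2$ and let $H_l$ be the space of $K$-finite vectors of $\ker(\Omega''-2\lambda)\subset I''(q,r,s)$. For $\lambda=0$, the space of $K$-finite vectors of $\ker\Omega''\subset I''(q,r,s)$ is $H_0\oplus H_1$, where $H_0$ (respectively $H_1$) consists of the $K$-finite vectors that are even (respectively odd) in $y$. Each $H_l$ is an $\mathfrak{sl}_2$-module. When $q=1$, $H_l^-$ denotes the unique lowest weight $\mathfrak{sl}_2$-submodule of $H_l$ (the span of the weight vectors in $H_l$ of weights $m\ge2l+1$); when $q=3$, $H_l^+$ denotes the unique highest weight $\mathfrak{sl}_2$-submodule of $H_l$ (the span of the weight vectors in $H_l$ of weights $m\le-(2l+1)$). *)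

theory Defs
  imports
    "HOL-Analysis.Analysis"
    "HOL-Library.Function_Algebras"
    "HOL-Algebra.AbelCoset"
    "HOL-Algebra.Module"
    "HOL-Algebra.Algebraic_Closure_Type"
begin

section \<open>The Lie algebra\<close>

text \<open>
  An element \<open>(A, (u, v), w)\<close> consists of a traceless matrix \<open>A\<close> and an element \<open>(u, v, w)\<close>
  of the Heisenberg Lie algebra.
\<close>

type_synonym jacobi = "(real^2^2) \<times> (real^2) \<times> real"

definition sl2_R :: "(real^2^2) set" where
  "sl2_R = {A. trace A = 0}"

definition jacobi_algebra :: "jacobi set" where
  "jacobi_algebra = sl2_R \<times> UNIV"

text \<open>
  The factor 2 in the centre is the commutator of the group law
  \<open>(v1,v2,v3)(v1',v2',v3') = (v1+v1', v2+v2', v3+v3'+v1*v2'-v2*v1')\<close>. The matrix \<open>A\<close> acts on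
  column vectors \<open>(u, v)\<close>, and \<open>[A, a] = A *v a\<close> in the semidirect product.
\<close>

fun jacobi_bracket :: "jacobi \<Rightarrow> jacobi \<Rightarrow> jacobi" where
  "jacobi_bracket (A, a, w) (A', a', w') =
     (A ** A' - A' ** A, A *v a' - A' *v a, 2 * (a $ 1 * a' $ 2 - a $ 2 * a' $ 1))"


section \<open>Modules over the Lie algebra, quotients and composition series\<close>

text \<open>
  Complex vector spaces are modules over the ring record \<^term>\<open>ring_of_type_algebra :: complex ring\<close>.
  The fields \<open>mult\<close> and \<open>one\<close>, which the module record inherits from rings, play no role.
\<close>

record 'v jacobi_module = "(complex, 'v) module" +
  lie_action :: "jacobi \<Rightarrow> 'v \<Rightarrow> 'v"

locale is_jacobi_module =
  Module.module "ring_of_type_algebra :: complex ring" M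
  for M :: "('v, 'm) jacobi_module_scheme" (structure) +
  assumes lie_action_closed:
      "\<lbrakk>\<xi> \<in> jacobi_algebra; x \<in> carrier M\<rbrakk> \<Longrightarrow> lie_action M \<xi> x \<in> carrier M"
    and lie_action_add:
      "\<lbrakk>\<xi> \<in> jacobi_algebra; x \<in> carrier M; y \<in> carrier M\<rbrakk> \<Longrightarrow>
        lie_action M \<xi> (x \<oplus> y) = lie_action M \<xi> x \<oplus> lie_action M \<xi> y"
    and lie_action_smult:
      "\<lbrakk>\<xi> \<in> jacobi_algebra; x \<in> carrier M\<rbrakk> \<Longrightarrow>
        lie_action M \<xi> (c \<odot>\<^bsub>M\<^esub> x) = c \<odot>\<^bsub>M\<^esub> lie_action M \<xi> x"
    and add_lie_action:
      "\<lbrakk>\<xi> \<in> jacobi_algebra; \<zeta> \<in> jacobi_algebra; x \<in> carrier M\<rbrakk> \<Longrightarrow>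
        lie_action M (\<xi> + \<zeta>) x = lie_action M \<xi> x \<oplus> lie_action M \<zeta> x"
    and scale_lie_action:
      "\<lbrakk>\<xi> \<in> jacobi_algebra; x \<in> carrier M\<rbrakk> \<Longrightarrow>
        lie_action M (t *\<^sub>R \<xi>) x = complex_of_real t \<odot>\<^bsub>M\<^esub> lie_action M \<xi> x"
    and lie_action_bracket:
      "\<lbrakk>\<xi> \<in> jacobi_algebra; \<zeta> \<in> jacobi_algebra; x \<in> carrier M\<rbrakk> \<Longrightarrow>
        lie_action M (jacobi_bracket \<xi> \<zeta>) x =
          lie_action M \<xi> (lie_action M \<zeta> x) \<ominus> lie_action M \<zeta> (lie_action M \<xi> x)"

definition jacobi_submodule :: "'v set \<Rightarrow> ('v, 'm) jacobi_module_scheme \<Rightarrow> bool" where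
  "jacobi_submodule N M \<longleftrightarrow>
     submodule N (ring_of_type_algebra :: complex ring) M \<and>
     (\<forall>\<xi>\<in>jacobi_algebra. \<forall>x\<in>N. lie_action M \<xi> x \<in> N)"

definition jacobi_irreducible :: "('v, 'm) jacobi_module_scheme \<Rightarrow> bool" where
  "jacobi_irreducible M \<longleftrightarrow>
     is_jacobi_module M \<and> carrier M \<noteq> {\<zero>\<^bsub>M\<^esub>} \<and>
     (\<forall>N. jacobi_submodule N M \<longrightarrow> N = {\<zero>\<^bsub>M\<^esub>} \<or> N = carrier M)"

definition jacobi_quotient ::
    "('v, 'm) jacobi_module_scheme \<Rightarrow> 'v set \<Rightarrow> 'v set jacobi_module" where
  "jacobi_quotient M W =
     \<lparr>carrier = a_rcosets\<^bsub>M\<^esub> W, monoid.mult = undefined, one = undefined,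
      ring.zero = W, add = set_add M,
      smult = (\<lambda>c C. \<Union>x\<in>C. W +>\<^bsub>M\<^esub> (c \<odot>\<^bsub>M\<^esub> x)),
      lie_action = (\<lambda>\<xi> C. \<Union>x\<in>C. W +>\<^bsub>M\<^esub> lie_action M \<xi> x)\<rparr>"

definition composition_series ::
    "('v, 'm) jacobi_module_scheme \<Rightarrow> 'v set list \<Rightarrow> bool" where
  "composition_series M Vs \<longleftrightarrow>
     Vs \<noteq> [] \<and> hd Vs = {\<zero>\<^bsub>M\<^esub>} \<and> last Vs = carrier M \<and>
     (\<forall>V\<in>set Vs. jacobi_submodule V M) \<and>
     (\<forall>i. Suc i < length Vs \<longrightarrow>
        Vs ! i \<subset> Vs ! Suc i \<and>
        jacobi_irreducible (jacobi_quotient (M\<lparr>carrier := Vs ! Suc i\<rparr>) (Vs ! i)))"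


section \<open>Smooth functions on the plane\<close>

text \<open>Functions of \<open>p = (\<theta>, y)\<close> as a complex vector space with pointwise operations.\<close>

type_synonym plane_fun = "real \<times> real \<Rightarrow> complex"

definition cscale :: "complex \<Rightarrow> plane_fun \<Rightarrow> plane_fun" where
  "cscale c F = (\<lambda>p. c * F p)"

global_interpretation cfun: vector_space cscale
  by unfold_locales (auto simp: cscale_def fun_eq_iff algebra_simps)

fun differentiable_times :: "nat \<Rightarrow> plane_fun \<Rightarrow> bool" where
  "differentiable_times 0 F \<longleftrightarrow> continuous_on UNIV F"
| "differentiable_times (Suc k) F \<longleftrightarrow>
     (\<forall>p. F differentiable (at p)) \<and>
     (\<forall>v. differentiable_times k (\<lambda>p. frechet_derivative F (at p) v))"

definition smooth :: "plane_fun \<Rightarrow> bool" where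
  "smooth F \<longleftrightarrow> (\<forall>k. differentiable_times k F)"

definition D_theta :: "plane_fun \<Rightarrow> plane_fun" where
  "D_theta F = (\<lambda>p. frechet_derivative F (at p) (1, 0))"

definition D_y :: "plane_fun \<Rightarrow> plane_fun" where
  "D_y F = (\<lambda>p. frechet_derivative F (at p) (0, 1))"


section \<open>The compact picture at \<open>r = -1/2\<close>, \<open>s = \<i>/2\<close>\<close>

definition compact_picture :: "int \<Rightarrow> plane_fun set" where
  "compact_picture q =
     {F. smooth F \<and>
         (\<forall>(j::int) \<theta> y. F (\<theta> + of_int j * pi, (-1) powi j * y) = \<i> powi (- (j * q)) * F (\<theta>, y))}"

definition act_kappa :: "plane_fun \<Rightarrow> plane_fun" where
  "act_kappa F = (\<lambda>p. \<i> * D_theta F p)"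

definition act_eta_plus :: "plane_fun \<Rightarrow> plane_fun" where
  "act_eta_plus F = (\<lambda>(\<theta>, y). 1/2 * exp (- 2 * \<i> * of_real \<theta>) *
     (- of_real y * D_y F (\<theta>, y) - \<i> * D_theta F (\<theta>, y)
      - 1/2 * F (\<theta>, y) + (of_real y)\<^sup>2 * F (\<theta>, y)))"

definition act_eta_minus :: "plane_fun \<Rightarrow> plane_fun" where
  "act_eta_minus F = (\<lambda>(\<theta>, y). 1/2 * exp (2 * \<i> * of_real \<theta>) *
     (- of_real y * D_y F (\<theta>, y) + \<i> * D_theta F (\<theta>, y)
      - 1/2 * F (\<theta>, y) - (of_real y)\<^sup>2 * F (\<theta>, y)))"

text \<open>
  The standard triple is obtained by solving \<open>\<kappa> = \<i>(e\<^sup>- - e\<^sup>+)\<close> and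
  \<open>\<eta>\<^sup>\<plusminus> = (h \<plusminus> \<i>(e\<^sup>+ + e\<^sup>-))/2\<close>; see the lemma \<open>sl2_triple_relations\<close>.
\<close>

definition act_h :: "plane_fun \<Rightarrow> plane_fun" where
  "act_h F = (\<lambda>p. act_eta_plus F p + act_eta_minus F p)"

definition act_e_plus :: "plane_fun \<Rightarrow> plane_fun" where
  "act_e_plus F = (\<lambda>p. (- \<i> * (act_eta_plus F p - act_eta_minus F p) + \<i> * act_kappa F p) / 2)"

definition act_e_minus :: "plane_fun \<Rightarrow> plane_fun" where
  "act_e_minus F = (\<lambda>p. (- \<i> * (act_eta_plus F p - act_eta_minus F p) - \<i> * act_kappa F p) / 2)"

lemma sl2_triple_relations:
  "act_kappa F p = \<i> * (act_e_minus F p - act_e_plus F p)"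
  "act_eta_plus F p = (act_h F p + \<i> * (act_e_plus F p + act_e_minus F p)) / 2"
  "act_eta_minus F p = (act_h F p - \<i> * (act_e_plus F p + act_e_minus F p)) / 2"
  by (simp_all add: act_h_def act_e_plus_def act_e_minus_def field_simps)

definition act_heisenberg :: "real \<Rightarrow> real \<Rightarrow> real \<Rightarrow> plane_fun \<Rightarrow> plane_fun" where
  "act_heisenberg u v w F = (\<lambda>(\<theta>, y).
     - of_real u * (of_real (cos \<theta>) * D_y F (\<theta>, y) + \<i> * of_real (y * sin \<theta>) * F (\<theta>, y))
     + of_real v * (of_real (sin \<theta>) * D_y F (\<theta>, y) - \<i> * of_real (y * cos \<theta>) * F (\<theta>, y))
     + \<i> / 2 * of_real w * F (\<theta>, y))"

text \<open>A traceless matrix is \<open>A $ 1 $ 1\<close> times \<open>h\<close> plus \<open>A $ 1 $ 2\<close> times \<open>e\<^sup>+\<close> plus \<open>A $ 2 $ 1\<close> times \<open>e\<^sup>-\<close>.\<close>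

fun jacobi_act :: "jacobi \<Rightarrow> plane_fun \<Rightarrow> plane_fun" where
  "jacobi_act (A, a, w) F = (\<lambda>p.
     of_real (A $ 1 $ 1) * act_h F p + of_real (A $ 1 $ 2) * act_e_plus F p
     + of_real (A $ 2 $ 1) * act_e_minus F p + act_heisenberg (a $ 1) (a $ 2) w F p)"

definition Omega :: "plane_fun \<Rightarrow> plane_fun" where
  "Omega F = (\<lambda>(\<theta>, y). (of_real y)\<^sup>2 *
     (2 * \<i> * D_theta F (\<theta>, y) - (of_real y)\<^sup>2 * F (\<theta>, y) + D_y (D_y F) (\<theta>, y)))"


section \<open>Weight vectors and the spaces \<open>H\<^sub>l\<close>\<close>

definition weight_vector :: "int \<Rightarrow> int \<Rightarrow> plane_fun \<Rightarrow> bool" where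
  "weight_vector q m F \<longleftrightarrow>
     F \<in> compact_picture q \<and> F \<noteq> 0 \<and>
     (\<exists>f :: real \<Rightarrow> complex. F = (\<lambda>(\<theta>, y). exp (- (\<i> * of_int m * of_real \<theta> / 2)) * f y))"

definition K_finite :: "int \<Rightarrow> plane_fun \<Rightarrow> bool" where
  "K_finite q F \<longleftrightarrow> F \<in> cfun.span {G. \<exists>m. weight_vector q m G}"

definition lam :: "nat \<Rightarrow> complex" where
  "lam l = of_nat l * (of_nat l - 1) / 2"

text \<open>\<open>K_kernel q l\<close> is the space of \<open>K\<close>-finite vectors of the kernel of \<open>\<Omega>'' - 2\<lambda>\<close>, \<open>\<lambda> = l(l-1)/2\<close>.\<close>

definition K_kernel :: "int \<Rightarrow> nat \<Rightarrow> plane_fun set" where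
  "K_kernel q l = {F \<in> compact_picture q. K_finite q F \<and> Omega F - cscale (2 * lam l) F = 0}"

definition H_part :: "int \<Rightarrow> nat \<Rightarrow> plane_fun set" where
  "H_part q l =
     (if l = 0 then {F \<in> K_kernel q 0. \<forall>\<theta> y. F (\<theta>, - y) = F (\<theta>, y)}
      else if l = 1 then {F \<in> K_kernel q 0. \<forall>\<theta> y. F (\<theta>, - y) = - F (\<theta>, y)}
      else K_kernel q l)"

definition H_part_minus :: "int \<Rightarrow> nat \<Rightarrow> plane_fun set" where
  "H_part_minus q l = cfun.span {F \<in> H_part q l. \<exists>m. weight_vector q m F \<and> m \<ge> 2 * int l + 1}"

definition H_part_plus :: "int \<Rightarrow> nat \<Rightarrow> plane_fun set" where
  "H_part_plus q l = cfun.span {F \<in> H_part q l. \<exists>m. weight_vector q m F \<and> m \<le> - (2 * int l + 1)}"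

definition subspace_sum :: "nat set \<Rightarrow> (nat \<Rightarrow> plane_fun set) \<Rightarrow> plane_fun set" where
  "subspace_sum I A = cfun.span (\<Union>l\<in>I. A l)"

definition direct_family :: "nat set \<Rightarrow> (nat \<Rightarrow> plane_fun set) \<Rightarrow> bool" where
  "direct_family I A \<longleftrightarrow>
     (\<forall>l\<in>I. cfun.subspace (A l)) \<and>
     (\<forall>S F. finite S \<and> S \<subseteq> I \<and> (\<forall>l\<in>S. F l \<in> A l) \<and> (\<Sum>l\<in>S. F l) = 0 \<longrightarrow> (\<forall>l\<in>S. F l = 0))"

definition H_total :: "int \<Rightarrow> plane_fun set" where
  "H_total q = subspace_sum UNIV (H_part q)"

definition H_module :: "int \<Rightarrow> plane_fun jacobi_module" where
  "H_module q =
     \<lparr>carrier = H_total q, monoid.mult = undefined, one = undefined,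
      ring.zero = 0, add = (+), smult = cscale, lie_action = jacobi_act\<rparr>"

end

theory Submission
  imports Defs
begin

text \<open>
  A weight vector \<open>exp(-im\<theta>/2) f(y)\<close> lies in the kernel of \<open>\<Omega>'' - l(l-1)\<close> iff
  \<open>y\<^sup>2 f'' = (y\<^sup>4 - m y\<^sup>2 + l(l-1)) f\<close>. The exponents at \<open>0\<close> are \<open>l\<close> and \<open>1-l\<close>, so smoothness and
  parity leave, up to scalars, only \<open>f = y\<^sup>l exp(-y\<^sup>2/2) M((2l+1-m)/4, l+1/2, y\<^sup>2)\<close> with Kummer's
  function \<open>M\<close>, and only for \<open>m \<equiv> q + 2l\<close> modulo \<open>4\<close>. Hence these functions \<open>b(l,m)\<close> form a basis
  of \<open>H\<close>. The contiguity relations of \<open>M\<close> give \<open>\<eta>\<^sup>\<plusminus> b(l,m)\<close> as a multiple of \<open>b(l,m\<plusminus>4)\<close>, vanishing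
  only at \<open>m = \<mp>(2l+1)\<close>, and the Heisenberg operators \<open>y \<mp> \<partial>\<^sub>y\<close> (twisted by \<open>exp(\<mp>i\<theta>)\<close>) as
  \<open>\<mp>l b(l-1,m\<plusminus>2) + (l-1)(2l+1\<plusminus>m)/(4l\<^sup>2-1) b(l+1,m\<plusminus>2)\<close>. The factor \<open>l-1\<close> is why \<open>H\<^sub>0 \<oplus> H\<^sub>1\<close>
  is invariant, and the factor \<open>2l+1\<plusminus>m\<close> is why the extremal weight parts are.
  Since \<open>\<kappa>\<close> and \<open>\<eta>\<^sup>-\<eta>\<^sup>+\<close> have distinct joint eigenvalues on the basis, every submodule is spanned
  by basis vectors, and the nonvanishing coefficients connect all basis vectors within each step.
\<close>

section \<open>Kummer's confluent hypergeometric function\<close>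

text \<open>Uniqueness of the radial solution rests on the Wronskian with \<open>osc l m\<close>: it
  is constant for y > 0 and vanishes at 0, which disposes of the exponent 1-l without constructing
  the second solution. Since the equation degenerates at 0, it does not relate the two half axes;
  what couples them is the parity f(-y) = i^(m-q) f(y) forced by the translation by \<pi>. For l
  \<ge> 2 a solution of the wrong parity would be c y^l u to the right of 0 and -c y^l u to the
  left, and only smoothness at 0 forces c = 0. For l = 0 and l = 1 the equation is the same and both
  parities occur, so there the parity has to come from the definition of the spaces.

  Submodules are complex subspaces, hence stable under complex combinations of the real Lie algebra.
  The eigenvalue of \<open>\<eta>\<^sup>-\<eta>\<^sup>+\<close> depends on l only through l(l-1), so
  two basis vectors of equal weight could be confused only if l + l' = 1, and the congruence modulo
  4 forbids this. The rest is combinatorics of the index set: \<open>ladder_closed\<close> records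
  the moves with a nonzero coefficient and decides both which spans are invariant and which basis
  vectors generate each other.\<close>

definition kummer_coeff :: "real \<Rightarrow> real \<Rightarrow> nat \<Rightarrow> real" where
  "kummer_coeff a b n = pochhammer a n / (pochhammer b n * fact n)"

definition kummer :: "real \<Rightarrow> real \<Rightarrow> real \<Rightarrow> real" where
  "kummer a b z = (\<Sum>n. kummer_coeff a b n * z ^ n)"

lemma kummer_coeff_0 [simp]: "kummer_coeff a b 0 = 1"
  by (simp add: kummer_coeff_def)

lemma kummer_coeff_Suc:
  "kummer_coeff a b (Suc n) = kummer_coeff a b n * ((a + n) / ((b + n) * (n + 1)))"
  by (simp add: kummer_coeff_def pochhammer_rec' field_simps)

section \<open>Coefficients with shifted parameters\<close>

lemma pochhammer_pred: "pochhammer (a - 1) (Suc n) = (a - 1) * pochhammer a n"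
  for a :: real
  by (simp add: pochhammer_rec)

lemma pochhammer_succ: "a * pochhammer (a + 1) n = (a + n) * pochhammer a n"
  for a :: real
  by (metis pochhammer_rec pochhammer_rec')

lemma pochhammer_succ_divide:
  "b > 0 \<Longrightarrow> pochhammer (b + 1) n = (b + n) * pochhammer b n / b" for b :: real
  using pochhammer_succ[of b n] by (simp add: eq_divide_eq mult.commute)

text \<open>This and the next five lemmas express shifted coefficients as
  \<open>kummer_coeff a b n\<close> times a rational function of \<open>a\<close>, \<open>b\<close>
  and \<open>n\<close>, so that every contiguity relation becomes a rational identity in each
  degree. Where \<open>a\<close> is raised, a factor \<open>a\<close> stays on the left: solving for
  the coefficient would divide by \<open>a\<close>, which is 0 at weight m = 2l+1.\<close>

lemma kummer_coeff_up_up: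
  assumes "b > 0"
  shows "a / b * kummer_coeff (a + 1) (b + 1) n = kummer_coeff a b n * ((a + n) / (b + n))"
proof -
  have "b + n \<noteq> 0" "pochhammer b n \<noteq> 0"
    using assms pochhammer_pos[of b n] by (auto intro: add_pos_nonneg dest: less_imp_neq simp: add_nonneg_eq_0_iff)
  then show ?thesis
    using assms pochhammer_succ[of a n]
    by (simp add: kummer_coeff_def pochhammer_succ_divide) (simp add: field_simps)
qed

lemma kummer_coeff_up:
  assumes "b > 0"
  shows "a * kummer_coeff (a + 1) b (Suc n) =
    kummer_coeff a b n * ((a + n) * (a + n + 1) / ((b + n) * (n + 1)))"
proof -
  have "a * pochhammer (a + 1) (Suc n) = (a + n + 1) * ((a + n) * pochhammer a n)"
    using pochhammer_succ[of a "Suc n"] by (simp add: pochhammer_rec' add_ac)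
  then show ?thesis
    using assms by (simp add: kummer_coeff_def pochhammer_rec'[of b] field_simps del: pochhammer_Suc)
qed

lemma kummer_coeff_down:
  "kummer_coeff (a - 1) b (Suc n) = kummer_coeff a b n * ((a - 1) / ((b + n) * (n + 1)))"
  by (simp add: kummer_coeff_def pochhammer_pred pochhammer_rec'[of b] field_simps)

lemma kummer_coeff_keep_up:
  assumes "b > 0"
  shows "kummer_coeff a (b + 1) n = kummer_coeff a b n * (b / (b + n))"
  using assms unfolding kummer_coeff_def pochhammer_succ_divide[OF assms] by simp

lemma kummer_coeff_keep_down:
  "kummer_coeff a (b - 1) (Suc n) = kummer_coeff a b n * ((a + n) / ((b - 1) * (n + 1)))"
  by (simp add: kummer_coeff_def pochhammer_pred pochhammer_rec'[of a] field_simps)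

lemma kummer_coeff_down_down:
  "kummer_coeff (a - 1) (b - 1) (Suc n) = kummer_coeff a b n * ((a - 1) / ((b - 1) * (n + 1)))"
  by (simp add: kummer_coeff_def pochhammer_pred field_simps)

lemma summable_kummer:
  assumes "b > 0"
  shows "summable (\<lambda>n. kummer_coeff a b n * z ^ n)"
proof -
  \<comment> \<open>\<open>C\<close> bounds |z| |a+n| / (b+n) for every n. The ratio of consecutive
    terms is then at most C / (n+1), hence at most 1/2 from N \<ge> 2C on.\<close>
  define C where "C = \<bar>z\<bar> * (\<bar>a\<bar> / b + 1)"
  have C0: "C \<ge> 0" using assms by (simp add: C_def)
  obtain N :: nat where N: "2 * C \<le> N" using real_arch_simple by blast
  show ?thesis
  proof (rule summable_ratio_test[of "1/2" N])
    fix n :: nat assume n: "N \<le> n"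
    have bn: "b + n > 0" using assms by simp
    have "\<bar>a + n\<bar> \<le> \<bar>a\<bar> + n" by simp
    also have "\<dots> \<le> \<bar>a\<bar> + n + (\<bar>a\<bar> / b * n + b)"
      using assms by simp
    also have "\<dots> = (\<bar>a\<bar> / b + 1) * (b + n)"
      using assms by (simp add: distrib_left distrib_right)
    finally have "\<bar>a + n\<bar> / (b + n) \<le> \<bar>a\<bar> / b + 1"
      using bn by (simp add: divide_le_eq)
    then have "\<bar>z\<bar> * (\<bar>a + n\<bar> / (b + n)) / (n + 1) \<le> C / (n + 1)"
      unfolding C_def by (intro divide_right_mono mult_left_mono) auto
    also have "\<dots> \<le> 1 / 2" using n N by (simp add: field_simps)
    finally have le: "\<bar>z\<bar> * (\<bar>a + n\<bar> / (b + n)) / (n + 1) \<le> 1 / 2" .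
    have "norm (kummer_coeff a b (Suc n) * z ^ Suc n)
        = (\<bar>z\<bar> * (\<bar>a + n\<bar> / (b + n)) / (n + 1)) * norm (kummer_coeff a b n * z ^ n)"
      using bn by (simp add: kummer_coeff_Suc abs_mult abs_divide power_abs mult_ac)
    also have "\<dots> \<le> 1 / 2 * norm (kummer_coeff a b n * z ^ n)"
      using le by (intro mult_right_mono) auto
    finally show "norm (kummer_coeff a b (Suc n) * z ^ Suc n)
      \<le> 1 / 2 * norm (kummer_coeff a b n * z ^ n)" .
  qed simp
qed

lemma kummer_sums: "b > 0 \<Longrightarrow> (\<lambda>n. kummer_coeff a b n * z ^ n) sums kummer a b z"
  unfolding kummer_def by (intro summable_sums summable_kummer)

lemma kummer_0 [simp]: "kummer a b 0 = 1"
  unfolding kummer_def by (subst powser_zero) simp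

text \<open>Padding with a zero in degree 0 makes z times a series comparable with the other series
  coefficient by coefficient.\<close>

lemma kummer_shift_sums:
  assumes "b > 0"
  shows "(\<lambda>n. (case n of 0 \<Rightarrow> 0 | Suc k \<Rightarrow> kummer_coeff a b k) * z ^ n) sums (z * kummer a b z)"
proof -
  have "(\<lambda>n. z * (kummer_coeff a b n * z ^ n)) sums (z * kummer a b z)"
    by (intro sums_mult kummer_sums assms)
  then have "(\<lambda>n. (case Suc n of 0 \<Rightarrow> 0 | Suc k \<Rightarrow> kummer_coeff a b k) * z ^ Suc n)
      sums (z * kummer a b z)"
    by (simp add: mult_ac)
  then show ?thesis by (subst (asm) sums_Suc_iff) simp
qed

lemma DERIV_kummer:
  assumes "b > 0"
  shows "(kummer a b has_real_derivative a / b * kummer (a + 1) (b + 1) z) (at z)"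
proof -
  have "diffs (kummer_coeff a b) = (\<lambda>n. a / b * kummer_coeff (a + 1) (b + 1) n)"
    using assms by (simp add: diffs_def fun_eq_iff kummer_coeff_up_up kummer_coeff_Suc add_pos_nonneg
        del: times_divide_eq_left)
  moreover have "(\<lambda>n. a / b * kummer_coeff (a + 1) (b + 1) n * z ^ n) sums (a / b * kummer (a + 1) (b + 1) z)"
    using sums_mult[OF kummer_sums, of "b + 1" "a / b" "a + 1" z] assms by (simp add: mult_ac)
  ultimately have "(\<Sum>n. diffs (kummer_coeff a b) n * z ^ n) = a / b * kummer (a + 1) (b + 1) z"
    by (simp add: sums_iff)
  then show ?thesis
    using termdiffs_strong_converges_everywhere[OF summable_kummer[OF assms], of a z]
    by (simp add: kummer_def[abs_def])
qed

section \<open>Contiguity relations of Kummer's function\<close>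

lemma sums_eqI: "f sums s \<Longrightarrow> g sums t \<Longrightarrow> (\<And>n. f n = g n) \<Longrightarrow> s = (t :: real)"
  by (metis (no_types, lifting) ext sums_unique2)

text \<open>The operator z d/dz + a multiplies z^n by a + n, and (a+n) (a)_n = a (a+1)_n for rising
  factorials. This is the radial core of \<open>\<eta>\<^sup>-\<close>, which lowers m by 4 and
  thereby raises the first parameter by 1.\<close>

lemma kummer_up:
  assumes "b > 0"
  shows "z * (a / b * kummer (a + 1) (b + 1) z) + a * kummer a b z = a * kummer (a + 1) b z"
proof -
  note s1 = sums_mult[OF kummer_shift_sums[of "b + 1" "a + 1" z], of "a / b"]
  note s2 = sums_mult[OF kummer_sums[of b a z], of a]
  note s3 = sums_mult[OF kummer_sums[of b "a + 1" z], of a]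
  have coeffs: "a / b * ((case n of 0 \<Rightarrow> 0 | Suc k \<Rightarrow> kummer_coeff (a + 1) (b + 1) k) * z ^ n)
      + a * (kummer_coeff a b n * z ^ n) = a * (kummer_coeff (a + 1) b n * z ^ n)" for n
  proof (cases n)
    case (Suc k)
    have bk: "b + k > 0" using assms by simp
    have "a / b * kummer_coeff (a + 1) (b + 1) k + a * kummer_coeff a b (Suc k)
        = a * kummer_coeff (a + 1) b (Suc k)"
      unfolding kummer_coeff_up[OF assms, of a k] kummer_coeff_up_up[OF assms, of a k] kummer_coeff_Suc[of a b k]
      using bk by (simp add: divide_simps) (simp add: algebra_simps)
    then show ?thesis unfolding Suc nat.case by (metis distrib_right mult.assoc)
  qed simp
  have "0 < b + 1" using assms by auto
  with sums_eqI[OF sums_add[OF s1 s2] s3 coeffs] assms show ?thesis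
    by (simp only: mult.left_commute[of z "a / b"] mult_minus_left divide_divide_eq_left not_False_eq_True simp_thms)
qed

text \<open>This is \<open>kummer_up\<close> for the first parameter b-a, carried over by Kummer's
  transformation M(a,b,z) = exp(z) M(b-a,b,-z); differentiating exp(z) produces the term -z M. The
  proof checks it on coefficients.\<close>

lemma kummer_down:
  assumes "b > 0"
  shows "z * (a / b * kummer (a + 1) (b + 1) z) + (b - a) * kummer a b z - z * kummer a b z
    = (b - a) * kummer (a - 1) b z"
proof -
  note s1 = sums_mult[OF kummer_shift_sums[of "b + 1" "a + 1" z], of "a / b"]
  note s2 = sums_mult[OF kummer_sums[of b a z], of "b - a"]
  note s3 = sums_mult[OF kummer_sums[of b "a - 1" z], of "b - a"]
  note s4 = kummer_shift_sums[of b a z]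
  have coeffs: "a / b * ((case n of 0 \<Rightarrow> 0 | Suc k \<Rightarrow> kummer_coeff (a + 1) (b + 1) k) * z ^ n)
      + (b - a) * (kummer_coeff a b n * z ^ n) - (case n of 0 \<Rightarrow> 0 | Suc k \<Rightarrow> kummer_coeff a b k) * z ^ n
      = (b - a) * (kummer_coeff (a - 1) b n * z ^ n)" for n
  proof (cases n)
    case (Suc k)
    have bk: "b + k > 0" using assms by simp
    have "a / b * kummer_coeff (a + 1) (b + 1) k + (b - a) * kummer_coeff a b (Suc k) - kummer_coeff a b k
        = (b - a) * kummer_coeff (a - 1) b (Suc k)"
      unfolding kummer_coeff_down[of a b k] kummer_coeff_up_up[OF assms, of a k] kummer_coeff_Suc[of a b k]
      using bk by (simp add: divide_simps) (simp add: algebra_simps)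
    then show ?thesis unfolding Suc nat.case by (metis distrib_right left_diff_distrib mult.assoc)
  qed simp
  have "0 < b + 1" using assms by auto
  with sums_eqI[OF sums_diff[OF sums_add[OF s1 s2] s4] s3 coeffs] assms show ?thesis
    by (simp only: mult.left_commute[of z "a / b"] mult_minus_left divide_divide_eq_left not_False_eq_True simp_thms)
qed

text \<open>This relation and the next two serve the Heisenberg operators. Passing from (l,m) to
  (l+1,m+2) turns the Kummer parameters (a,b) into (a,b+1), passing to (l-1,m+2) gives (a-1,b-1),
  and passing to (l-1,m-2) gives (a,b-1); (l+1,m-2) gives (a+1,b+1), the pair that occurs in the
  derivative.\<close>

lemma kummer_keep_up:
  assumes "b > 0"
  shows "kummer a b z - a / b * kummer (a + 1) (b + 1) z = (b - a) / b * kummer a (b + 1) z"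
proof -
  note s1 = sums_mult[OF kummer_sums[of "b + 1" "a + 1" z], of "a / b"]
  note s2 = kummer_sums[of b a z]
  note s3 = sums_mult[OF kummer_sums[of "b + 1" a z], of "(b - a) / b"]
  have coeffs: "kummer_coeff a b n * z ^ n - a / b * (kummer_coeff (a + 1) (b + 1) n * z ^ n)
     = (b - a) / b * (kummer_coeff a (b + 1) n * z ^ n)" for n
  proof -
    have bk: "b + n > 0" using assms by simp
    have "kummer_coeff a b n - a / b * kummer_coeff (a + 1) (b + 1) n
       = (b - a) / b * kummer_coeff a (b + 1) n"
      unfolding kummer_coeff_keep_up[OF assms, of a n] kummer_coeff_up_up[OF assms, of a n]
      using bk assms by (simp add: divide_simps) (simp add: algebra_simps)
    then show ?thesis by (metis left_diff_distrib mult.assoc)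
  qed
  have "0 < b + 1" using assms by auto
  with sums_eqI[OF sums_diff[OF s2 s1] s3 coeffs] assms show ?thesis
    by (simp only: mult.left_commute[of z "a / b"] mult_minus_left divide_divide_eq_left not_False_eq_True simp_thms)
qed

lemma kummer_down_down:
  assumes "b > 1"
  shows "kummer (a - 1) (b - 1) z - kummer a b z = - ((b - a) / (b * (b - 1)) * (z * kummer a (b + 1) z))"
proof -
  have b0: "b > 0" using assms by simp
  note s1 = sums_mult[OF kummer_shift_sums[of "b + 1" a z], of "- ((b - a) / (b * (b - 1)))"]
  note s2 = kummer_sums[of b a z]
  note s3 = kummer_sums[of "b - 1" "a - 1" z]
  have coeffs: "kummer_coeff (a - 1) (b - 1) n * z ^ n - kummer_coeff a b n * z ^ n
     = - ((b - a) / (b * (b - 1))) * ((case n of 0 \<Rightarrow> 0 | Suc k \<Rightarrow> kummer_coeff a (b + 1) k) * z ^ n)" for n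
  proof (cases n)
    case (Suc k)
    have bk: "b + k > 0" "b - 1 > 0" using assms by auto
    have "kummer_coeff (a - 1) (b - 1) (Suc k) - kummer_coeff a b (Suc k)
       = - ((b - a) / (b * (b - 1))) * kummer_coeff a (b + 1) k"
      unfolding kummer_coeff_keep_up[OF b0, of a k] kummer_coeff_down_down[of a b k] kummer_coeff_Suc[of a b k]
      using bk b0 by (simp add: divide_simps) (simp add: algebra_simps)
    then show ?thesis unfolding Suc nat.case by (metis left_diff_distrib mult.assoc)
  qed simp
  have "0 < b + 1" "0 < b - 1" using assms by auto
  with sums_eqI[OF sums_diff[OF s3 s2] s1 coeffs] assms show ?thesis
    by (simp only: mult.left_commute[of z "a / b"] mult_minus_left divide_divide_eq_left not_False_eq_True simp_thms)
qed

lemma kummer_keep_down: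
  assumes "b > 1"
  shows "kummer a (b - 1) z - kummer a b z = a / (b * (b - 1)) * (z * kummer (a + 1) (b + 1) z)"
proof -
  have b0: "b > 0" using assms by simp
  note s1 = sums_mult[OF kummer_shift_sums[of "b + 1" "a + 1" z], of "a / b / (b - 1)"]
  note s2 = kummer_sums[of b a z]
  note s3 = kummer_sums[of "b - 1" a z]
  have coeffs: "kummer_coeff a (b - 1) n * z ^ n - kummer_coeff a b n * z ^ n
     = a / b / (b - 1) * ((case n of 0 \<Rightarrow> 0 | Suc k \<Rightarrow> kummer_coeff (a + 1) (b + 1) k) * z ^ n)" for n
  proof (cases n)
    case (Suc k)
    have bk: "b + k > 0" "b - 1 > 0" using assms by auto
    have "kummer_coeff a (b - 1) (Suc k) - kummer_coeff a b (Suc k)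
       = a / b * kummer_coeff (a + 1) (b + 1) k / (b - 1)"
      unfolding kummer_coeff_up_up[OF b0, of a k] kummer_coeff_keep_down[of a b k] kummer_coeff_Suc[of a b k]
      using bk b0 by (simp add: divide_simps) (simp add: algebra_simps)
    then show ?thesis unfolding Suc nat.case
      by (metis (no_types, lifting) left_diff_distrib mult.assoc mult.commute times_divide_eq_right)
  qed simp
  have "0 < b + 1" "0 < b - 1" using assms by auto
  with sums_eqI[OF sums_diff[OF s3 s2] s1 coeffs] assms show ?thesis
    by (simp only: mult.left_commute[of z "a / b"] mult_minus_left divide_divide_eq_left not_False_eq_True simp_thms)
qed

section \<open>The radial profiles\<close>

definition osc :: "nat \<Rightarrow> int \<Rightarrow> real \<Rightarrow> real" where
  "osc l m y = y ^ l * exp (- (y\<^sup>2 / 2)) * kummer ((2 * real l + 1 - of_int m) / 4) (l + 1/2) (y\<^sup>2)"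

text \<open>The product rule for \<open>osc\<close>, with M' = (a/b) M(a+1,b+1). At l = 0 the
  truncated exponent \<open>l - 1\<close> is harmless because of the factor l.\<close>

definition osc' :: "nat \<Rightarrow> int \<Rightarrow> real \<Rightarrow> real" where
  "osc' l m y = (l * y ^ (l - 1) - y * y ^ l) * exp (- (y\<^sup>2 / 2)) * kummer ((2 * real l + 1 - of_int m) / 4) (l + 1/2) (y\<^sup>2)
     + y ^ l * exp (- (y\<^sup>2 / 2)) * (2 * y * ((2 * real l + 1 - of_int m) / 4 / (l + 1/2)
         * kummer ((2 * real l + 1 - of_int m) / 4 + 1) (l + 1/2 + 1) (y\<^sup>2)))"

lemma DERIV_osc: "(osc l m has_real_derivative osc' l m y) (at y)"
proof -
  note [derivative_intros] = DERIV_chain2[OF DERIV_kummer]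
  have "l + 1/2 > (0::real)" by simp
  then show ?thesis
    unfolding osc_def[abs_def] osc'_def
    by (auto intro!: derivative_eq_intros simp: algebra_simps)
qed

lemma osc_minus: "osc l m (- y) = (-1) ^ l * osc l m y"
  by (simp add: osc_def power_minus[of y])

text \<open>In terms of the Kummer parameters this is (l-1)(b-a) / (b(b-1)), since b-a = (m+2l+1)/4
  and 4l^2-1 = 4b(b-1). Replacing m by -m replaces b-a by a.\<close>

definition up_coeff :: "nat \<Rightarrow> int \<Rightarrow> real" where
  "up_coeff l m = (real l - 1) * (of_int m + 2 * real l + 1) / (4 * real l ^ 2 - 1)"

text \<open>With the Gaussian factor E, differentiation gives y f - f' = 2 y^(l+1) E (M - M') - l
  y^(l-1) E M. Here M - M' is a multiple of M(a,b+1), and M splits into M(a-1,b-1) and a multiple of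
  y^2 M(a,b+1). Up to the common factor (b-a)/(b(b-1)) the contributions to M(a,b+1) add up to
  2(b-1) - l = l - 1: this is the origin of the factor that makes the low part invariant.\<close>

lemma osc_raise:
  "y * osc l m y - osc' l m y = - (l * osc (l - 1) (m + 2) y) + up_coeff l m * osc (l + 1) (m + 2) y"
proof -
  define E where "E = exp (- (y\<^sup>2 / 2))"
  define a where "a = (2 * real l + 1 - of_int m) / 4"
  define b where "b = l + 1 / (2::real)"
  have b0: "b > 0" by (simp add: b_def)
  have m: "real_of_int m = 2 * b - 4 * a" unfolding a_def b_def by argo
  define M where "M = kummer a b (y\<^sup>2)"
  define M1 where "M1 = a / b * kummer (a + 1) (b + 1) (y\<^sup>2)"
  define M2 where "M2 = kummer a (b + 1) (y\<^sup>2)"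
  have k1: "M - M1 = (b - a) / b * M2"
    using kummer_keep_up[OF b0, of a "y\<^sup>2"] unfolding M_def M1_def M2_def .
  have o: "osc l m y = y ^ l * E * M" "osc' l m y = (l * y ^ (l - 1) - y * y ^ l) * E * M + y ^ l * E * (2 * y * M1)"
    unfolding osc_def osc'_def E_def M_def M1_def a_def b_def by (rule refl)+
  have pa: "(2 * real (l + 1) + 1 - real_of_int (m + 2)) / 4 = a" "real (l + 1) + 1 / 2 = b + 1"
    unfolding a_def b_def of_int_add of_int_diff of_int_numeral of_nat_add of_nat_Suc of_nat_1 by argo+
  have p: "osc (l + 1) (m + 2) y = y * y ^ l * E * M2"
    unfolding osc_def E_def M2_def pa by simp
  show ?thesis
  proof (cases l)
    \<comment> \<open>Here b-1 = -1/2 lies outside the range of \<open>kummer_down_down\<close>, but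
      the term with \<open>l - 1\<close> has coefficient 0 and the relation for M - M'
      suffices.\<close>
    case 0
    then have b: "b = 1/2" by (simp add: b_def)
    have "(b - a) / b = 1 - 2 * a" unfolding b by simp
    with k1 have "M - M1 = (1 - 2 * a) * M2" by (simp only:)
    then have M1: "M1 = M - (1 - 2 * a) * M2" by argo
    have m: "real_of_int m = 1 - 4 * a" using m b by simp
    show ?thesis unfolding up_coeff_def o p M1 m using 0 by (simp add: algebra_simps)
  next
    case (Suc k)
    have b1: "b > 1" by (simp add: b_def Suc)
    define M3 where "M3 = kummer (a - 1) (b - 1) (y\<^sup>2)"
    have k2: "M3 - M = - ((b - a) / (b * (b - 1)) * (y\<^sup>2 * M2))"
      using kummer_down_down[OF b1, of a "y\<^sup>2"] unfolding M_def M2_def M3_def .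
    have pa: "(2 * real k + 1 - real_of_int (m + 2)) / 4 = a - 1" "real k + 1 / 2 = b - 1"
      unfolding Suc a_def b_def of_int_add of_int_diff of_int_numeral of_nat_add of_nat_Suc of_nat_1 by argo+
  have r: "osc (l - 1) (m + 2) y = y ^ k * E * M3"
      unfolding osc_def E_def M3_def Suc diff_Suc_1 pa by simp
    have l: "real l = b - 1/2" by (simp add: b_def)
    have d: "4 * (b - 1/2)\<^sup>2 - 1 = 4 * b * (b - 1)" by (simp add: power2_eq_square algebra_simps)
    have e1: "M1 = M - (b - a) / b * M2" using k1 by simp
    have e2: "M3 = M - (b - a) / (b * (b - 1)) * (y\<^sup>2 * M2)" using k2 by simp
    have yl: "y ^ l = y * y ^ k" "y ^ (l - 1) = y ^ k" by (simp_all add: Suc)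
    show ?thesis
      unfolding up_coeff_def o p r yl unfolding l m d e1 e2
      using b1 by (simp add: divide_simps) (simp add: algebra_simps power2_eq_square)
  qed
qed

text \<open>The derivative of the Gaussian cancels y f, leaving l y^(l-1) E M + 2 (a/b) y^(l+1) E
  M(a+1,b+1). Rewriting M by \<open>kummer_keep_down\<close> again produces 2(b-1) - l = l -
  1.\<close>

lemma osc_lower:
  "y * osc l m y + osc' l m y = l * osc (l - 1) (m - 2) y + up_coeff l (- m) * osc (l + 1) (m - 2) y"
proof -
  define E where "E = exp (- (y\<^sup>2 / 2))"
  define a where "a = (2 * real l + 1 - of_int m) / 4"
  define b where "b = l + 1 / (2::real)"
  have b0: "b > 0" by (simp add: b_def)
  have m: "real_of_int m = 2 * b - 4 * a" unfolding a_def b_def by argo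
  define M where "M = kummer a b (y\<^sup>2)"
  define M1 where "M1 = kummer (a + 1) (b + 1) (y\<^sup>2)"
  have o: "osc l m y = y ^ l * E * M" "osc' l m y = (l * y ^ (l - 1) - y * y ^ l) * E * M + y ^ l * E * (2 * y * (a / b * M1))"
    unfolding osc_def osc'_def E_def M_def M1_def a_def b_def by (rule refl)+
  have pa: "(2 * real (l + 1) + 1 - real_of_int (m - 2)) / 4 = a + 1" "real (l + 1) + 1 / 2 = b + 1"
    unfolding a_def b_def of_int_add of_int_diff of_int_numeral of_nat_add of_nat_Suc of_nat_1 by argo+
  have p: "osc (l + 1) (m - 2) y = y * y ^ l * E * M1"
    unfolding osc_def E_def M1_def pa by simp
  show ?thesis
  proof (cases l)
    case 0
    then have b: "b = 1/2" by (simp add: b_def)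
    have m: "real_of_int m = 1 - 4 * a" using m b by simp
    show ?thesis unfolding up_coeff_def o p of_int_minus m b using 0 by (simp add: algebra_simps)
  next
    case (Suc k)
    have b1: "b > 1" by (simp add: b_def Suc)
    define M3 where "M3 = kummer a (b - 1) (y\<^sup>2)"
    have k2: "M3 - M = a / (b * (b - 1)) * (y\<^sup>2 * M1)"
      using kummer_keep_down[OF b1, of a "y\<^sup>2"] unfolding M_def M1_def M3_def .
    have pa: "(2 * real k + 1 - real_of_int (m - 2)) / 4 = a" "real k + 1 / 2 = b - 1"
      unfolding Suc a_def b_def of_int_add of_int_diff of_int_numeral of_nat_add of_nat_Suc of_nat_1 by argo+
  have r: "osc (l - 1) (m - 2) y = y ^ k * E * M3"
      unfolding osc_def E_def M3_def Suc diff_Suc_1 pa by simp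
    have l: "real l = b - 1/2" by (simp add: b_def)
    have d: "4 * (b - 1/2)\<^sup>2 - 1 = 4 * b * (b - 1)" by (simp add: power2_eq_square algebra_simps)
    define c where "c = a / (b * (b - 1))"
    have e2: "M3 = M + c * (y\<^sup>2 * M1)" unfolding c_def k2[symmetric] by simp
    have ab: "a / b = c * (b - 1)" using b1 by (simp add: c_def)
    have "(b - 1/2 - 1) * (real_of_int (- m) + 2 * (b - 1/2) + 1) / (4 * b * (b - 1))
        = ((b - 3/2) * (4 * a)) / (4 * (b * (b - 1)))" using m by simp
    also have "\<dots> = (b - 3/2) * c" unfolding c_def by (simp only: mult.left_commute[of _ 4 a]) simp
    finally have g: "(b - 1/2 - 1) * (real_of_int (- m) + 2 * (b - 1/2) + 1) / (4 * b * (b - 1))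
        = (b - 3/2) * c" .
    have yl: "y ^ l = y * y ^ k" "y ^ (l - 1) = y ^ k" by (simp_all add: Suc)
    show ?thesis
      unfolding up_coeff_def o p r yl unfolding l d g unfolding m e2 ab
      by (simp add: algebra_simps power2_eq_square)
  qed
qed

text \<open>Twice the radial part of \<open>\<eta>\<^sup>+\<close> at weight m; the term (m+1)/2
  collects the \<theta>-derivative and the constant 1/2. On y^l E M the operator acts as -2 (z d/dz
  + (b-a) - z) on M at z = y^2, which is the left side of \<open>kummer_down\<close>.\<close>

lemma osc_eta_plus:
  "y\<^sup>2 * osc l m y - y * osc' l m y - (m + 1) / 2 * osc l m y = - ((m + 2 * l + 1) / 2) * osc l (m + 4) y"
proof -
  define E where "E = exp (- (y\<^sup>2 / 2))"
  define a where "a = (2 * real l + 1 - of_int m) / 4"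
  define b where "b = l + 1 / (2::real)"
  have b0: "b > 0" by (simp add: b_def)
  have m: "real_of_int m = 2 * b - 4 * a" and l: "real l = b - 1/2"
    unfolding a_def b_def by argo+
  define M where "M = kummer a b (y\<^sup>2)"
  define M1 where "M1 = a / b * kummer (a + 1) (b + 1) (y\<^sup>2)"
  define M2 where "M2 = kummer (a - 1) b (y\<^sup>2)"
  have k: "y\<^sup>2 * M1 = (b - a) * M2 - (b - a) * M + y\<^sup>2 * M"
    using kummer_down[OF b0, of "y\<^sup>2" a] unfolding M_def M1_def M2_def by argo
  have o: "osc l m y = y ^ l * E * M" "osc' l m y = (l * y ^ (l - 1) - y * y ^ l) * E * M + y ^ l * E * (2 * y * M1)"
    unfolding osc_def osc'_def E_def M_def M1_def a_def b_def by (rule refl)+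
  have pa: "(2 * real l + 1 - real_of_int (m + 4)) / 4 = a - 1" "real l + 1 / 2 = b"
    unfolding a_def b_def of_int_add of_int_diff of_int_numeral of_nat_add of_nat_Suc of_nat_1 by argo+
  have p: "osc l (m + 4) y = y ^ l * E * M2"
    unfolding osc_def E_def M2_def pa by simp
  have yl: "y * (l * y ^ (l - 1)) = l * y ^ l" by (cases l) auto
  have "y * osc' l m y = (y * (l * y ^ (l - 1)) - y\<^sup>2 * y ^ l) * E * M + y ^ l * E * (2 * (y\<^sup>2 * M1))"
    unfolding o by (simp add: algebra_simps power2_eq_square)
  note Y = this[unfolded yl k, unfolded l]
  show ?thesis
    unfolding Y o(1) p m l by (simp add: algebra_simps add_divide_distrib diff_divide_distrib)
qed

text \<open>The Gaussian now cancels the term in y^2, and the operator acts as -2 (z d/dz + a) on M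
  at z = y^2, so \<open>kummer_up\<close> applies.\<close>

lemma osc_eta_minus:
  "- (y * osc' l m y) + (m - 1) / 2 * osc l m y - y\<^sup>2 * osc l m y = (m - 2 * l - 1) / 2 * osc l (m - 4) y"
proof -
  define E where "E = exp (- (y\<^sup>2 / 2))"
  define a where "a = (2 * real l + 1 - of_int m) / 4"
  define b where "b = l + 1 / (2::real)"
  have b0: "b > 0" by (simp add: b_def)
  have m: "real_of_int m = 2 * b - 4 * a" and l: "real l = b - 1/2"
    unfolding a_def b_def by argo+
  define M where "M = kummer a b (y\<^sup>2)"
  define M1 where "M1 = a / b * kummer (a + 1) (b + 1) (y\<^sup>2)"
  define M2 where "M2 = kummer (a + 1) b (y\<^sup>2)"
  have k: "y\<^sup>2 * M1 = a * M2 - a * M"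
    using kummer_up[OF b0, of "y\<^sup>2" a] unfolding M_def M1_def M2_def by argo
  have o: "osc l m y = y ^ l * E * M" "osc' l m y = (l * y ^ (l - 1) - y * y ^ l) * E * M + y ^ l * E * (2 * y * M1)"
    unfolding osc_def osc'_def E_def M_def M1_def a_def b_def by (rule refl)+
  have pa: "(2 * real l + 1 - real_of_int (m - 4)) / 4 = a + 1" "real l + 1 / 2 = b"
    unfolding a_def b_def of_int_add of_int_diff of_int_numeral of_nat_add of_nat_Suc of_nat_1 by argo+
  have p: "osc l (m - 4) y = y ^ l * E * M2"
    unfolding osc_def E_def M2_def pa by simp
  have yl: "y * (l * y ^ (l - 1)) = l * y ^ l" by (cases l) auto
  have "y * osc' l m y = (y * (l * y ^ (l - 1)) - y\<^sup>2 * y ^ l) * E * M + y ^ l * E * (2 * (y\<^sup>2 * M1))"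
    unfolding o by (simp add: algebra_simps power2_eq_square)
  note Y = this[unfolded yl k, unfolded l]
  show ?thesis
    unfolding Y o(1) p m l by (simp add: algebra_simps add_divide_distrib diff_divide_distrib)
qed

section \<open>Smoothness of the radial profiles\<close>

fun cont_diff :: "nat \<Rightarrow> (real \<Rightarrow> complex) \<Rightarrow> bool" where
  "cont_diff 0 f \<longleftrightarrow> continuous_on UNIV f"
| "cont_diff (Suc k) f \<longleftrightarrow> (\<exists>f'. (\<forall>x. (f has_vector_derivative f' x) (at x)) \<and> cont_diff k f')"

lemma cont_diff_SucI: "(\<And>x. (f has_vector_derivative f' x) (at x)) \<Longrightarrow> cont_diff k f' \<Longrightarrow> cont_diff (Suc k) f"
  by auto

lemma cont_diff_mono: "cont_diff (Suc k) f \<Longrightarrow> cont_diff k f"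
proof (induction k arbitrary: f)
  case 0
  then obtain f' where "\<And>x. (f has_vector_derivative f' x) (at x)" by auto
  then have "continuous_on UNIV f"
    by (intro continuous_at_imp_continuous_on ballI) (metis has_vector_derivative_continuous)
  then show ?case by simp
next
  case (Suc k)
  then obtain f' where f': "\<And>x. (f has_vector_derivative f' x) (at x)" "cont_diff (Suc k) f'"
    by (metis cont_diff.simps(2))
  from Suc.IH[OF f'(2)] show ?case by (rule cont_diff_SucI[OF f'(1)])
qed

lemma cont_diff_add: "cont_diff k f \<Longrightarrow> cont_diff k g \<Longrightarrow> cont_diff k (\<lambda>x. f x + g x)"
proof (induction k arbitrary: f g)
  case 0 then show ?case by (auto intro: continuous_on_add)
next
  case (Suc k)
  then obtain f' g' where "\<And>x. (f has_vector_derivative f' x) (at x)" "cont_diff k f'"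
    "\<And>x. (g has_vector_derivative g' x) (at x)" "cont_diff k g'" by auto
  with Suc.IH show ?case
    by (intro cont_diff_SucI[of _ "\<lambda>x. f' x + g' x"] has_vector_derivative_add)
qed

lemma cont_diff_mult: "cont_diff k f \<Longrightarrow> cont_diff k g \<Longrightarrow> cont_diff k (\<lambda>x. f x * g x)"
proof (induction k arbitrary: f g)
  case 0 then show ?case by (auto intro: continuous_on_mult)
next
  case (Suc k)
  obtain f' g' where d: "\<And>x. (f has_vector_derivative f' x) (at x)" "cont_diff k f'"
    "\<And>x. (g has_vector_derivative g' x) (at x)" "cont_diff k g'" using Suc.prems by auto
  have "cont_diff k (\<lambda>x. f x * g' x + f' x * g x)"
    using d Suc.prems by (intro cont_diff_add Suc.IH) (auto intro: cont_diff_mono simp del: cont_diff.simps)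
  then show ?case by (rule cont_diff_SucI[rotated]) (intro has_vector_derivative_mult d)
qed

lemma cont_diff_const: "cont_diff k (\<lambda>x. c)"
  by (induction k arbitrary: c) (auto intro!: exI[of _ "\<lambda>x. 0"])

lemma cont_diff_id: "cont_diff k (\<lambda>x. complex_of_real x)"
proof (cases k)
  case (Suc j)
  have "((\<lambda>x. complex_of_real x) has_vector_derivative 1) (at x)" for x
    using has_vector_derivative_of_real[OF DERIV_ident] by simp
  with Suc show ?thesis by (auto intro!: exI[of _ "\<lambda>x. 1"] simp: cont_diff_const)
qed (auto intro: continuous_intros)

lemma cont_diff_power: "cont_diff k (\<lambda>x. complex_of_real x ^ n)"
  by (induction n) (auto intro: cont_diff_const cont_diff_mult cont_diff_id)

text \<open>The derivative is -x times the function itself, so the product rule closes the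
  induction.\<close>

lemma cont_diff_exp_sq: "cont_diff k (\<lambda>x. complex_of_real (exp (- (x\<^sup>2 / 2))))"
proof (induction k)
  case 0
  show ?case by (auto intro!: continuous_intros)
next
  case (Suc k)
  have "((\<lambda>x. complex_of_real (exp (- (x\<^sup>2 / 2)))) has_vector_derivative
      (-1) * (of_real x * of_real (exp (- (x\<^sup>2 / 2))))) (at x)" for x
    by (auto intro!: derivative_eq_intros has_vector_derivative_of_real[THEN has_vector_derivative_eq_rhs])
  then show ?case
    by (rule cont_diff_SucI) (intro cont_diff_mult cont_diff_const cont_diff_id Suc.IH)
qed

text \<open>Differentiation gives x times a function of the same kind with parameters (a+1,b+1);
  hence the induction generalises over both parameters.\<close>

lemma cont_diff_kummer_sq:
  assumes "b > 0"
  shows "cont_diff k (\<lambda>x. complex_of_real (kummer a b (x\<^sup>2)))"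
  using assms
proof (induction k arbitrary: a b)
  case 0
  then have "((\<lambda>x. kummer a b (x\<^sup>2)) has_real_derivative a / b * kummer (a + 1) (b + 1) (x\<^sup>2) * (2 * x)) (at x)" for x
    by (intro DERIV_chain2[OF DERIV_kummer]) (auto intro!: derivative_eq_intros)
  then have "continuous_on UNIV (\<lambda>x. kummer a b (x\<^sup>2))"
    by (meson DERIV_isCont continuous_at_imp_continuous_on)
  then show ?case by (auto intro: continuous_intros)
next
  case (Suc k)
  have "((\<lambda>x. kummer a b (x\<^sup>2)) has_real_derivative a / b * kummer (a + 1) (b + 1) (x\<^sup>2) * (2 * x)) (at x)" for x
    using Suc.prems by (intro DERIV_chain2[OF DERIV_kummer]) (auto intro!: derivative_eq_intros)
  from has_vector_derivative_of_real[OF this, where 'a = complex]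
  have "((\<lambda>x. complex_of_real (kummer a b (x\<^sup>2))) has_vector_derivative
      of_real (a / b) * of_real (kummer (a + 1) (b + 1) (x\<^sup>2)) * (2 * of_real x)) (at x)" for x
    by simp
  then show ?case
    by (rule cont_diff_SucI) (use Suc.prems in \<open>intro cont_diff_mult cont_diff_const cont_diff_id Suc.IH; simp\<close>)
qed

text \<open>The smooth factor that remains after splitting off y^l. Its value 1 at 0 decides whether
  solutions on the two half axes can be glued with opposite signs.\<close>

definition osc_cofactor :: "nat \<Rightarrow> int \<Rightarrow> real \<Rightarrow> complex" where
  "osc_cofactor l m y = of_real (exp (- (y\<^sup>2 / 2))) *
     of_real (kummer ((2 * real l + 1 - of_int m) / 4) (l + 1/2) (y\<^sup>2))"

lemma of_real_osc: "complex_of_real (osc l m y) = of_real y ^ l * osc_cofactor l m y"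
  by (simp add: osc_def osc_cofactor_def)

lemma cont_diff_osc_cofactor: "cont_diff k (osc_cofactor l m)"
  unfolding osc_cofactor_def[abs_def] by (intro cont_diff_mult cont_diff_exp_sq cont_diff_kummer_sq) simp

lemma osc_cofactor_0: "osc_cofactor l m 0 = 1"
  by (simp add: osc_cofactor_def)

lemma cont_diff_osc: "cont_diff k (\<lambda>y. complex_of_real (osc l m y))"
  unfolding of_real_osc by (intro cont_diff_mult cont_diff_power cont_diff_osc_cofactor)

text \<open>Half the difference of \<open>osc_lower\<close> and \<open>osc_raise\<close> writes
  \<open>osc'\<close> as a combination of neighbouring profiles; this is the termwise derivative of
  that combination, which keeps second derivatives of Kummer functions out of sight.\<close>

definition osc'' :: "nat \<Rightarrow> int \<Rightarrow> real \<Rightarrow> real" where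
  "osc'' l m y =
    (l * osc' (l - 1) (m - 2) y
       + up_coeff l (- m) * osc' (l + 1) (m - 2) y
     + (l * osc' (l - 1) (m + 2) y
       - up_coeff l m * osc' (l + 1) (m + 2) y)) / 2"

lemma DERIV_osc': "(osc' l m has_real_derivative osc'' l m y) (at y)"
proof -
  have "osc' l m = (\<lambda>y.
    (l * osc (l - 1) (m - 2) y
       + up_coeff l (- m) * osc (l + 1) (m - 2) y
     + (l * osc (l - 1) (m + 2) y
       - up_coeff l m * osc (l + 1) (m + 2) y)) / 2)"
  proof
    fix y
    have "osc' l m y = ((y * osc l m y + osc' l m y) - (y * osc l m y - osc' l m y)) / 2" by simp
    also have "\<dots> = (l * osc (l - 1) (m - 2) y
       + up_coeff l (- m) * osc (l + 1) (m - 2) y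
     + (l * osc (l - 1) (m + 2) y
       - up_coeff l m * osc (l + 1) (m + 2) y)) / 2"
      unfolding osc_raise osc_lower by (simp only: diff_diff_eq2 diff_add_eq add_diff_eq diff_minus_eq_add minus_add_distrib add.assoc diff_diff_add minus_diff_eq
        diff_conv_add_uminus minus_minus)
    finally show "osc' l m y = (l * osc (l - 1) (m - 2) y
       + up_coeff l (- m) * osc (l + 1) (m - 2) y
     + (l * osc (l - 1) (m + 2) y
       - up_coeff l m * osc (l + 1) (m + 2) y)) / 2" .
  qed
  then show ?thesis
    unfolding osc''_def
    by (auto intro!: DERIV_osc DERIV_cdivide DERIV_add DERIV_diff DERIV_cmult)
qed

text \<open>The equation encodes \<open>\<eta>\<^sup>-\<eta>\<^sup>+\<close> acting by a scalar.
  Differentiating \<open>osc_eta_plus\<close> links the derivative of the profile at m+4 to f'',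
  while \<open>osc_eta_minus\<close> at m+4 leads back to f; eliminating the profile at m+4 and its
  derivative leaves the equation.\<close>

lemma osc_ode: "y\<^sup>2 * osc'' l m y = (y ^ 4 - m * y\<^sup>2 + real l * (real l - 1)) * osc l m y"
proof -
  define c where "c = (real_of_int m + 2 * real l + 1) / 2"
  define G D D2 G4 D4 where defs: "G = osc l m" "D = osc' l m" "D2 = osc'' l m" "G4 = osc l (m + 4)" "D4 = osc' l (m + 4)"
  define \<mu> :: real where "\<mu> = of_int m"
  have e: "y\<^sup>2 * G y - y * D y - (\<mu> + 1) / 2 * G y = - c * G4 y" for y
    using osc_eta_plus[of y l m] by (simp add: c_def defs \<mu>_def)
  have d1: "((\<lambda>y. y\<^sup>2 * G y - y * D y - (\<mu> + 1) / 2 * G y) has_real_derivative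
      (2 * y * G y + y\<^sup>2 * D y - (D y + y * D2 y) - (\<mu> + 1) / 2 * D y)) (at y)"
    unfolding defs by (auto intro!: derivative_eq_intros DERIV_osc DERIV_osc')
  have d2: "((\<lambda>y. - c * G4 y) has_real_derivative - c * D4 y) (at y)"
    unfolding defs by (intro DERIV_cmult DERIV_osc)
  have d: "2 * y * G y + y\<^sup>2 * D y - (D y + y * D2 y) - (\<mu> + 1) / 2 * D y = - c * D4 y"
    using d1[unfolded e] d2 by (rule DERIV_unique)
  have e2: "- (y * D4 y) + (\<mu> + 3) / 2 * G4 y - y\<^sup>2 * G4 y = (\<mu> + 3 - 2 * real l) / 2 * G y"
    using osc_eta_minus[of y l "m + 4"] by (simp add: \<mu>_def defs add_ac)
  have yD4: "y * D4 y = ((\<mu> + 3) / 2 - y\<^sup>2) * G4 y - (\<mu> + 3 - 2 * real l) / 2 * G y"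
    unfolding e2[symmetric] by (simp add: algebra_simps)
  \<comment> \<open>From here on the equations are multiplied by \<open>c\<close> and never divided
    by it, because \<open>c\<close> is 0 at m = -(2l+1).\<close>
  have "c * G4 y = - (- c * G4 y)" by simp
  also have "\<dots> = y * D y + (\<mu> + 1) / 2 * G y - y\<^sup>2 * G y"
    unfolding e[symmetric] by simp
  finally have cG4: "c * G4 y = y * D y + (\<mu> + 1) / 2 * G y - y\<^sup>2 * G y" .
  have "c * (y * D4 y) = ((\<mu> + 3) / 2 - y\<^sup>2) * (c * G4 y) - c * ((\<mu> + 3 - 2 * real l) / 2 * G y)"
    unfolding yD4 by (simp add: algebra_simps)
  also note cG4
  finally have cyD4: "c * (y * D4 y) = ((\<mu> + 3) / 2 - y\<^sup>2) * (y * D y + (\<mu> + 1) / 2 * G y - y\<^sup>2 * G y)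
      - c * ((\<mu> + 3 - 2 * real l) / 2 * G y)" .
  have "y * D2 y = 2 * y * G y + y\<^sup>2 * D y - D y - (\<mu> + 1) / 2 * D y - (- c * D4 y)"
    unfolding d[symmetric] by simp
  then have "y\<^sup>2 * D2 y = y * (2 * y * G y + y\<^sup>2 * D y - D y - (\<mu> + 1) / 2 * D y) + c * (y * D4 y)"
    by (simp add: power2_eq_square mult.assoc distrib_left mult.left_commute)
  also have "\<dots> = (y ^ 4 - \<mu> * y\<^sup>2 + real l * (real l - 1)) * G y"
    unfolding cyD4 unfolding c_def unfolding \<mu>_def[symmetric]
    by (simp add: power2_eq_square power4_eq_xxxx algebra_simps add_divide_distrib diff_divide_distrib)
  finally show ?thesis unfolding defs \<mu>_def .
qed

section \<open>Uniqueness for the radial equation\<close>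

text \<open>Gronwall's argument for the energy E = |h|^2 + |h'|^2. Its derivative 2(1+p) (h
  \<bullet> h') is bounded by (1+C) E between y0 and y, so E exp(-(1+C)t) does not increase and E
  exp((1+C)t) does not decrease there. As E vanishes at y0, E(y) \<le> 0 on either side.\<close>

lemma second_order_ode_unique:
  fixes h :: "real \<Rightarrow> complex" and p :: "real \<Rightarrow> real"
  assumes h: "\<And>y. y > 0 \<Longrightarrow> (h has_vector_derivative h' y) (at y)"
    and h': "\<And>y. y > 0 \<Longrightarrow> (h' has_vector_derivative p y *\<^sub>R h y) (at y)"
    and p: "continuous_on {0<..} p"
    and y0: "y0 > 0" "h y0 = 0" "h' y0 = 0" and y: "y > 0"
  shows "h y = 0"
proof -
  let ?I = "{min y y0..max y y0}"
  have "compact (p ` ?I)"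
    using y y0 by (intro compact_continuous_image continuous_on_subset[OF p]) auto
  then obtain C where C: "\<And>t. t \<in> ?I \<Longrightarrow> \<bar>p t\<bar> \<le> C"
    using compact_imp_bounded by (metis bounded_iff imageI real_norm_def)
  have C0: "C \<ge> 0" using C[of y] by force
  define E where "E t = h t \<bullet> h t + h' t \<bullet> h' t" for t
  define E' where "E' t = 2 * (1 + p t) * (h t \<bullet> h' t)" for t
  have E0: "E y0 = 0" using y0 by (simp add: E_def)
  have dE: "(E has_real_derivative E' t) (at t)" if "t > 0" for t
  proof -
    note inner = bounded_bilinear.has_vector_derivative[OF bounded_bilinear_inner]
    have "(E has_vector_derivative (h t \<bullet> h' t + h' t \<bullet> h t)
        + (h' t \<bullet> (p t *\<^sub>R h t) + (p t *\<^sub>R h t) \<bullet> h' t)) (at t)"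
      unfolding E_def[abs_def] by (intro has_vector_derivative_add inner h h' that)
    then show ?thesis
      by (simp add: has_real_derivative_iff_has_vector_derivative E'_def inner_commute algebra_simps)
  qed
  have bound: "\<bar>E' t\<bar> \<le> (1 + C) * E t" if "t \<in> ?I" for t
  proof -
    have "2 * \<bar>h t \<bullet> h' t\<bar> \<le> 2 * (norm (h t) * norm (h' t))"
      using Cauchy_Schwarz_ineq2 by simp
    also have "\<dots> \<le> E t"
      using sum_squares_bound[of "norm (h t)" "norm (h' t)"]
      by (simp add: E_def dot_square_norm power2_eq_square)
    finally have 1: "2 * \<bar>h t \<bullet> h' t\<bar> \<le> E t" .
    have "\<bar>E' t\<bar> = \<bar>1 + p t\<bar> * (2 * \<bar>h t \<bullet> h' t\<bar>)" unfolding E'_def abs_mult by simp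
    also have "\<dots> \<le> (1 + C) * E t"
      using C[OF that] C0 1 by (intro mult_mono) auto
    finally show ?thesis .
  qed
  have "E y \<le> 0"
  proof (cases "y0 \<le> y")
    case True
    have "E y0 * exp (- (1 + C) * y0) \<ge> E y * exp (- (1 + C) * y)"
    proof (rule DERIV_nonpos_imp_nonincreasing[OF True], intro exI conjI)
      fix t assume t: "y0 \<le> t" "t \<le> y"
      show "((\<lambda>t. E t * exp (- (1 + C) * t)) has_real_derivative
          (E' t - (1 + C) * E t) * exp (- (1 + C) * t)) (at t)"
        using t y0 by (auto intro!: derivative_eq_intros dE simp: algebra_simps)
      show "(E' t - (1 + C) * E t) * exp (- (1 + C) * t) \<le> 0"
        using bound[of t] t True by (intro mult_nonpos_nonneg) auto
    qed
    then show ?thesis by (simp add: E0 mult_le_0_iff)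
  next
    case False
    then have "y \<le> y0" by simp
    then have "E y * exp ((1 + C) * y) \<le> E y0 * exp ((1 + C) * y0)"
    proof (rule DERIV_nonneg_imp_nondecreasing, intro exI conjI)
      fix t assume t: "y \<le> t" "t \<le> y0"
      show "((\<lambda>t. E t * exp ((1 + C) * t)) has_real_derivative
          (E' t + (1 + C) * E t) * exp ((1 + C) * t)) (at t)"
        using t y by (auto intro!: derivative_eq_intros dE simp: algebra_simps)
      show "0 \<le> (E' t + (1 + C) * E t) * exp ((1 + C) * t)"
        using bound[of t] t False by (intro mult_nonneg_nonneg) auto
    qed
    then show ?thesis by (simp add: E0 mult_le_0_iff)
  qed
  then have "h y \<bullet> h y \<le> 0"
    unfolding E_def using inner_ge_zero[of "h' y"] by linarith
  then show ?thesis by (metis inner_ge_zero inner_eq_zero_iff order_antisym)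
qed

text \<open>For small y the Kummer factor is close to its value 1 at 0. Such a point normalises the
  constant in the uniqueness argument and shows that basis vectors are nonzero.\<close>

lemma osc_pos_near_0: "\<exists>y0>0. osc l m y0 > 0"
proof -
  let ?k = "kummer ((2 * real l + 1 - of_int m) / 4) (l + 1/2)"
  have "isCont ?k 0" by (rule DERIV_isCont[OF DERIV_kummer]) simp
  then have "\<exists>s>0. \<forall>x. x \<noteq> 0 \<and> norm (x - 0) < s \<longrightarrow> norm (?k x - ?k 0) < 1"
    unfolding isCont_def by (intro LIM_D) auto
  then obtain s where s: "s > 0" "\<And>x. x \<noteq> 0 \<Longrightarrow> \<bar>x\<bar> < s \<Longrightarrow> \<bar>?k x - 1\<bar> < 1" by auto
  define y0 where "y0 = sqrt (s / 2)"
  have y0: "y0 > 0" "y0\<^sup>2 = s / 2" using s(1) by (simp_all add: y0_def)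
  have "?k (y0\<^sup>2) > 0" using s(2)[of "y0\<^sup>2"] s(1) unfolding y0(2) by auto
  then have "osc l m y0 > 0" using y0(1) by (simp add: osc_def)
  with y0(1) show ?thesis by blast
qed

text \<open>
  A function that agrees with \<open>c y\<^sup>n u\<close> to the right of \<open>0\<close> and with \<open>-c y\<^sup>n u\<close> to the left has
  \<open>n\<close>-th one-sided derivatives \<open>\<plusminus>c n! u(0)\<close> at \<open>0\<close>.
\<close>

lemma odd_reflection_vanishes:
  assumes "cont_diff n f" "\<And>k. cont_diff k u"
    and pos: "\<And>y. y > 0 \<Longrightarrow> f y = c * (of_real y ^ n * u y)"
    and neg: "\<And>y. y < 0 \<Longrightarrow> f y = - c * (of_real y ^ n * u y)"
  shows "c * u 0 = 0"
  using assms
proof (induction n arbitrary: f u)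
  case 0
  have lim: "(f \<longlongrightarrow> f 0) (at 0)" "(u \<longlongrightarrow> u 0) (at 0)"
    using 0(1) 0(2)[of 0] by (simp_all add: continuous_on_eq_continuous_at isCont_def)
  have "((\<lambda>y. c * u y) \<longlongrightarrow> f 0) (at_right 0)"
    using filterlim_mono[OF lim(1) order_refl at_le[of "{0<..}" UNIV 0]]
    by (rule tendsto_cong[THEN iffD1, rotated]) (auto simp: eventually_at_filter 0(3))
  moreover have "((\<lambda>y. c * u y) \<longlongrightarrow> c * u 0) (at_right 0)"
    using filterlim_mono[OF lim(2) order_refl at_le[of "{0<..}" UNIV 0]] by (intro tendsto_mult_left) simp
  ultimately have 1: "f 0 = c * u 0" using tendsto_unique[OF trivial_limit_at_right_real] by blast
  have "((\<lambda>y. - c * u y) \<longlongrightarrow> f 0) (at_left 0)"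
    using filterlim_mono[OF lim(1) order_refl at_le[of "{..<0}" UNIV 0]]
    by (rule tendsto_cong[THEN iffD1, rotated]) (auto simp: eventually_at_filter 0(4))
  moreover have "((\<lambda>y. - c * u y) \<longlongrightarrow> - c * u 0) (at_left 0)"
    using filterlim_mono[OF lim(2) order_refl at_le[of "{..<0}" UNIV 0]] by (intro tendsto_mult_left) simp
  ultimately have 2: "f 0 = - c * u 0" using tendsto_unique[OF trivial_limit_at_left_real] by blast
  from 1 2 show ?case by simp
next
  case (Suc n)
  obtain f' where f': "\<And>x. (f has_vector_derivative f' x) (at x)" "cont_diff n f'" using Suc.prems(1) by auto
  obtain u' where u': "\<And>x. (u has_vector_derivative u' x) (at x)" using Suc.prems(2)[of 1] by auto
  have du': "cont_diff k u'" for k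
  proof -
    obtain v where v: "\<And>x. (u has_vector_derivative v x) (at x)" "cont_diff k v"
      using Suc.prems(2)[of "Suc k"] by auto
    have "v = u'" using vector_derivative_unique_at[OF v(1) u'] by blast
    with v show ?thesis by simp
  qed
  \<comment> \<open>The derivative of y^(n+1) u is y^n w with w(0) = (n+1) u(0), so the claim for f'
    and n gives the claim for f and n+1.\<close>
  define w where "w y = of_nat (Suc n) * u y + of_real y * u' y" for y
  have dprod: "((\<lambda>y. c * (of_real y ^ Suc n * u y)) has_vector_derivative c * (of_real y ^ n * w y)) (at y)" for y c
  proof -
    have "((\<lambda>y. complex_of_real y ^ Suc n) has_vector_derivative of_nat (Suc n) * of_real y ^ n) (at y)"
      using has_vector_derivative_of_real[OF DERIV_pow[of "Suc n" y UNIV], where 'a = complex] by simp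
    from has_vector_derivative_mult_right[OF has_vector_derivative_mult[OF this u'], of c]
    show ?thesis by (rule has_vector_derivative_eq_rhs) (simp add: w_def algebra_simps)
  qed
  have "c * w 0 = 0"
  proof (rule Suc.IH[OF f'(2)])
    show "cont_diff k w" for k
      unfolding w_def[abs_def] by (intro cont_diff_add cont_diff_mult cont_diff_const cont_diff_id du' Suc.prems)
    show "f' y = c * (of_real y ^ n * w y)" if "y > 0" for y
      using has_vector_derivative_transform_within_open[OF f'(1), of "{0<..}" y] that Suc.prems(3) dprod
        vector_derivative_unique_at by (metis (no_types, lifting) greaterThan_iff open_greaterThan)
    show "f' y = - c * (of_real y ^ n * w y)" if "y < 0" for y
      using has_vector_derivative_transform_within_open[OF f'(1), of "{..<0}" y] that Suc.prems(4) dprod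
        vector_derivative_unique_at by (metis (no_types, lifting) lessThan_iff open_lessThan)
  qed
  moreover have "c * w 0 = of_nat (Suc n) * (c * u 0)" unfolding w_def by simp
  ultimately have "of_nat (Suc n) * (c * u 0) = 0" by (simp only:)
  then show ?case by (metis mult_eq_0_iff of_nat_eq_0_iff nat.distinct(1))
qed

context
  fixes l :: nat and m :: int and f f' f'' :: "real \<Rightarrow> complex"
  assumes f: "\<And>y. (f has_vector_derivative f' y) (at y)"
    and f': "\<And>y. (f' has_vector_derivative f'' y) (at y)"
    and ode: "\<And>y :: real. of_real (y\<^sup>2) * f'' y = of_real (y ^ 4 - of_int m * y\<^sup>2 + real l * (real l - 1)) * f y"
begin

text \<open>The hypothesis says that the Wronskian of f and \<open>osc l m\<close> vanishes at 0. It
  is constant on the positive axis, because both functions solve g'' = p g there, and so it is 0. At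
  a point where the profile does not vanish, a multiple of it matching the value of f then also
  matches the derivative, and uniqueness applies.\<close>

lemma ode_solution_positive_axis:
  assumes W0: "f 0 * of_real (osc' l m 0) = f' 0 * of_real (osc l m 0)"
  shows "\<exists>c. \<forall>y>0. f y = c * of_real (osc l m y)"
proof -
  define p where "p y = (y ^ 4 - of_int m * y\<^sup>2 + real l * (real l - 1)) / y\<^sup>2" for y :: real
  have fp: "f'' y = of_real (p y) * f y" and gp: "osc'' l m y = p y * osc l m y" if "y > 0" for y
  proof -
    have "of_real (y\<^sup>2) * f'' y = of_real (y\<^sup>2) * (of_real (p y) * f y)"
      using that unfolding ode p_def mult.assoc[symmetric] of_real_mult[symmetric] by simp
    then show "f'' y = of_real (p y) * f y" using that by simp
    have "y\<^sup>2 * osc'' l m y = y\<^sup>2 * (p y * osc l m y)"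
      using that unfolding osc_ode p_def mult.assoc[symmetric] by simp
    then show "osc'' l m y = p y * osc l m y" using that by simp
  qed
  define W where "W y = f y * of_real (osc' l m y) - f' y * of_real (osc l m y)" for y
  note dg = has_vector_derivative_of_real[OF DERIV_osc, where 'a = complex, of l m]
  note dg' = has_vector_derivative_of_real[OF DERIV_osc', where 'a = complex, of l m]
  have dW: "(W has_vector_derivative
      (f y * of_real (osc'' l m y) + f' y * of_real (osc' l m y))
      - (f' y * of_real (osc' l m y) + f'' y * of_real (osc l m y))) (at y)" for y
    unfolding W_def[abs_def]
    by (intro has_vector_derivative_diff has_vector_derivative_mult f f' dg dg')
  have W: "W y = 0" if y: "y > 0" for y
  \<comment> \<open>The point 0 is the exceptional set: p is singular there, so constancy comes from
    the open half axis together with continuity at 0.\<close>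
  proof (rule has_derivative_zero_unique_strong_convex[of "{0..y}" "{0}" W 0 0])
    show "continuous_on {0..y} W"
      using dW by (intro continuous_at_imp_continuous_on ballI) (metis has_vector_derivative_continuous)
    show "W 0 = 0" using W0 by (simp add: W_def)
    fix x assume x: "x \<in> {0..y} - {0}"
    then have "(W has_vector_derivative 0) (at x)"
      using dW[of x] by (simp add: fp gp)
    then show "(W has_derivative (\<lambda>h. 0)) (at x within {0..y})"
      by (auto simp: has_vector_derivative_def intro: has_derivative_at_withinI)
  qed (use y in auto)
  obtain y0 where y0: "y0 > 0" "osc l m y0 > 0" using osc_pos_near_0 by blast
  define c where "c = f y0 / of_real (osc l m y0)"
  define h where "h y = f y - c * of_real (osc l m y)" for y
  define h' where "h' y = f' y - c * of_real (osc' l m y)" for y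
  have "h y = 0" if y: "y > 0" for y
  proof (rule second_order_ode_unique[of h h' p y0 y])
    fix t :: real assume t: "t > 0"
    show "(h has_vector_derivative h' t) (at t)"
      unfolding h_def[abs_def] h'_def
      by (intro has_vector_derivative_diff has_vector_derivative_mult_right f dg)
    have "(h' has_vector_derivative f'' t - c * of_real (osc'' l m t)) (at t)"
      unfolding h'_def[abs_def]
      by (intro has_vector_derivative_diff has_vector_derivative_mult_right f' dg')
    moreover have "f'' t - c * of_real (osc'' l m t) = p t *\<^sub>R h t"
      by (simp add: fp[OF t] gp[OF t] h_def scaleR_conv_of_real algebra_simps)
    ultimately show "(h' has_vector_derivative p t *\<^sub>R h t) (at t)" by simp
  next
    show "continuous_on {0<..} p"
      unfolding p_def[abs_def] by (intro continuous_intros) auto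
    show "h y0 = 0" using y0 by (simp add: h_def c_def)
    have "f' y0 * of_real (osc l m y0) = f y0 * of_real (osc' l m y0)"
      using W[OF y0(1)] by (simp add: W_def)
    then show "h' y0 = 0" using y0 by (simp add: h'_def c_def nonzero_eq_divide_eq)
  qed (use y0 y in auto)
  then show ?thesis unfolding h_def by auto
qed

lemma ode_solution_at_0:
  assumes "l \<ge> 2" shows "f 0 = 0"
proof -
  have "real l * (real l - 1) \<noteq> 0" using assms by auto
  with ode[of 0] show ?thesis by (simp del: of_real_mult of_real_diff)
qed

text \<open>The Wronskian vanishes at 0: for l = 0 both derivatives are 0 there, for l \<ge> 1 both
  values are, f(0) being 0 by oddness if l = 1 and by the equation if l \<ge> 2. The solution on the
  positive axis extends to 0 by continuity and to the negative axis by parity.\<close>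

lemma ode_solution_same_parity:
  assumes parity: "\<And>y. f (- y) = (-1) ^ l * f y"
  shows "\<exists>c. \<forall>y. f y = c * of_real (osc l m y)"
proof -
  have "f 0 * of_real (osc' l m 0) = f' 0 * of_real (osc l m 0)"
  proof (cases l)
    case 0
    have "((\<lambda>y. f (- y)) has_vector_derivative - f' 0) (at 0)"
      using vector_diff_chain_at[of uminus "-1" 0 f "f' 0"] f[of 0]
      by (simp add: o_def has_vector_derivative_minus[OF has_vector_derivative_id, simplified id_def])
    then have "(f has_vector_derivative - f' 0) (at 0)" using parity 0 by simp
    then have "f' 0 = - f' 0" using f[of 0] vector_derivative_unique_at by blast
    then have "f' 0 = 0" by simp
    with 0 show ?thesis by (simp add: osc'_def)
  next
    case (Suc k)
    have "f 0 = 0"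
    proof (cases "k = 0")
      case True
      then have "f 0 = - f 0" using parity[of 0] Suc by simp
      then show ?thesis by simp
    qed (use ode_solution_at_0 Suc in simp)
    with Suc show ?thesis by (simp add: osc_def)
  qed
  from ode_solution_positive_axis[OF this] obtain c where c: "\<And>y. y > 0 \<Longrightarrow> f y = c * of_real (osc l m y)"
    by blast
  have cont: "isCont (\<lambda>y. f y - c * of_real (osc l m y)) 0"
    using f DERIV_isCont[OF DERIV_osc] has_vector_derivative_continuous
    by (intro continuous_intros) blast+
  have "((\<lambda>y. f y - c * of_real (osc l m y)) \<longlongrightarrow> f 0 - c * of_real (osc l m 0)) (at_right 0)"
    using cont unfolding isCont_def by (rule filterlim_mono) (auto simp: at_le)
  moreover have "((\<lambda>y. f y - c * of_real (osc l m y)) \<longlongrightarrow> 0) (at_right 0)"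
    by (rule tendsto_eventually) (auto simp: eventually_at_right_field c intro!: exI[of _ 1])
  ultimately have f0: "f 0 = c * of_real (osc l m 0)"
    using tendsto_unique[OF trivial_limit_at_right_real] by fastforce
  have "f y = c * of_real (osc l m y)" for y
  proof (cases y "0 :: real" rule: linorder_cases)
    case less
    then have "f y = (-1) ^ l * (c * of_real (osc l m (- y)))"
      using parity[of "- y"] c[of "- y"] by simp
    then show ?thesis by (simp add: osc_minus mult_ac flip: power_mult_distrib)
  qed (use c f0 in auto)
  then show ?thesis by blast
qed

text \<open>On the two half axes f is c y^l u and -c y^l u, whose l-th one-sided derivatives at 0
  differ unless c = 0. The bound on l is essential: for l = 0 and l = 1 the equations coincide, and
  each has the profile of the other as a smooth solution of opposite parity.\<close>

lemma ode_solution_opposite_parity: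
  assumes l: "l \<ge> 2" and smooth: "\<And>k. cont_diff k f" and parity: "\<And>y. f (- y) = - ((-1) ^ l * f y)"
  shows "f y = 0"
proof -
  have "f 0 * of_real (osc' l m 0) = f' 0 * of_real (osc l m 0)"
    using l ode_solution_at_0[OF l] by (simp add: osc_def)
  from ode_solution_positive_axis[OF this] obtain c where c: "\<And>y. y > 0 \<Longrightarrow> f y = c * of_real (osc l m y)"
    by blast
  have "f y = - c * (of_real y ^ l * osc_cofactor l m y)" if "y < 0" for y
    using parity[of "- y"] c[of "- y"] that
    by (simp add: osc_minus of_real_osc[symmetric] flip: power_mult_distrib)
  then have "c * osc_cofactor l m 0 = 0"
    using smooth cont_diff_osc_cofactor c by (intro odd_reflection_vanishes[of l f]) (auto simp: of_real_osc)
  then have "c = 0" by (simp add: osc_cofactor_0)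
  have pos: "f y = 0" if "y > 0" for y using c[OF that] \<open>c = 0\<close> by simp
  show ?thesis
    using pos[of y] pos[of "- y"] parity[of y] ode_solution_at_0[OF l]
    by (cases y "0::real" rule: linorder_cases) auto
qed

end

section \<open>Functions of a fixed weight\<close>

definition wave :: "int \<Rightarrow> (real \<Rightarrow> complex) \<Rightarrow> plane_fun" where
  "wave m f = (\<lambda>(\<theta>, y). exp (- (\<i> * of_int m * of_real \<theta> / 2)) * f y)"

lemma wave_apply: "wave m f (\<theta>, y) = exp (- (\<i> * of_int m * of_real \<theta> / 2)) * f y"
  by (simp add: wave_def)

lemma exp_weight_has_vector_derivative:
  "((\<lambda>t. exp (- (\<i> * of_int m * complex_of_real t / 2))) has_vector_derivative
    - (\<i> * of_int m / 2) * exp (- (\<i> * of_int m * of_real t / 2))) (at t)"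
proof -
  have "((\<lambda>z. exp (- (\<i> * of_int m * z / 2))) has_field_derivative
    - (\<i> * of_int m / 2) * exp (- (\<i> * of_int m * of_real t / 2))) (at (of_real t))"
    by (auto intro!: derivative_eq_intros)
  from has_vector_derivative_real_field[OF this] show ?thesis by (simp add: o_def)
qed

lemma has_derivative_wave:
  assumes "(f has_vector_derivative f') (at (snd p))"
  shows "(wave m f has_derivative
    (\<lambda>v. of_real (fst v) * (- (\<i> * of_int m / 2) * wave m f p) +
         of_real (snd v) * (exp (- (\<i> * of_int m * of_real (fst p) / 2)) * f'))) (at p)"
proof -
  have e: "((\<lambda>p. exp (- (\<i> * of_int m * complex_of_real (fst p) / 2))) has_derivative
      (\<lambda>v. fst v *\<^sub>R (- (\<i> * of_int m / 2) * exp (- (\<i> * of_int m * of_real (fst p) / 2))))) (at p)"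
    by (rule has_derivative_compose[OF has_derivative_fst[OF has_derivative_ident]
        exp_weight_has_vector_derivative[unfolded has_vector_derivative_def]])
  have f: "((\<lambda>p. f (snd p)) has_derivative (\<lambda>v. snd v *\<^sub>R f')) (at p)"
    using assms unfolding has_vector_derivative_def
    by (rule has_derivative_compose[OF has_derivative_snd[OF has_derivative_ident]])
  have "wave m f = (\<lambda>p. exp (- (\<i> * of_int m * of_real (fst p) / 2)) * f (snd p))"
    by (auto simp: wave_def)
  with has_derivative_mult[OF e f] show ?thesis
    by (elim has_derivative_eq_rhs[rotated] ssubst)
      (auto simp: fun_eq_iff scaleR_conv_of_real algebra_simps)
qed

text \<open>\<open>frechet_derivative\<close> is additive and homogeneous only on differentiable
  functions, so this condition accompanies every linearity statement about the operators.\<close>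

definition everywhere_diff :: "plane_fun \<Rightarrow> bool" where
  "everywhere_diff F \<longleftrightarrow> (\<forall>p. F differentiable (at p))"

lemma everywhere_diffD: "everywhere_diff F \<Longrightarrow> (F has_derivative frechet_derivative F (at p)) (at p)"
  unfolding everywhere_diff_def using frechet_derivative_works by blast

lemma frechet_derivative_eqI:
  fixes F :: plane_fun
  shows "(F has_derivative F') (at p) \<Longrightarrow> frechet_derivative F (at p) = F'"
  by (metis frechet_derivative_at)

lemma everywhere_diff_wave: "(\<And>y. (f has_vector_derivative f' y) (at y)) \<Longrightarrow> everywhere_diff (wave m f)"
  unfolding everywhere_diff_def differentiable_def using has_derivative_wave by blast

lemma frechet_wave:
  assumes "\<And>y. (f has_vector_derivative f' y) (at y)"
  shows "frechet_derivative (wave m f) (at p) =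
    (\<lambda>v. of_real (fst v) * (- (\<i> * of_int m / 2) * wave m f p) + of_real (snd v) * wave m f' p)"
  using frechet_derivative_eqI[OF has_derivative_wave[OF assms], of m p] by (cases p) (simp add: wave_apply)

lemma D_theta_wave:
  assumes "\<And>y. (f has_vector_derivative f' y) (at y)"
  shows "D_theta (wave m f) = cscale (- (\<i> * of_int m / 2)) (wave m f)"
  unfolding D_theta_def cscale_def frechet_wave[OF assms] by simp

lemma D_y_wave:
  assumes "\<And>y. (f has_vector_derivative f' y) (at y)"
  shows "D_y (wave m f) = wave m f'"
  unfolding D_y_def frechet_wave[OF assms] by simp

lemma frechet_add:
  "everywhere_diff F \<Longrightarrow> everywhere_diff G \<Longrightarrow> frechet_derivative (F + G) (at p) =
    (\<lambda>v. frechet_derivative F (at p) v + frechet_derivative G (at p) v)"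
  unfolding plus_fun_def by (intro frechet_derivative_eqI has_derivative_add everywhere_diffD)

lemma frechet_cscale:
  "everywhere_diff F \<Longrightarrow> frechet_derivative (cscale c F) (at p) = (\<lambda>v. c * frechet_derivative F (at p) v)"
  unfolding cscale_def by (intro frechet_derivative_eqI has_derivative_mult_right everywhere_diffD)

lemma everywhere_diff_add: "everywhere_diff F \<Longrightarrow> everywhere_diff G \<Longrightarrow> everywhere_diff (F + G)"
  unfolding everywhere_diff_def plus_fun_def by (auto intro: differentiable_add)

lemma everywhere_diff_cscale: "everywhere_diff F \<Longrightarrow> everywhere_diff (cscale c F)"
  unfolding everywhere_diff_def cscale_def by (auto intro: differentiable_mult)

lemma everywhere_diff_zero: "everywhere_diff 0"
  unfolding everywhere_diff_def zero_fun_def by simp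

lemma D_add:
  assumes "everywhere_diff F" "everywhere_diff G"
  shows "D_y (F + G) = D_y F + D_y G" "D_theta (F + G) = D_theta F + D_theta G"
  using assms by (simp_all add: D_y_def D_theta_def frechet_add) (simp_all add: plus_fun_def)

lemma D_cscale:
  assumes "everywhere_diff F"
  shows "D_y (cscale c F) = cscale c (D_y F)" "D_theta (cscale c F) = cscale c (D_theta F)"
  using assms by (simp_all add: D_y_def D_theta_def frechet_cscale) (simp_all add: cscale_def)

lemma differentiable_times_add:
  "differentiable_times k F \<Longrightarrow> differentiable_times k G \<Longrightarrow> differentiable_times k (F + G)"
proof (induction k arbitrary: F G)
  case 0 then show ?case by (simp add: plus_fun_def continuous_on_add)
next
  case (Suc k)
  then have d: "everywhere_diff F" "everywhere_diff G" unfolding differentiable_times.simps everywhere_diff_def by blast+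
  have "differentiable_times k ((\<lambda>p. frechet_derivative F (at p) v) + (\<lambda>p. frechet_derivative G (at p) v))" for v
    using Suc.prems by (intro Suc.IH) (simp_all only: differentiable_times.simps)
  then show ?case
    unfolding differentiable_times.simps(2) everywhere_diff_def[symmetric] frechet_add[OF d]
    using everywhere_diff_add[OF d] by (simp add: plus_fun_def)
qed

lemma differentiable_times_cscale: "differentiable_times k F \<Longrightarrow> differentiable_times k (cscale c F)"
proof (induction k arbitrary: F)
  case 0 then show ?case by (simp add: cscale_def continuous_on_mult_left)
next
  case (Suc k)
  then have d: "everywhere_diff F" unfolding differentiable_times.simps everywhere_diff_def by blast
  have "differentiable_times k (cscale c (\<lambda>p. frechet_derivative F (at p) v))" for v
    using Suc.prems by (intro Suc.IH) (simp_all only: differentiable_times.simps)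
  then show ?case
    unfolding differentiable_times.simps(2) everywhere_diff_def[symmetric] frechet_cscale[OF d]
    using everywhere_diff_cscale[OF d, of c] by (simp add: cscale_def)
qed

lemma differentiable_times_wave: "cont_diff k f \<Longrightarrow> differentiable_times k (wave m f)"
proof (induction k arbitrary: f)
  case 0
  then have f: "continuous_on UNIV f" by simp
  have "continuous_on UNIV (\<lambda>p::real \<times> real. snd p)" by (rule continuous_on_snd[OF continuous_on_id])
  then have "continuous_on UNIV (\<lambda>p::real \<times> real. f (snd p))"
    by (rule continuous_on_compose2[OF f]) simp
  moreover have "continuous_on UNIV (\<lambda>p::real \<times> real. exp (- (\<i> * of_int m * of_real (fst p) / 2)))"
    by (intro continuous_on_exp continuous_on_minus continuous_on_divide continuous_on_mult
      continuous_on_of_real continuous_on_fst continuous_on_const continuous_on_id) simp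
  ultimately have "continuous_on UNIV (\<lambda>p. exp (- (\<i> * of_int m * of_real (fst p) / 2)) * f (snd p))"
    by (rule continuous_on_mult[rotated])
  then show ?case by (simp add: wave_def split_beta)
next
  case (Suc k)
  then obtain f' where f': "\<And>y. (f has_vector_derivative f' y) (at y)" "cont_diff k f'" by auto
  have e: "(\<lambda>p. frechet_derivative (wave m f) (at p) v) =
      cscale (- (of_real (fst v) * (\<i> * of_int m / 2))) (wave m f) + cscale (of_real (snd v)) (wave m f')" for v
    unfolding frechet_wave[OF f'(1)] by (simp add: fun_eq_iff cscale_def)
  have d: "differentiable_times k (cscale a (wave m f) + cscale c (wave m f'))" for a c
    by (intro differentiable_times_add differentiable_times_cscale Suc.IH f'(2) cont_diff_mono[OF Suc.prems])
  show ?case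
    unfolding differentiable_times.simps(2) everywhere_diff_def[symmetric] e
    by (intro conjI allI d everywhere_diff_wave[OF f'(1)])
qed

lemma smooth_wave: "(\<And>k. cont_diff k f) \<Longrightarrow> smooth (wave m f)"
  by (simp add: smooth_def differentiable_times_wave)

lemma smooth_imp_dif: "smooth F \<Longrightarrow> everywhere_diff F"
  unfolding smooth_def everywhere_diff_def using differentiable_times.simps(2) by blast

lemma smooth_add: "smooth F \<Longrightarrow> smooth G \<Longrightarrow> smooth (F + G)"
  by (simp add: smooth_def differentiable_times_add)

lemma smooth_cscale: "smooth F \<Longrightarrow> smooth (cscale c F)"
  by (simp add: smooth_def differentiable_times_cscale)

lemma smooth_D_y: "smooth F \<Longrightarrow> smooth (D_y F)"
  unfolding smooth_def D_y_def using differentiable_times.simps(2) by blast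

text \<open>The derivative of a vertical slice is the Frechet derivative in direction (0,1), to
  which the induction hypothesis applies. At \<theta> = 0 the slice of a wave is its radial factor,
  whose smoothness is recovered in this way.\<close>

lemma cont_diff_slice: "differentiable_times k F \<Longrightarrow> cont_diff k (\<lambda>y. F (\<theta>, y))"
proof (induction k arbitrary: F)
  case 0
  have "continuous_on UNIV (F \<circ> (\<lambda>y. (\<theta>, y)))"
    using 0 by (intro continuous_on_compose continuous_intros) (auto intro: continuous_on_subset)
  then show ?case by (simp add: o_def)
next
  case (Suc k)
  have "((\<lambda>y. F (\<theta>, y)) has_vector_derivative frechet_derivative F (at (\<theta>, y)) (0, 1)) (at y)" for y
  proof -
    have F: "(F has_derivative frechet_derivative F (at (\<theta>, y))) (at (\<theta>, y))"
      using Suc.prems by (simp add: frechet_derivative_works)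
    have "((\<lambda>t. (\<theta>, t)) has_derivative (\<lambda>h. (0, h))) (at y)"
      by (intro derivative_intros)
    from has_derivative_compose[OF this F]
    have "((\<lambda>t. F (\<theta>, t)) has_derivative (\<lambda>h. frechet_derivative F (at (\<theta>, y)) (h *\<^sub>R (0, 1)))) (at y)"
      by simp
    then show ?thesis
      unfolding has_vector_derivative_def linear_cmul[OF has_derivative_linear[OF F]] .
  qed
  moreover have "cont_diff k (\<lambda>y. frechet_derivative F (at (\<theta>, y)) (0, 1))"
    using Suc.IH[of "\<lambda>p. frechet_derivative F (at p) (0, 1)"] Suc.prems by simp
  ultimately show ?case by (rule cont_diff_SucI)
qed

lemma smooth_wave_iff: "smooth (wave m f) \<longleftrightarrow> (\<forall>k. cont_diff k f)"
proof
  assume "smooth (wave m f)"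
  then have "cont_diff k (\<lambda>y. wave m f (0, y))" for k by (intro cont_diff_slice) (simp add: smooth_def)
  then show "\<forall>k. cont_diff k f" by (simp add: wave_apply)
qed (simp add: smooth_wave)

section \<open>The Lie algebra action on functions of a fixed weight\<close>

text \<open>The creation operator of the harmonic oscillator, twisted by exp(-i \<theta>): it is the
  complex combination (1,0) + i (0,1) of the Heisenberg generators (u,v). The annihilation operator
  \<open>act_lower\<close> is -(1,0) + i (0,1).\<close>

definition act_raise :: "plane_fun \<Rightarrow> plane_fun" where
  "act_raise F = (\<lambda>(\<theta>, y). exp (- (\<i> * of_real \<theta>)) * (of_real y * F (\<theta>, y) - D_y F (\<theta>, y)))"

definition act_lower :: "plane_fun \<Rightarrow> plane_fun" where
  "act_lower F = (\<lambda>(\<theta>, y). exp (\<i> * of_real \<theta>) * (of_real y * F (\<theta>, y) + D_y F (\<theta>, y)))"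

text \<open>This and the next five definitions are the coordinates of a real Lie algebra element
  with respect to \<open>\<eta>\<^sup>+\<close>, \<open>\<eta>\<^sup>-\<close>, \<kappa>, the two
  oscillator operators and the identity. They come from
  \<open>h = \<eta>\<^sup>+ + \<eta>\<^sup>-\<close> and \<open>e\<^sup>\<plusminus> =
  (-\<i>(\<eta>\<^sup>+ - \<eta>\<^sup>-) \<plusminus> \<i>\<kappa>) / 2\<close>.\<close>

definition coef_eta_plus :: "jacobi \<Rightarrow> complex" where
  "coef_eta_plus = (\<lambda>(A, a, w). of_real (A $ 1 $ 1) - \<i> * of_real (A $ 1 $ 2 + A $ 2 $ 1) / 2)"

definition coef_eta_minus :: "jacobi \<Rightarrow> complex" where
  "coef_eta_minus = (\<lambda>(A, a, w). of_real (A $ 1 $ 1) + \<i> * of_real (A $ 1 $ 2 + A $ 2 $ 1) / 2)"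

definition coef_kappa :: "jacobi \<Rightarrow> complex" where
  "coef_kappa = (\<lambda>(A, a, w). \<i> * of_real (A $ 1 $ 2 - A $ 2 $ 1) / 2)"

definition coef_raise :: "jacobi \<Rightarrow> complex" where
  "coef_raise = (\<lambda>(A, a, w). (of_real (a $ 1) - \<i> * of_real (a $ 2)) / 2)"

definition coef_lower :: "jacobi \<Rightarrow> complex" where
  "coef_lower = (\<lambda>(A, a, w). - (of_real (a $ 1) + \<i> * of_real (a $ 2)) / 2)"

definition coef_centre :: "jacobi \<Rightarrow> complex" where
  "coef_centre = (\<lambda>(A, a, w). \<i> * of_real w / 2)"

lemmas coef_defs = coef_eta_plus_def coef_eta_minus_def coef_kappa_def coef_raise_def coef_lower_def
  coef_centre_def

lemma jacobi_act_decomp: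
  "jacobi_act \<xi> F p = coef_eta_plus \<xi> * act_eta_plus F p + coef_eta_minus \<xi> * act_eta_minus F p
    + coef_kappa \<xi> * act_kappa F p + coef_raise \<xi> * act_raise F p + coef_lower \<xi> * act_lower F p
    + coef_centre \<xi> * F p"
proof -
  obtain A a w where \<xi>: "\<xi> = (A, a, w)" by (cases \<xi>)
  obtain \<theta> y where p: "p = (\<theta>, y)" by (cases p)
  define c s where cs: "c = complex_of_real (cos \<theta>)" "s = complex_of_real (sin \<theta>)"
  have e: "exp (\<i> * of_real \<theta>) = c + \<i> * s" "exp (- (\<i> * of_real \<theta>)) = c - \<i> * s"
    using cis_conv_exp[of \<theta>] cis_conv_exp[of "- \<theta>"]
    by (simp_all add: cs complex_eq_iff)
  have "act_heisenberg (a $ 1) (a $ 2) w F p =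
    coef_raise \<xi> * act_raise F p + coef_lower \<xi> * act_lower F p + coef_centre \<xi> * F p"
    unfolding act_heisenberg_def act_raise_def act_lower_def coef_defs \<xi> p split e
      of_real_mult cs[symmetric]
    by (simp add: algebra_simps add_divide_distrib diff_divide_distrib)
  moreover have "of_real (A $ 1 $ 1) * act_h F p + of_real (A $ 1 $ 2) * act_e_plus F p
      + of_real (A $ 2 $ 1) * act_e_minus F p = coef_eta_plus \<xi> * act_eta_plus F p
      + coef_eta_minus \<xi> * act_eta_minus F p + coef_kappa \<xi> * act_kappa F p"
    unfolding act_h_def act_e_plus_def act_e_minus_def coef_defs \<xi> split
    by (simp add: algebra_simps add_divide_distrib diff_divide_distrib)
  ultimately show ?thesis unfolding \<xi> jacobi_act.simps by (simp only: add.assoc)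
qed

lemma act_add:
  assumes "everywhere_diff F" "everywhere_diff G"
  shows "act_eta_plus (F + G) = act_eta_plus F + act_eta_plus G"
    "act_eta_minus (F + G) = act_eta_minus F + act_eta_minus G"
    "act_kappa (F + G) = act_kappa F + act_kappa G"
    "act_raise (F + G) = act_raise F + act_raise G"
    "act_lower (F + G) = act_lower F + act_lower G"
  unfolding act_eta_plus_def act_eta_minus_def act_kappa_def act_raise_def act_lower_def D_add[OF assms]
  by (auto simp: algebra_simps)

lemma act_cscale:
  assumes "everywhere_diff F"
  shows "act_eta_plus (cscale c F) = cscale c (act_eta_plus F)"
    "act_eta_minus (cscale c F) = cscale c (act_eta_minus F)"
    "act_kappa (cscale c F) = cscale c (act_kappa F)"
    "act_raise (cscale c F) = cscale c (act_raise F)"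
    "act_lower (cscale c F) = cscale c (act_lower F)"
  unfolding act_eta_plus_def act_eta_minus_def act_kappa_def act_raise_def act_lower_def D_cscale[OF assms]
  unfolding cscale_def by (auto simp: algebra_simps)

lemma jacobi_act_add: "everywhere_diff F \<Longrightarrow> everywhere_diff G \<Longrightarrow> jacobi_act \<xi> (F + G) = jacobi_act \<xi> F + jacobi_act \<xi> G"
  by (rule ext) (simp add: jacobi_act_decomp act_add algebra_simps)

lemma jacobi_act_cscale: "everywhere_diff F \<Longrightarrow> jacobi_act \<xi> (cscale c F) = cscale c (jacobi_act \<xi> F)"
  by (rule ext) (simp add: jacobi_act_decomp act_cscale, simp add: cscale_def jacobi_act_decomp algebra_simps)

lemma exp_wave_shift:
  "exp (- 2 * \<i> * of_real \<theta>) * exp (- (\<i> * of_int m * of_real \<theta> / 2)) = exp (- (\<i> * of_int (m + 4) * of_real \<theta> / 2))"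
  "exp (2 * \<i> * of_real \<theta>) * exp (- (\<i> * of_int m * of_real \<theta> / 2)) = exp (- (\<i> * of_int (m - 4) * of_real \<theta> / 2))"
  "exp (- (\<i> * of_real \<theta>)) * exp (- (\<i> * of_int m * of_real \<theta> / 2)) = exp (- (\<i> * of_int (m + 2) * of_real \<theta> / 2))"
  "exp (\<i> * of_real \<theta>) * exp (- (\<i> * of_int m * of_real \<theta> / 2)) = exp (- (\<i> * of_int (m - 2) * of_real \<theta> / 2))"
  unfolding exp_add[symmetric]
  by (rule arg_cong[where f = exp]; simp add: algebra_simps add_divide_distrib diff_divide_distrib)+

context
  fixes m :: int and f f' :: "real \<Rightarrow> complex"
  assumes f: "\<And>y. (f has_vector_derivative f' y) (at y)"
begin

lemma act_eta_plus_wave: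
  "act_eta_plus (wave m f) =
    wave (m + 4) (\<lambda>y. 1/2 * ((of_real y)\<^sup>2 * f y - of_real y * f' y - (of_int m + 1) / 2 * f y))"
  unfolding act_eta_plus_def D_theta_wave[OF f] D_y_wave[OF f] 
  by (rule ext, simp only: split_paired_all split wave_apply cscale_def exp_wave_shift(1)[symmetric])
    (simp add: algebra_simps add_divide_distrib diff_divide_distrib)

lemma act_eta_minus_wave:
  "act_eta_minus (wave m f) =
    wave (m - 4) (\<lambda>y. 1/2 * (- (of_real y * f' y) + (of_int m - 1) / 2 * f y - (of_real y)\<^sup>2 * f y))"
  unfolding act_eta_minus_def D_theta_wave[OF f] D_y_wave[OF f] 
  by (rule ext, simp only: split_paired_all split wave_apply cscale_def exp_wave_shift(2)[symmetric])
    (simp add: algebra_simps add_divide_distrib diff_divide_distrib)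

lemma act_kappa_wave: "act_kappa (wave m f) = cscale (of_int m / 2) (wave m f)"
  unfolding act_kappa_def D_theta_wave[OF f] cscale_def
  by (simp add: mult.assoc[symmetric] fun_eq_iff)

lemma act_raise_wave: "act_raise (wave m f) = wave (m + 2) (\<lambda>y. of_real y * f y - f' y)"
  unfolding act_raise_def D_y_wave[OF f] 
  by (rule ext, simp only: split_paired_all split wave_apply exp_wave_shift(3)[symmetric])
    (simp add: algebra_simps)

lemma act_lower_wave: "act_lower (wave m f) = wave (m - 2) (\<lambda>y. of_real y * f y + f' y)"
  unfolding act_lower_def D_y_wave[OF f] 
  by (rule ext, simp only: split_paired_all split wave_apply exp_wave_shift(4)[symmetric])
    (simp add: algebra_simps)

end

lemma wave_cong: "m = n \<Longrightarrow> (\<And>y. f y = g y) \<Longrightarrow> wave m f = wave n g"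
  by presburger

lemma wave_linear:
  "wave m f + wave m g = wave m (\<lambda>y. f y + g y)"
  "wave m f - wave m g = wave m (\<lambda>y. f y - g y)"
  "cscale c (wave m f) = wave m (\<lambda>y. c * f y)"
  by (auto simp: wave_def cscale_def algebra_simps)


context
  fixes m :: int and f f' f'' :: "real \<Rightarrow> complex"
  assumes f: "\<And>y. (f has_vector_derivative f' y) (at y)"
    and f': "\<And>y. (f' has_vector_derivative f'' y) (at y)"
begin

lemma deriv_y_f: "((\<lambda>y. of_real y * f y) has_vector_derivative f y + of_real y * f' y) (at y)"
  using has_vector_derivative_mult[OF has_vector_derivative_of_real[OF DERIV_ident] f, of y]
  by (simp add: add.commute)

lemma deriv_y_f': "((\<lambda>y. of_real y * f' y) has_vector_derivative f' y + of_real y * f'' y) (at y)"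
  using has_vector_derivative_mult[OF has_vector_derivative_of_real[OF DERIV_ident] f', of y]
  by (simp add: add.commute)

lemma deriv_y2_f: "((\<lambda>y. (of_real y)\<^sup>2 * f y) has_vector_derivative 2 * of_real y * f y + (of_real y)\<^sup>2 * f' y) (at y)"
  using has_vector_derivative_mult[OF has_vector_derivative_of_real[OF DERIV_ident] deriv_y_f, of y]
  by (simp add: algebra_simps power2_eq_square)

lemma deriv_raise: "((\<lambda>y. of_real y * f y - f' y) has_vector_derivative f y + of_real y * f' y - f'' y) (at y)"
  by (intro has_vector_derivative_diff deriv_y_f f')

lemma deriv_lower: "((\<lambda>y. of_real y * f y + f' y) has_vector_derivative f y + of_real y * f' y + f'' y) (at y)"
  by (intro has_vector_derivative_add deriv_y_f f')

lemma deriv_eta_plus: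
  "((\<lambda>y. 1/2 * ((of_real y)\<^sup>2 * f y - of_real y * f' y - (of_int m + 1) / 2 * f y)) has_vector_derivative
    1/2 * ((2 * of_real y * f y + (of_real y)\<^sup>2 * f' y) - (f' y + of_real y * f'' y) - (of_int m + 1) / 2 * f' y)) (at y)"
  by (intro has_vector_derivative_mult_right has_vector_derivative_diff deriv_y2_f deriv_y_f' f)

lemma deriv_eta_minus:
  "((\<lambda>y. 1/2 * (- (of_real y * f' y) + (of_int m - 1) / 2 * f y - (of_real y)\<^sup>2 * f y)) has_vector_derivative
    1/2 * (- (f' y + of_real y * f'' y) + (of_int m - 1) / 2 * f' y - (2 * of_real y * f y + (of_real y)\<^sup>2 * f' y))) (at y)"
  by (intro has_vector_derivative_mult_right has_vector_derivative_diff has_vector_derivative_add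
    has_vector_derivative_minus deriv_y2_f deriv_y_f' f)

text \<open>All ten brackets among the five noncentral operators. They hold for every twice
  differentiable radial factor, so the bracket relation is a computation with operators and does not
  involve Kummer functions.\<close>

lemma act_commutators:
  shows "act_eta_plus (act_eta_minus (wave m f)) = act_eta_minus (act_eta_plus (wave m f)) + act_kappa (wave m f)"
    and "act_kappa (act_eta_plus (wave m f)) = act_eta_plus (act_kappa (wave m f)) + cscale 2 (act_eta_plus (wave m f))"
    and "act_kappa (act_eta_minus (wave m f)) = act_eta_minus (act_kappa (wave m f)) - cscale 2 (act_eta_minus (wave m f))"
    and "act_kappa (act_raise (wave m f)) = act_raise (act_kappa (wave m f)) + act_raise (wave m f)"
    and "act_kappa (act_lower (wave m f)) = act_lower (act_kappa (wave m f)) - act_lower (wave m f)"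
    and "act_eta_plus (act_raise (wave m f)) = act_raise (act_eta_plus (wave m f))"
    and "act_eta_minus (act_lower (wave m f)) = act_lower (act_eta_minus (wave m f))"
    and "act_eta_plus (act_lower (wave m f)) = act_lower (act_eta_plus (wave m f)) - act_raise (wave m f)"
    and "act_eta_minus (act_raise (wave m f)) = act_raise (act_eta_minus (wave m f)) - act_lower (wave m f)"
    and "act_raise (act_lower (wave m f)) = act_lower (act_raise (wave m f)) - cscale 2 (wave m f)"
  unfolding act_kappa_wave[OF f] act_cscale[OF everywhere_diff_wave[OF f]]
    act_eta_plus_wave[OF f] act_eta_minus_wave[OF f] act_raise_wave[OF f] act_lower_wave[OF f]
    act_kappa_wave[OF deriv_eta_plus] act_kappa_wave[OF deriv_eta_minus] act_kappa_wave[OF deriv_raise] act_kappa_wave[OF deriv_lower]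
    act_eta_plus_wave[OF deriv_eta_minus] act_eta_minus_wave[OF deriv_eta_plus]
    act_eta_plus_wave[OF deriv_raise] act_raise_wave[OF deriv_eta_plus]
    act_eta_minus_wave[OF deriv_raise] act_raise_wave[OF deriv_eta_minus]
    act_eta_plus_wave[OF deriv_lower] act_lower_wave[OF deriv_eta_plus]
    act_eta_minus_wave[OF deriv_lower] act_lower_wave[OF deriv_eta_minus]
    act_raise_wave[OF deriv_lower] act_lower_wave[OF deriv_raise]
  subgoal by (simp add: wave_linear) (rule wave_cong; simp add: algebra_simps power2_eq_square add_divide_distrib diff_divide_distrib)
  subgoal by (simp add: wave_linear) (rule wave_cong; simp add: algebra_simps power2_eq_square add_divide_distrib diff_divide_distrib)
  subgoal by (simp add: wave_linear) (rule wave_cong; simp add: algebra_simps power2_eq_square add_divide_distrib diff_divide_distrib)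
  subgoal by (simp add: wave_linear) (rule wave_cong; simp add: algebra_simps power2_eq_square add_divide_distrib diff_divide_distrib)
  subgoal by (simp add: wave_linear) (rule wave_cong; simp add: algebra_simps power2_eq_square add_divide_distrib diff_divide_distrib)
  subgoal by (simp add: wave_linear) (rule wave_cong; simp add: algebra_simps power2_eq_square add_divide_distrib diff_divide_distrib)
  subgoal by (simp add: wave_linear) (rule wave_cong; simp add: algebra_simps power2_eq_square add_divide_distrib diff_divide_distrib)
  subgoal by (simp add: wave_linear add.commute[of _ m]) (rule wave_cong; simp add: algebra_simps power2_eq_square add_divide_distrib diff_divide_distrib)
  subgoal by (simp add: wave_linear add.commute[of _ m]) (rule wave_cong; simp add: algebra_simps power2_eq_square add_divide_distrib diff_divide_distrib)
  subgoal by (simp add: wave_linear) (rule wave_cong; simp add: algebra_simps power2_eq_square add_divide_distrib diff_divide_distrib)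
  done

end

section \<open>The Lie bracket in complex coordinates\<close>

lemma jacobi_algebra_iff: "(A, a, w) \<in> jacobi_algebra \<longleftrightarrow> A $ 2 $ 2 = - A $ 1 $ 1"
  by (auto simp: jacobi_algebra_def sl2_R_def trace_def sum_2)

text \<open>The structure constants of \<open>act_commutators\<close>, now read off from matrices
  and vectors. Vanishing trace expresses the lower right entry by the upper left one; the constant
  -2 in the last line matches [raise, lower] = -2 and the factor 2 in the centre of the
  bracket.\<close>

lemma coef_bracket:
  assumes "\<xi> \<in> jacobi_algebra" "\<zeta> \<in> jacobi_algebra"
  shows "coef_kappa (jacobi_bracket \<xi> \<zeta>) = coef_eta_plus \<xi> * coef_eta_minus \<zeta> - coef_eta_minus \<xi> * coef_eta_plus \<zeta>"
    and "coef_eta_plus (jacobi_bracket \<xi> \<zeta>) = 2 * (coef_kappa \<xi> * coef_eta_plus \<zeta> - coef_eta_plus \<xi> * coef_kappa \<zeta>)"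
    and "coef_eta_minus (jacobi_bracket \<xi> \<zeta>) = - 2 * (coef_kappa \<xi> * coef_eta_minus \<zeta> - coef_eta_minus \<xi> * coef_kappa \<zeta>)"
    and "coef_raise (jacobi_bracket \<xi> \<zeta>) = coef_kappa \<xi> * coef_raise \<zeta> - coef_raise \<xi> * coef_kappa \<zeta>
      - (coef_eta_plus \<xi> * coef_lower \<zeta> - coef_lower \<xi> * coef_eta_plus \<zeta>)"
    and "coef_lower (jacobi_bracket \<xi> \<zeta>) = - (coef_kappa \<xi> * coef_lower \<zeta> - coef_lower \<xi> * coef_kappa \<zeta>)
      - (coef_eta_minus \<xi> * coef_raise \<zeta> - coef_raise \<xi> * coef_eta_minus \<zeta>)"
    and "coef_centre (jacobi_bracket \<xi> \<zeta>) = - 2 * (coef_raise \<xi> * coef_lower \<zeta> - coef_lower \<xi> * coef_raise \<zeta>)"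
proof -
  obtain A a w B b v where *: "\<xi> = (A, a, w)" "\<zeta> = (B, b, v)" by (metis prod_cases3)
  have tr: "A $ 2 $ 2 = - A $ 1 $ 1" "B $ 2 $ 2 = - B $ 1 $ 1"
    using assms unfolding * jacobi_algebra_iff by auto
  note simps = * coef_defs tr matrix_matrix_mult_def matrix_vector_mult_def sum_2
  show "coef_kappa (jacobi_bracket \<xi> \<zeta>) = coef_eta_plus \<xi> * coef_eta_minus \<zeta> - coef_eta_minus \<xi> * coef_eta_plus \<zeta>"
    and "coef_eta_plus (jacobi_bracket \<xi> \<zeta>) = 2 * (coef_kappa \<xi> * coef_eta_plus \<zeta> - coef_eta_plus \<xi> * coef_kappa \<zeta>)"
    and "coef_eta_minus (jacobi_bracket \<xi> \<zeta>) = - 2 * (coef_kappa \<xi> * coef_eta_minus \<zeta> - coef_eta_minus \<xi> * coef_kappa \<zeta>)"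
    and "coef_raise (jacobi_bracket \<xi> \<zeta>) = coef_kappa \<xi> * coef_raise \<zeta> - coef_raise \<xi> * coef_kappa \<zeta>
      - (coef_eta_plus \<xi> * coef_lower \<zeta> - coef_lower \<xi> * coef_eta_plus \<zeta>)"
    and "coef_lower (jacobi_bracket \<xi> \<zeta>) = - (coef_kappa \<xi> * coef_lower \<zeta> - coef_lower \<xi> * coef_kappa \<zeta>)
      - (coef_eta_minus \<xi> * coef_raise \<zeta> - coef_raise \<xi> * coef_eta_minus \<zeta>)"
    and "coef_centre (jacobi_bracket \<xi> \<zeta>) = - 2 * (coef_raise \<xi> * coef_lower \<zeta> - coef_lower \<xi> * coef_raise \<zeta>)"
    by (simp_all add: simps complex_eq_iff field_simps)
qed

lemma coef_add:
  "coef_kappa (\<xi> + \<zeta>) = coef_kappa \<xi> + coef_kappa \<zeta>" "coef_eta_plus (\<xi> + \<zeta>) = coef_eta_plus \<xi> + coef_eta_plus \<zeta>"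
  "coef_eta_minus (\<xi> + \<zeta>) = coef_eta_minus \<xi> + coef_eta_minus \<zeta>" "coef_raise (\<xi> + \<zeta>) = coef_raise \<xi> + coef_raise \<zeta>"
  "coef_lower (\<xi> + \<zeta>) = coef_lower \<xi> + coef_lower \<zeta>" "coef_centre (\<xi> + \<zeta>) = coef_centre \<xi> + coef_centre \<zeta>"
  by (cases \<xi>; cases \<zeta>; simp add: coef_defs complex_eq_iff add_divide_distrib)+

lemma coef_scaleR:
  "coef_kappa (t *\<^sub>R \<xi>) = of_real t * coef_kappa \<xi>" "coef_eta_plus (t *\<^sub>R \<xi>) = of_real t * coef_eta_plus \<xi>"
  "coef_eta_minus (t *\<^sub>R \<xi>) = of_real t * coef_eta_minus \<xi>" "coef_raise (t *\<^sub>R \<xi>) = of_real t * coef_raise \<xi>"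
  "coef_lower (t *\<^sub>R \<xi>) = of_real t * coef_lower \<xi>" "coef_centre (t *\<^sub>R \<xi>) = of_real t * coef_centre \<xi>"
  by (cases \<xi>; simp add: coef_defs complex_eq_iff algebra_simps)+

lemma jacobi_act_add_left: "jacobi_act (\<xi> + \<zeta>) F = jacobi_act \<xi> F + jacobi_act \<zeta> F"
  by (rule ext) (simp add: jacobi_act_decomp coef_add algebra_simps)

lemma jacobi_act_scale_left: "jacobi_act (t *\<^sub>R \<xi>) F = cscale (of_real t) (jacobi_act \<xi> F)"
  by (rule ext) (simp add: jacobi_act_decomp coef_scaleR cscale_def algebra_simps)

lemma jacobi_act_sum_form:
  "jacobi_act \<xi> F = cscale (coef_eta_plus \<xi>) (act_eta_plus F) + (cscale (coef_eta_minus \<xi>) (act_eta_minus F)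
    + (cscale (coef_kappa \<xi>) (act_kappa F) + (cscale (coef_raise \<xi>) (act_raise F)
    + (cscale (coef_lower \<xi>) (act_lower F) + cscale (coef_centre \<xi>) F))))"
  by (rule ext) (simp add: jacobi_act_decomp cscale_def)

lemma jacobi_act_bracket_wave:
  assumes \<xi>: "\<xi> \<in> jacobi_algebra" and \<zeta>: "\<zeta> \<in> jacobi_algebra"
    and f: "\<And>y. (f has_vector_derivative f' y) (at y)"
    and f': "\<And>y. (f' has_vector_derivative f'' y) (at y)"
  shows "jacobi_act (jacobi_bracket \<xi> \<zeta>) (wave m f) =
    jacobi_act \<xi> (jacobi_act \<zeta> (wave m f)) - jacobi_act \<zeta> (jacobi_act \<xi> (wave m f))"
proof (rule ext)
  fix p
  let ?F = "wave m f"
  have dF: "everywhere_diff ?F" by (rule everywhere_diff_wave[OF f])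
  have d: "everywhere_diff (act_eta_plus ?F)" "everywhere_diff (act_eta_minus ?F)" "everywhere_diff (act_kappa ?F)" "everywhere_diff (act_raise ?F)" "everywhere_diff (act_lower ?F)"
    unfolding act_eta_plus_wave[OF f] act_eta_minus_wave[OF f] act_kappa_wave[OF f] act_raise_wave[OF f] act_lower_wave[OF f]
    by (intro everywhere_diff_cscale dF everywhere_diff_wave[OF deriv_eta_plus[OF f f']] everywhere_diff_wave[OF deriv_eta_minus[OF f f']]
      everywhere_diff_wave[OF deriv_raise[OF f f']] everywhere_diff_wave[OF deriv_lower[OF f f']])+
  have expand: "jacobi_act \<xi> (jacobi_act \<zeta> ?F) p =
      coef_eta_plus \<zeta> * jacobi_act \<xi> (act_eta_plus ?F) p + (coef_eta_minus \<zeta> * jacobi_act \<xi> (act_eta_minus ?F) p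
    + (coef_kappa \<zeta> * jacobi_act \<xi> (act_kappa ?F) p + (coef_raise \<zeta> * jacobi_act \<xi> (act_raise ?F) p
    + (coef_lower \<zeta> * jacobi_act \<xi> (act_lower ?F) p + coef_centre \<zeta> * jacobi_act \<xi> ?F p))))" for \<xi> \<zeta>
    unfolding jacobi_act_sum_form[of \<zeta>]
    by (simp only: jacobi_act_add jacobi_act_cscale everywhere_diff_add everywhere_diff_cscale d dF plus_fun_apply)
      (simp only: cscale_def)
  \<comment> \<open>Used as rewrite rules, the commutators bring every product of two operators into
    one order, from left to right: lower, raise, \<open>\<eta>\<^sup>-\<close>,
    \<open>\<eta>\<^sup>+\<close>, \<kappa>. After that both sides are combinations of the same
    products.\<close>
  note comm = act_commutators[OF f f', of m, THEN fun_cong[where x = p], simplified cscale_def plus_fun_apply minus_apply]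
  show "jacobi_act (jacobi_bracket \<xi> \<zeta>) ?F p =
    (jacobi_act \<xi> (jacobi_act \<zeta> ?F) - jacobi_act \<zeta> (jacobi_act \<xi> ?F)) p"
    unfolding minus_apply expand unfolding jacobi_act_decomp coef_bracket[OF \<xi> \<zeta>] comm
    by (simp add: algebra_simps)
qed

section \<open>The weight basis and separation of weights\<close>

text \<open>Multiplying the coefficients by \<mu> i - \<mu> j removes component j and keeps
  component i0; repeating this for all j \<noteq> i0 isolates \<open>v i0\<close>. Since \<mu> may
  depend on j, several operators can share the work, and since operators enter only through their
  effect on coefficients, the lemma covers the \<theta>-derivative, \<Omega>'', the reflection of y
  and the Lie algebra alike.\<close>

lemma separate_components:
  assumes W: "cfun.subspace W" and S: "finite S" "i0 \<in> S" and sum: "(\<Sum>i\<in>S. v i) \<in> W"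
    and sep: "\<And>j. j \<in> S \<Longrightarrow> j \<noteq> i0 \<Longrightarrow> \<exists>\<mu> :: 'i \<Rightarrow> complex. \<mu> j \<noteq> \<mu> i0 \<and>
      (\<forall>c. (\<Sum>i\<in>S. cscale (c i) (v i)) \<in> W \<longrightarrow> (\<Sum>i\<in>S. cscale (c i * \<mu> i) (v i)) \<in> W)"
  shows "v i0 \<in> W"
proof -
  have "finite T \<Longrightarrow> T \<subseteq> S - {i0} \<Longrightarrow>
      \<exists>c. (\<forall>j\<in>T. c j = 0) \<and> c i0 \<noteq> 0 \<and> (\<Sum>i\<in>S. cscale (c i) (v i)) \<in> W" for T
  proof (induction T rule: finite_induct)
    case empty
    show ?case using sum by (intro exI[of _ "\<lambda>_. 1"]) simp
  next
    case (insert j T)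
    then obtain c where c: "\<forall>j\<in>T. c j = 0" "c i0 \<noteq> 0" "(\<Sum>i\<in>S. cscale (c i) (v i)) \<in> W" by auto
    obtain \<mu> where \<mu>: "\<mu> j \<noteq> \<mu> i0"
      "\<And>c. (\<Sum>i\<in>S. cscale (c i) (v i)) \<in> W \<Longrightarrow> (\<Sum>i\<in>S. cscale (c i * \<mu> i) (v i)) \<in> W"
      using sep[of j] insert.prems by blast
    have "(\<Sum>i\<in>S. cscale (c i * (\<mu> i - \<mu> j)) (v i)) =
        (\<Sum>i\<in>S. cscale (c i * \<mu> i) (v i)) - cscale (\<mu> j) (\<Sum>i\<in>S. cscale (c i) (v i))"
      by (simp add: cfun.scale_sum_right sum_subtractf[symmetric] cfun.scale_left_diff_distrib
        right_diff_distrib mult.commute)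
    also have "\<dots> \<in> W"
      by (intro cfun.subspace_diff[OF W] cfun.subspace_scale[OF W] \<mu>(2) c(3))
    finally show ?case
      using c \<mu>(1) by (intro exI[of _ "\<lambda>i. c i * (\<mu> i - \<mu> j)"]) auto
  qed
  from this[of "S - {i0}"] S obtain c where c: "\<forall>j\<in>S - {i0}. c j = 0" "c i0 \<noteq> 0"
    "(\<Sum>i\<in>S. cscale (c i) (v i)) \<in> W" by auto
  have "(\<Sum>i\<in>S. cscale (c i) (v i)) = cscale (c i0) (v i0)"
    using S c(1) by (subst sum.remove[of _ i0]) auto
  with c(3) have "cscale (inverse (c i0)) (cscale (c i0) (v i0)) \<in> W"
    by (metis cfun.subspace_scale[OF W])
  then show ?thesis using c(2) by simp
qed

lemma linear_sum:
  assumes "\<And>F G. everywhere_diff F \<Longrightarrow> everywhere_diff G \<Longrightarrow> L (F + G) = L F + L G"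
    and "\<And>c F. everywhere_diff F \<Longrightarrow> L (cscale c F) = cscale c (L F)"
    and "finite S" "\<And>i. i \<in> S \<Longrightarrow> everywhere_diff (v i)"
  shows "L (\<Sum>i\<in>S. cscale (c i) (v i)) = (\<Sum>i\<in>S. cscale (c i) (L (v i))) \<and> everywhere_diff (\<Sum>i\<in>S. cscale (c i) (v i))"
  using assms(3,4)
proof (induction S rule: finite_induct)
  case empty
  have "L 0 = 0" using assms(2)[OF everywhere_diff_zero, of 0] by simp
  then show ?case unfolding sum.empty by (simp only: everywhere_diff_zero simp_thms)
next
  case (insert i S)
  then have d: "everywhere_diff (v i)" and IH: "L (\<Sum>i\<in>S. cscale (c i) (v i)) = (\<Sum>i\<in>S. cscale (c i) (L (v i)))"
    "everywhere_diff (\<Sum>i\<in>S. cscale (c i) (v i))" by blast+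
  show ?case
    unfolding sum.insert[OF insert.hyps] assms(1)[OF everywhere_diff_cscale[OF d] IH(2)] assms(2)[OF d] IH(1)
    by (intro conjI refl everywhere_diff_add everywhere_diff_cscale d IH)
qed

lemma wave_zero: "wave m (\<lambda>y. 0) = 0"
  by (auto simp: wave_def)

lemma wave_eq_0_iff: "wave m f = 0 \<longleftrightarrow> (\<forall>y. f y = 0)"
proof
  assume "wave m f = 0"
  then have "wave m f (0, y) = 0" for y by simp
  then show "\<forall>y. f y = 0" by (simp add: wave_apply)
qed (auto simp: wave_def)

lemma sum_fun_apply: "(\<Sum>i\<in>S. F i) p = (\<Sum>i\<in>S. F i p)" for F :: "'i \<Rightarrow> plane_fun"
  by (induction S rule: infinite_finite_induct) auto

lemma fourier_independent:
  assumes "finite S" "(\<Sum>m\<in>S. wave m (g m)) = 0" "m \<in> S"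
  shows "wave m (g m) = 0"
proof -
  have "wave m (g m) \<in> {0}"
  proof (rule separate_components[OF cfun.subspace_single_0 assms(1,3)])
    fix j assume "j \<in> S" "j \<noteq> m"
    show "\<exists>\<mu>. \<mu> j \<noteq> \<mu> m \<and> (\<forall>c. (\<Sum>i\<in>S. cscale (c i) (wave i (g i))) \<in> {0} \<longrightarrow>
             (\<Sum>i\<in>S. cscale (c i * \<mu> i) (wave i (g i))) \<in> {0})"
    \<comment> \<open>The eigenvalues of the \<theta>-derivative, taken at a fixed y.\<close>
    proof (intro exI[of _ "\<lambda>n. - (\<i> * of_int n / 2)"] conjI allI impI)
      fix c assume *: "(\<Sum>i\<in>S. cscale (c i) (wave i (g i))) \<in> {0}"
      have "(\<Sum>i\<in>S. cscale (c i * (- (\<i> * of_int i / 2))) (wave i (g i))) (\<theta>, y) = 0" for \<theta> y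
      proof -
        have D: "((\<lambda>t. \<Sum>i\<in>S. c i * (exp (- (\<i> * of_int i * of_real t / 2)) * g i y)) has_vector_derivative
           (\<Sum>i\<in>S. c i * (- (\<i> * of_int i / 2) * exp (- (\<i> * of_int i * of_real \<theta> / 2)) * g i y))) (at \<theta>)"
          by (intro has_vector_derivative_sum has_vector_derivative_mult_right has_vector_derivative_mult_left
            exp_weight_has_vector_derivative)
        have Z: "(\<lambda>t. \<Sum>i\<in>S. c i * (exp (- (\<i> * of_int i * of_real t / 2)) * g i y)) = (\<lambda>t. 0)"
        proof
          fix t
          have "(\<Sum>i\<in>S. cscale (c i) (wave i (g i))) (t, y) = 0" using * by simp
          then show "(\<Sum>i\<in>S. c i * (exp (- (\<i> * of_int i * of_real t / 2)) * g i y)) = 0"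
            unfolding sum_fun_apply cscale_def wave_apply .
        qed
        have "(\<Sum>i\<in>S. c i * (- (\<i> * of_int i / 2) * exp (- (\<i> * of_int i * of_real \<theta> / 2)) * g i y)) = 0"
          by (rule vector_derivative_unique_at[OF D[unfolded Z] has_vector_derivative_const])
        then show ?thesis unfolding sum_fun_apply cscale_def wave_apply mult.assoc .
      qed
      then show "(\<Sum>i\<in>S. cscale (c i * (- (\<i> * of_int i / 2))) (wave i (g i))) \<in> {0}"
        by (auto simp: fun_eq_iff)
    qed (use \<open>j \<noteq> m\<close> in simp)
  qed (use assms(2) in simp)
  then show ?thesis by simp
qed

section \<open>The weight basis and its ladder relations\<close>

definition osc_wave :: "nat \<times> int \<Rightarrow> plane_fun" where
  "osc_wave = (\<lambda>(l, m). wave m (\<lambda>y. of_real (osc l m y)))"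

definition osc_index :: "int \<Rightarrow> (nat \<times> int) set" where
  "osc_index q = {(l, m). 4 dvd m - q - 2 * int l}"

lemma deriv_osc:
  "((\<lambda>y. complex_of_real (osc l m y)) has_vector_derivative of_real (osc' l m y)) (at y)"
  "((\<lambda>y. complex_of_real (osc' l m y)) has_vector_derivative of_real (osc'' l m y)) (at y)"
  by (rule has_vector_derivative_of_real[OF DERIV_osc] has_vector_derivative_of_real[OF DERIV_osc'])+

lemma osc_wave_smooth: "smooth (osc_wave i)"
  by (cases i) (auto simp: osc_wave_def intro: smooth_wave cont_diff_osc)

lemma osc_wave_dif: "everywhere_diff (osc_wave i)"
  by (rule smooth_imp_dif[OF osc_wave_smooth])

lemma osc_wave_nonzero: "osc_wave i \<noteq> 0"
proof (cases i)
  case (Pair l m)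
  obtain y where "osc l m y > 0" using osc_pos_near_0 by blast
  then have "complex_of_real (osc l m y) \<noteq> 0" by simp
  then show ?thesis unfolding Pair osc_wave_def split wave_eq_0_iff by blast
qed

lemma act_kappa_osc: "act_kappa (osc_wave (l, m)) = cscale (of_int m / 2) (osc_wave (l, m))"
  unfolding osc_wave_def split by (rule act_kappa_wave[OF deriv_osc(1)])

lemma act_eta_plus_osc:
  "act_eta_plus (osc_wave (l, m)) = cscale (- (of_int m + 2 * of_nat l + 1) / 4) (osc_wave (l, m + 4))"
proof -
  have "1/2 * ((of_real y)\<^sup>2 * of_real (osc l m y) - of_real y * of_real (osc' l m y) - (of_int m + 1) / 2 * of_real (osc l m y))
     = complex_of_real (1/2 * (y\<^sup>2 * osc l m y - y * osc' l m y - (of_int m + 1) / 2 * osc l m y))" for y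
    by simp
  also have "\<dots> y = - (of_int m + 2 * of_nat l + 1) / 4 * of_real (osc l (m + 4) y)" for y
    unfolding osc_eta_plus by (simp add: algebra_simps)
  finally show ?thesis
    unfolding osc_wave_def split act_eta_plus_wave[OF deriv_osc(1)] wave_linear by (simp only:)
qed

lemma act_eta_minus_osc:
  "act_eta_minus (osc_wave (l, m)) = cscale ((of_int m - 2 * of_nat l - 1) / 4) (osc_wave (l, m - 4))"
proof -
  have "1/2 * (- (of_real y * of_real (osc' l m y)) + (of_int m - 1) / 2 * of_real (osc l m y) - (of_real y)\<^sup>2 * of_real (osc l m y))
     = complex_of_real (1/2 * (- (y * osc' l m y) + (of_int m - 1) / 2 * osc l m y - y\<^sup>2 * osc l m y))" for y
    by simp
  also have "\<dots> y = (of_int m - 2 * of_nat l - 1) / 4 * of_real (osc l (m - 4) y)" for y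
    unfolding osc_eta_minus by simp
  finally show ?thesis
    unfolding osc_wave_def split act_eta_minus_wave[OF deriv_osc(1)] wave_linear by (simp only:)
qed

lemma act_raise_osc:
  "act_raise (osc_wave (l, m)) =
    cscale (- of_nat l) (osc_wave (l - 1, m + 2)) + cscale (of_real (up_coeff l m)) (osc_wave (l + 1, m + 2))"
proof -
  have "of_real y * of_real (osc l m y) - of_real (osc' l m y) = complex_of_real (y * osc l m y - osc' l m y)" for y
    by simp
  also have "\<dots> y = - of_nat l * of_real (osc (l - 1) (m + 2) y) + of_real (up_coeff l m) * of_real (osc (l + 1) (m + 2) y)" for y
    unfolding osc_raise by simp
  finally show ?thesis
    unfolding osc_wave_def split act_raise_wave[OF deriv_osc(1)] wave_linear by (simp only:)
qed

lemma act_lower_osc: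
  "act_lower (osc_wave (l, m)) =
    cscale (of_nat l) (osc_wave (l - 1, m - 2)) + cscale (of_real (up_coeff l (- m))) (osc_wave (l + 1, m - 2))"
proof -
  have "of_real y * of_real (osc l m y) + of_real (osc' l m y) = complex_of_real (y * osc l m y + osc' l m y)" for y
    by simp
  also have "\<dots> y = of_nat l * of_real (osc (l - 1) (m - 2) y) + of_real (up_coeff l (- m)) * of_real (osc (l + 1) (m - 2) y)" for y
    unfolding osc_lower by simp
  finally show ?thesis
    unfolding osc_wave_def split act_lower_wave[OF deriv_osc(1)] wave_linear by (simp only:)
qed

lemma Omega_wave:
  assumes f: "\<And>y. (f has_vector_derivative f' y) (at y)"
    and f': "\<And>y. (f' has_vector_derivative f'' y) (at y)"
  shows "Omega (wave m f) = wave m (\<lambda>y. (of_real y)\<^sup>2 * (of_int m * f y - (of_real y)\<^sup>2 * f y + f'' y))"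
  unfolding Omega_def D_theta_wave[OF f] D_y_wave[OF f] D_y_wave[OF f']
  by (rule ext, simp only: split_paired_all split wave_apply cscale_def) (simp add: algebra_simps)

lemma Omega_osc: "Omega (osc_wave (l, m)) = cscale (2 * lam l) (osc_wave (l, m))"
proof -
  have "(of_real y)\<^sup>2 * (of_int m * of_real (osc l m y) - (of_real y)\<^sup>2 * of_real (osc l m y) + of_real (osc'' l m y))
    = complex_of_real (y\<^sup>2 * osc'' l m y - (y ^ 4 - of_int m * y\<^sup>2) * osc l m y)" for y
    by (simp add: algebra_simps power2_eq_square power4_eq_xxxx)
  also have "\<dots> y = 2 * lam l * of_real (osc l m y)" for y
    unfolding osc_ode by (simp add: lam_def algebra_simps)
  finally show ?thesis
    unfolding osc_wave_def split Omega_wave[OF deriv_osc] wave_linear by (simp only:)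
qed

lemma Omega_add:
  assumes "smooth F" "smooth G" shows "Omega (F + G) = Omega F + Omega G"
proof -
  have d: "everywhere_diff F" "everywhere_diff G" "everywhere_diff (D_y F)" "everywhere_diff (D_y G)"
    using assms by (simp_all add: smooth_imp_dif smooth_D_y)
  show ?thesis
    unfolding Omega_def D_add[OF d(1,2)] D_add[OF d(3,4)] by (auto simp: algebra_simps)
qed

lemma Omega_cscale:
  assumes "smooth F" shows "Omega (cscale c F) = cscale c (Omega F)"
proof -
  have d: "everywhere_diff F" "everywhere_diff (D_y F)"
    using assms by (simp_all add: smooth_imp_dif smooth_D_y)
  show ?thesis
    unfolding Omega_def D_cscale[OF d(1)] D_cscale[OF d(2)] unfolding cscale_def by (auto simp: algebra_simps)
qed

lemma smooth_zero: "smooth 0"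
  using smooth_cscale[OF osc_wave_smooth, of 0] by simp

lemma Omega_sum:
  assumes "finite S" "\<And>i. i \<in> S \<Longrightarrow> smooth (v i)"
  shows "Omega (\<Sum>i\<in>S. cscale (c i) (v i)) = (\<Sum>i\<in>S. cscale (c i) (Omega (v i))) \<and> smooth (\<Sum>i\<in>S. cscale (c i) (v i))"
  using assms
proof (induction S rule: finite_induct)
  case empty
  have "Omega 0 = 0" using Omega_cscale[OF smooth_zero, of 0] by simp
  then show ?case unfolding sum.empty by (simp only: smooth_zero simp_thms)
next
  case (insert i S)
  then have d: "smooth (v i)" and IH: "Omega (\<Sum>i\<in>S. cscale (c i) (v i)) = (\<Sum>i\<in>S. cscale (c i) (Omega (v i)))"
    "smooth (\<Sum>i\<in>S. cscale (c i) (v i))" by blast+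
  show ?case
    unfolding sum.insert[OF insert.hyps] Omega_add[OF smooth_cscale[OF d] IH(2)] Omega_cscale[OF d] IH(1)
    by (intro conjI refl smooth_add smooth_cscale d IH)
qed

section \<open>The spaces \<open>H\<^sub>l\<close>\<close>

lemma ii_powi: "\<i> powi n = exp (\<i> * of_int n * of_real pi / 2)"
proof -
  have "\<i> powi n = cis (pi / 2) powi n" by simp
  also have "\<dots> = cis (of_int n * (pi / 2))" by (rule cis_power_int)
  also have "\<dots> = exp (\<i> * of_int n * of_real pi / 2)" by (simp add: cis_conv_exp mult.assoc)
  finally show ?thesis .
qed

lemma ii_powi_4: "4 dvd n \<Longrightarrow> \<i> powi n = 1"
  by (auto elim!: dvdE simp: power_int_mult)

lemma compact_picture_subspace: "cfun.subspace (compact_picture q)"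
  unfolding cfun.subspace_def
proof (intro conjI ballI allI)
  show "0 \<in> compact_picture q" by (simp add: compact_picture_def smooth_zero)
  fix F G assume "F \<in> compact_picture q" "G \<in> compact_picture q"
  then show "F + G \<in> compact_picture q"
    unfolding compact_picture_def by (simp add: smooth_add distrib_left)
next
  fix c F assume "F \<in> compact_picture q"
  then show "cscale c F \<in> compact_picture q"
    unfolding compact_picture_def by (simp add: smooth_cscale) (simp add: cscale_def)
qed

lemma minus_one_powi: "(-1 :: 'a :: field) powi j = (if even j then 1 else -1)"
  by (simp add: power_int_minus_left)

text \<open>Translation by j \<pi> contributes i^(-mj) from the exponential, and the reflection of y
  contributes (-1)^(lj) = i^(2lj) from the profile. Their product is i^(-jq) because 4 divides m - q
  - 2l.\<close>

lemma osc_wave_compact: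
  assumes "(l, m) \<in> osc_index q"
  shows "osc_wave (l, m) \<in> compact_picture q"
proof -
  have "osc_wave (l, m) (\<theta> + of_int j * pi, (-1) powi j * y) = \<i> powi (- (j * q)) * osc_wave (l, m) (\<theta>, y)"
    for j :: int and \<theta> y
  proof -
    have par: "complex_of_real (osc l m ((-1) powi j * y)) = \<i> powi (2 * int l * j) * of_real (osc l m y)"
      by (cases "even j"; cases "even l")
        (auto elim!: evenE oddE simp: minus_one_powi osc_minus power_int_mult power_int_add mult.assoc)
    have e: "exp (- (\<i> * of_int m * of_real (\<theta> + of_int j * pi) / 2)) =
       exp (- (\<i> * of_int m * of_real \<theta> / 2)) * \<i> powi (- (m * j))"
      unfolding ii_powi exp_add[symmetric] by (rule arg_cong[of _ _ exp]) (simp add: algebra_simps add_divide_distrib)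
    have "4 dvd - (m * j) + 2 * int l * j + j * q"
    proof -
      have "- (m * j) + 2 * int l * j + j * q = (m - q - 2 * int l) * (- j)" by (simp add: algebra_simps)
      then show ?thesis using assms by (simp add: osc_index_def)
    qed
    note ii_powi_4[OF this]
    moreover have "\<i> powi (a + b + c) = \<i> powi a * \<i> powi b * \<i> powi c" for a b c
      by (simp add: power_int_add)
    ultimately have "\<i> powi (- (m * j)) * \<i> powi (2 * int l * j) * \<i> powi (j * q) = 1"
      by (simp only:)
    moreover have "a = \<i> powi (- n)" if "a * \<i> powi n = 1" for a n
      using that by (simp add: power_int_minus eq_divide_eq inverse_eq_divide)
    ultimately have k: "\<i> powi (- (m * j)) * \<i> powi (2 * int l * j) = \<i> powi (- (j * q))" by blast
    show ?thesis unfolding osc_wave_def split wave_apply par e k[symmetric] by (simp only: mult_ac)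
  qed
  then show ?thesis by (simp add: compact_picture_def osc_wave_smooth)
qed

lemma wave_compact_parity:
  assumes "wave m f \<in> compact_picture q"
  shows "f (- y) = \<i> powi (m - q) * f y"
proof -
  have "wave m f (0 + of_int 1 * pi, (-1) powi 1 * y) = \<i> powi (- (1 * q)) * wave m f (0, y)"
    using assms unfolding compact_picture_def by blast
  then have "\<i> powi (- m) * f (- y) = \<i> powi (- q) * f y"
    unfolding wave_apply ii_powi by simp
  then have "\<i> powi m * (\<i> powi (- m) * f (- y)) = \<i> powi m * (\<i> powi (- q) * f y)" by simp
  then show ?thesis by (simp add: power_int_minus power_int_diff field_simps)
qed

text \<open>Translation by \<pi> gives f(-y) = i^(m-q) f(y). For odd m-q, using this twice yields f
  = -f. Otherwise i^(m-q) is (-1)^l or its negative according to m-q-2l modulo 4, which leads to the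
  two uniqueness lemmas; for l < 2 the wrong parity contradicts \<open>par\<close>.\<close>

lemma wave_solution:
  assumes cp: "wave m f \<in> compact_picture q"
    and eig: "Omega (wave m f) = cscale (2 * lam l) (wave m f)"
    and par: "l < 2 \<Longrightarrow> \<forall>y. f (- y) = (-1) ^ l * f y"
  shows "wave m f = 0 \<or> (l, m) \<in> osc_index q \<and> (\<exists>c. wave m f = cscale c (osc_wave (l, m)))"
proof -
  have smooth: "cont_diff k f" for k
    using cp by (simp add: compact_picture_def smooth_wave_iff)
  from smooth[of 2] obtain f' f'' where f: "\<And>y. (f has_vector_derivative f' y) (at y)"
    and f': "\<And>y. (f' has_vector_derivative f'' y) (at y)"
    by (auto simp: numeral_2_eq_2)
  have ode: "of_real (y\<^sup>2) * f'' y = of_real (y ^ 4 - of_int m * y\<^sup>2 + real l * (real l - 1)) * f y" for y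
  proof -
    have "wave m (\<lambda>y. (of_real y)\<^sup>2 * (of_int m * f y - (of_real y)\<^sup>2 * f y + f'' y)) (0, y) = cscale (2 * lam l) (wave m f) (0, y)"
      using eig unfolding Omega_wave[OF f f'] by simp
    then have "(of_real y)\<^sup>2 * (of_int m * f y - (of_real y)\<^sup>2 * f y + f'' y) = of_nat l * (of_nat l - 1) * f y"
      by (simp add: wave_apply cscale_def lam_def)
    then have "(of_real y)\<^sup>2 * f'' y = of_nat l * (of_nat l - 1) * f y - (of_real y)\<^sup>2 * (of_int m * f y - (of_real y)\<^sup>2 * f y)"
      by (simp add: distrib_left eq_diff_eq add.commute)
    then show ?thesis by (simp add: algebra_simps power2_eq_square power4_eq_xxxx)
  qed
  have twist: "f (- y) = \<i> powi (m - q) * f y" for y by (rule wave_compact_parity[OF cp])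
  define n where "n = m - q - 2 * int l"
  have "4 dvd n \<or> 4 dvd n - 2 \<or> odd n" by presburger
  then consider "4 dvd m - q - 2 * int l" | "4 dvd m - q - 2 * int l - 2" | "odd (m - q)"
    by (auto simp: n_def)
  then show ?thesis
  proof cases
    case 1
    have "\<i> powi (m - q) = \<i> powi (m - q - 2 * int l) * \<i> powi (2 * int l)"
      by (subst power_int_add[symmetric]) auto
    also have "\<dots> = (-1) ^ l" by (simp add: ii_powi_4[OF 1] power_int_mult)
    finally have "f (- y) = (-1) ^ l * f y" for y using twist by simp
    from ode_solution_same_parity[OF f f' ode this] obtain c where "\<And>y. f y = c * of_real (osc l m y)" by blast
    then have "wave m f = cscale c (osc_wave (l, m))"
      unfolding osc_wave_def split wave_linear by (intro wave_cong refl)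
    then show ?thesis using 1 by (auto simp: osc_index_def)
  next
    case 2
    have "\<i> powi (m - q) = \<i> powi (m - q - 2 * int l - 2) * \<i> powi (2 * int l) * \<i> powi 2"
      by (subst power_int_add[symmetric], simp)+ simp
    also have "\<dots> = - ((-1) ^ l)" by (simp add: ii_powi_4[OF 2] power_int_mult)
    finally have opp: "f (- y) = - ((-1) ^ l * f y)" for y using twist by simp
    have "f y = 0" for y
    proof (cases "l < 2")
      case True
      with par have "f (- y) = (-1) ^ l * f y" by blast
      moreover have "x = - x \<Longrightarrow> x = 0" for x :: complex by simp
      ultimately have "(-1) ^ l * f y = 0" using opp[of y] by metis
      then show ?thesis by simp
    next
      case False
      then show ?thesis using ode_solution_opposite_parity[OF f f' ode _ smooth opp] by simp
    qed
    then show ?thesis by (simp add: wave_eq_0_iff)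
  next
    case 3
    have "f y = 0" for y
    proof -
      have "f y = \<i> powi (m - q) * f (- y)" using twist[of "- y"] unfolding minus_minus .
      also have "\<dots> = \<i> powi (m - q) * (\<i> powi (m - q) * f y)" unfolding twist[of y] ..
      also have "\<dots> = \<i> powi (2 * (m - q)) * f y" unfolding mult_2
        by (subst power_int_add) (simp_all only: mult.assoc complex_i_not_zero not_False_eq_True simp_thms)
      also have "\<i> powi (2 * (m - q)) = -1"
        unfolding power_int_mult using 3 by (simp add: minus_one_powi del: even_diff)
      finally show ?thesis by simp
    qed
    then show ?thesis by (simp add: wave_eq_0_iff)
  qed
qed

lemma weight_vector_iff: "weight_vector q m F \<longleftrightarrow> F \<in> compact_picture q \<and> F \<noteq> 0 \<and> (\<exists>f. F = wave m f)"
  by (simp add: weight_vector_def wave_def)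

lemma osc_wave_weight: "(l, m) \<in> osc_index q \<Longrightarrow> weight_vector q m (osc_wave (l, m))"
  unfolding weight_vector_iff using osc_wave_compact osc_wave_nonzero by (auto simp: osc_wave_def)

lemma K_finite_subspace: "cfun.subspace {F. K_finite q F}"
  unfolding K_finite_def by simp

text \<open>Weight vectors of equal weight are merged by updating \<open>f\<close>. Keeping zero
  components at the absent weights makes the update uniform, whether or not the new weight already
  occurs.\<close>

lemma K_finite_decompose:
  assumes "K_finite q F"
  shows "\<exists>S f. finite S \<and> (\<forall>m. wave m (f m) \<in> compact_picture q) \<and> (\<forall>m. m \<notin> S \<longrightarrow> wave m (f m) = 0)
    \<and> F = (\<Sum>m\<in>S. wave m (f m))"
  using assms unfolding K_finite_def
proof (induction rule: cfun.span_induct_alt)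
  case base
  have "wave m (\<lambda>y. 0) \<in> compact_picture q" for m
    unfolding wave_zero by (rule cfun.subspace_0[OF compact_picture_subspace])
  then show ?case using wave_zero
    by (intro exI[of _ "{}"] exI[of _ "\<lambda>m y. 0"]) (unfold sum.empty, blast intro: finite.emptyI)
next
  case (step c G F)
  then obtain S f where IH: "finite S" "\<And>m. wave m (f m) \<in> compact_picture q"
    "\<And>m. m \<notin> S \<Longrightarrow> wave m (f m) = 0" "F = (\<Sum>m\<in>S. wave m (f m))" by blast
  obtain n g where G: "G = wave n g" "wave n g \<in> compact_picture q"
    using step by (auto simp: weight_vector_iff)
  define f' where "f' = f(n := \<lambda>y. c * g y + f n y)"
  have n: "wave n (f' n) = cscale c G + wave n (f n)" by (simp add: G f'_def wave_linear)
  have o: "wave m (f' m) = wave m (f m)" if "m \<noteq> n" for m using that by (simp add: f'_def)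
  have cp: "wave m (f' m) \<in> compact_picture q" for m
  proof (cases "m = n")
    case True
    then show ?thesis using n IH(2)[of n] G
      by (simp add: cfun.subspace_add[OF compact_picture_subspace] cfun.subspace_scale[OF compact_picture_subspace])
  qed (use o IH(2) in simp)
  have "F = (\<Sum>m\<in>insert n S. wave m (f m))"
    using IH by (cases "n \<in> S") (simp_all add: insert_absorb)
  also have "\<dots> = wave n (f n) + (\<Sum>m\<in>S - {n}. wave m (f m))"
    using IH(1) by (rule sum.insert_remove)
  also have "(\<Sum>m\<in>S - {n}. wave m (f m)) = (\<Sum>m\<in>S - {n}. wave m (f' m))"
    using o by (intro sum.cong) auto
  finally have "cscale c G + F = (\<Sum>m\<in>insert n S. wave m (f' m))"
    unfolding sum.insert_remove[OF IH(1)] n by (simp only: add.assoc)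
  then show ?case
    using IH(1) IH(3) cp o by (intro exI[of _ "insert n S"] exI[of _ f'] conjI allI impI) auto
qed

lemma lam_01 [simp]: "lam 0 = 0" "lam (Suc 0) = 0"
  by (simp_all add: lam_def)

text \<open>One description for all three cases of the definition: l = 0 and l = 1 share the
  eigenvalue 0 and differ only in the parity (-1)^l.\<close>

lemma mem_H_part_iff:
  "F \<in> H_part q l \<longleftrightarrow> F \<in> compact_picture q \<and> K_finite q F \<and> Omega F = cscale (2 * lam l) F
    \<and> (l < 2 \<longrightarrow> (\<forall>\<theta> y. F (\<theta>, - y) = (-1) ^ l * F (\<theta>, y)))"
proof -
  consider "l = 0" | "l = 1" | "l \<ge> 2" by linarith
  then show ?thesis by cases (auto simp: H_part_def K_kernel_def)
qed

lemma H_part_subspace: "cfun.subspace (H_part q l)"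
  unfolding cfun.subspace_def
proof (intro conjI ballI allI)
  have "Omega 0 = 0" using Omega_cscale[OF smooth_zero, of 0] by simp
  then show "0 \<in> H_part q l"
    unfolding mem_H_part_iff
    using cfun.subspace_0[OF compact_picture_subspace] cfun.subspace_0[OF K_finite_subspace] by simp
  fix F G assume *: "F \<in> H_part q l" "G \<in> H_part q l"
  then have s: "smooth F" "smooth G" by (auto simp: mem_H_part_iff compact_picture_def)
  show "F + G \<in> H_part q l"
    using * cfun.subspace_add[OF compact_picture_subspace] cfun.subspace_add[OF K_finite_subspace]
    unfolding mem_H_part_iff Omega_add[OF s] by (simp add: cfun.scale_right_distrib distrib_left)
next
  fix c F assume *: "F \<in> H_part q l"
  then have s: "smooth F" by (auto simp: mem_H_part_iff compact_picture_def)
  have "K_finite q (cscale c F)" using * cfun.subspace_scale[OF K_finite_subspace] by (simp add: mem_H_part_iff)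
  moreover have "cscale c F (\<theta>, - y) = (-1) ^ l * cscale c F (\<theta>, y)" if "l < 2" for \<theta> y
    using * that by (simp add: mem_H_part_iff cscale_def)
  ultimately show "cscale c F \<in> H_part q l"
    using * cfun.subspace_scale[OF compact_picture_subspace]
    unfolding mem_H_part_iff Omega_cscale[OF s] by (simp add: mult.commute)
qed

lemma osc_wave_in_H_part: "(l, m) \<in> osc_index q \<Longrightarrow> osc_wave (l, m) \<in> H_part q l"
  unfolding mem_H_part_iff K_finite_def
  using osc_wave_compact[of l m q] Omega_osc[of l m] osc_wave_weight[of l m q]
  by (auto intro!: cfun.span_base) (auto simp: osc_wave_def wave_apply osc_minus)

lemma wave_in_H_part:
  assumes "wave m f \<in> H_part q l" "wave m f \<noteq> 0"
  shows "(l, m) \<in> osc_index q \<and> (\<exists>c. wave m f = cscale c (osc_wave (l, m)))"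
proof -
  have "f (- y) = (-1) ^ l * f y" if "l < 2" for y
  proof -
    have "wave m f (0, - y) = (-1) ^ l * wave m f (0, y)" using assms(1) that unfolding mem_H_part_iff by blast
    then show ?thesis by (simp add: wave_apply)
  qed
  with wave_solution[of m f q l] assms show ?thesis unfolding mem_H_part_iff by blast
qed

text \<open>Since \<Omega>'' preserves weights, \<open>fourier_independent\<close> splits the
  eigenvalue equation of F into one equation for each weight; the parity condition splits in the
  same way.\<close>

lemma H_part_decompose:
  assumes "F \<in> H_part q l"
  shows "\<exists>S f. finite S \<and> F = (\<Sum>m\<in>S. wave m (f m)) \<and> (\<forall>m\<in>S. wave m (f m) \<in> H_part q l)"
proof -
  have F: "K_finite q F" "Omega F = cscale (2 * lam l) F"
    "l < 2 \<Longrightarrow> F (\<theta>, - y) = (-1) ^ l * F (\<theta>, y)" for \<theta> y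
    using assms by (auto simp: mem_H_part_iff)
  obtain S f where S: "finite S" and cp: "\<And>m. wave m (f m) \<in> compact_picture q"
    and FS: "F = (\<Sum>m\<in>S. wave m (f m))"
    using K_finite_decompose[OF F(1)] by blast
  have sm: "smooth (wave m (f m))" for m using cp by (simp add: compact_picture_def)
  have "\<exists>g. Omega (wave m (f m)) - cscale (2 * lam l) (wave m (f m)) = wave m g" for m
  proof -
    have "cont_diff 2 (f m)" using sm[of m] by (simp add: smooth_wave_iff)
    then obtain f' f'' where f: "\<And>y. ((f m) has_vector_derivative f' y) (at y)"
      and f': "\<And>y. (f' has_vector_derivative f'' y) (at y)" by (auto simp: numeral_2_eq_2)
    show ?thesis unfolding Omega_wave[OF f f'] wave_linear by blast
  qed
  then obtain g where g: "\<And>m. Omega (wave m (f m)) - cscale (2 * lam l) (wave m (f m)) = wave m (g m)" by metis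
  have "Omega F = (\<Sum>m\<in>S. Omega (wave m (f m)))"
    unfolding FS using Omega_sum[OF S, of "\<lambda>m. wave m (f m)" "\<lambda>_. 1"] sm by simp
  then have "(\<Sum>m\<in>S. wave m (g m)) = 0"
    using F(2) unfolding g[symmetric] sum_subtractf FS cfun.scale_sum_right by simp
  then have "wave m (g m) = 0" if "m \<in> S" for m using fourier_independent[OF S _ that] by blast
  then have om: "Omega (wave m (f m)) = cscale (2 * lam l) (wave m (f m))" if "m \<in> S" for m
    using g[of m] that by simp
  have "wave m (f m) \<in> H_part q l" if m: "m \<in> S" for m
  proof -
    have "K_finite q (wave m (f m))"
    proof (cases "wave m (f m) = 0")
      case True
      then show ?thesis using cfun.subspace_0[OF K_finite_subspace] by simp
    next
      case False
      then have "weight_vector q m (wave m (f m))" using cp by (auto simp: weight_vector_iff)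
      then show ?thesis unfolding K_finite_def by (intro cfun.span_base) blast
    qed
    moreover have "wave m (f m) (\<theta>, - y) = (-1) ^ l * wave m (f m) (\<theta>, y)" if "l < 2" for \<theta> y
    proof -
      have "(\<Sum>m\<in>S. wave m (\<lambda>y. f m (- y) - (-1) ^ l * f m y)) (\<theta>, y) = F (\<theta>, - y) - (-1) ^ l * F (\<theta>, y)" for \<theta> y
        unfolding FS sum_fun_apply wave_apply by (simp add: sum_distrib_left sum_subtractf[symmetric] algebra_simps)
      then have "(\<Sum>m\<in>S. wave m (\<lambda>y. f m (- y) - (-1) ^ l * f m y)) = 0"
        using F(3)[OF that] by (auto simp: fun_eq_iff)
      from fourier_independent[OF S this m] have "f m (- y) = (-1) ^ l * f m y"
        by (simp add: wave_eq_0_iff)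
      then show ?thesis by (simp add: wave_apply)
    qed
    ultimately show ?thesis using cp om[OF m] unfolding mem_H_part_iff by blast
  qed
  with S FS show ?thesis by blast
qed

lemma H_part_eq_span: "H_part q l = cfun.span (osc_wave ` {i \<in> osc_index q. fst i = l})"
proof
  show "cfun.span (osc_wave ` {i \<in> osc_index q. fst i = l}) \<subseteq> H_part q l"
    using osc_wave_in_H_part by (intro cfun.span_minimal[OF _ H_part_subspace]) auto
  show "H_part q l \<subseteq> cfun.span (osc_wave ` {i \<in> osc_index q. fst i = l})"
  proof
    fix F assume "F \<in> H_part q l"
    then obtain S f where S: "finite S" "F = (\<Sum>m\<in>S. wave m (f m))" "\<And>m. m \<in> S \<Longrightarrow> wave m (f m) \<in> H_part q l"
      using H_part_decompose by blast
    show "F \<in> cfun.span (osc_wave ` {i \<in> osc_index q. fst i = l})"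
      unfolding S(2)
    proof (rule cfun.span_sum)
      fix m assume "m \<in> S"
      note m = wave_in_H_part[OF S(3)[OF this]]
      show "wave m (f m) \<in> cfun.span (osc_wave ` {i \<in> osc_index q. fst i = l})"
      proof (cases "wave m (f m) = 0")
        case False
        with m obtain c where "(l, m) \<in> osc_index q" "wave m (f m) = cscale c (osc_wave (l, m))" by blast
        then show ?thesis by (simp add: cfun.span_scale cfun.span_base)
      qed (simp add: cfun.span_zero)
    qed
  qed
qed

text \<open>Each weight vector of \<open>H_part q l\<close> is a multiple of the basis vector with
  the same weight. The predicate \<open>P\<close> stands for the bound on m, so that lowest and
  highest weight parts are treated together.\<close>

lemma span_weight_vectors:
  "cfun.span {F \<in> H_part q l. \<exists>m. weight_vector q m F \<and> P m} =
    cfun.span (osc_wave ` {i \<in> osc_index q. fst i = l \<and> P (snd i)})"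
proof
  show "cfun.span {F \<in> H_part q l. \<exists>m. weight_vector q m F \<and> P m}
      \<subseteq> cfun.span (osc_wave ` {i \<in> osc_index q. fst i = l \<and> P (snd i)})"
  proof (rule cfun.span_minimal, safe)
    fix F m assume *: "F \<in> H_part q l" "weight_vector q m F" "P m"
    then obtain f where "F = wave m f" "F \<noteq> 0" by (auto simp: weight_vector_iff)
    with wave_in_H_part[of m f q l] * obtain c where "(l, m) \<in> osc_index q" "F = cscale c (osc_wave (l, m))" by blast
    with * show "F \<in> cfun.span (osc_wave ` {i \<in> osc_index q. fst i = l \<and> P (snd i)})"
      by (simp add: cfun.span_scale cfun.span_base)
  qed
  show "cfun.span (osc_wave ` {i \<in> osc_index q. fst i = l \<and> P (snd i)})
      \<subseteq> cfun.span {F \<in> H_part q l. \<exists>m. weight_vector q m F \<and> P m}"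
    using osc_wave_in_H_part osc_wave_weight by (intro cfun.span_mono) fastforce
qed

text \<open>\<Omega>'' separates j from l unless j(j-1) = l(l-1), which for j \<noteq> l means j + l
  = 1. The remaining pair 0, 1 is separated by the reflection of y, which acts on
  \<open>H_part q l\<close> by (-1)^l.\<close>

lemma direct_family_H_part: "direct_family UNIV (H_part q)"
  unfolding direct_family_def
proof (intro conjI ballI allI impI)
  show "cfun.subspace (H_part q l)" for l by (rule H_part_subspace)
  fix S :: "nat set" and F l
  assume *: "finite S \<and> S \<subseteq> UNIV \<and> (\<forall>l\<in>S. F l \<in> H_part q l) \<and> (\<Sum>l\<in>S. F l) = 0" and l: "l \<in> S"
  have om: "Omega (F l) = cscale (2 * lam l) (F l)" and sm: "smooth (F l)" if "l \<in> S" for l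
    using * that by (auto simp: mem_H_part_iff compact_picture_def)
  have par: "F l (\<theta>, - y) = (-1) ^ l * F l (\<theta>, y)" if "l \<in> S" for l \<theta> y
  proof -
    have "F l \<in> cfun.span (osc_wave ` {i \<in> osc_index q. fst i = l})" using * that H_part_eq_span by blast
    then show ?thesis
    proof (induction rule: cfun.span_induct_alt)
      case (step c G H)
      then have "G (\<theta>, - y) = (-1) ^ l * G (\<theta>, y)" by (auto simp: osc_wave_def wave_apply osc_minus)
      with step show ?case by (simp add: cscale_def algebra_simps)
    qed simp
  qed
  have "F l \<in> {0}"
  proof (rule separate_components[OF cfun.subspace_single_0, of S])
    fix j assume j: "j \<in> S" "j \<noteq> l"
    show "\<exists>\<mu>. \<mu> j \<noteq> \<mu> l \<and> (\<forall>c. (\<Sum>i\<in>S. cscale (c i) (F i)) \<in> {0} \<longrightarrow>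
             (\<Sum>i\<in>S. cscale (c i * \<mu> i) (F i)) \<in> {0})"
    proof (cases "lam j = lam l")
      case False
      show ?thesis
      proof (intro exI[of _ "\<lambda>l. 2 * lam l"] conjI allI impI)
        fix c assume "(\<Sum>i\<in>S. cscale (c i) (F i)) \<in> {0}"
        moreover have "Omega 0 = 0" using Omega_cscale[OF smooth_zero, of 0] by simp
        moreover have "Omega (\<Sum>i\<in>S. cscale (c i) (F i)) = (\<Sum>i\<in>S. cscale (c i) (Omega (F i)))"
          using Omega_sum[of S F c] sm * by blast
        moreover have "\<dots> = (\<Sum>i\<in>S. cscale (c i * (2 * lam i)) (F i))"
          by (intro sum.cong) (simp_all add: om)
        ultimately show "(\<Sum>i\<in>S. cscale (c i * (2 * lam i)) (F i)) \<in> {0}" by simp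
      qed (use False in simp)
    next
      case True
      have odd: "(-1 :: complex) ^ j \<noteq> (-1) ^ l"
      proof -
        have "of_nat j * (of_nat j - 1) = (of_nat l * (of_nat l - 1) :: complex)"
          using True by (simp add: lam_def)
        then have "(of_nat j - of_nat l) * (of_nat j + of_nat l - 1) = (0 :: complex)"
          by (simp add: algebra_simps)
        then have "of_nat (j + l) = (of_nat 1 :: complex)" using j(2) by simp
        then have "j + l = 1" unfolding of_nat_eq_iff .
        then have "j = 0 \<and> l = 1 \<or> j = 1 \<and> l = 0" by arith
        then show ?thesis by auto
      qed
      show ?thesis
      proof (intro exI[of _ "\<lambda>l. (-1) ^ l"] conjI allI impI odd)
        fix c assume 0: "(\<Sum>i\<in>S. cscale (c i) (F i)) \<in> {0}"
        have "(\<Sum>i\<in>S. cscale (c i * (-1) ^ i) (F i)) (\<theta>, y) = (\<Sum>i\<in>S. cscale (c i) (F i)) (\<theta>, - y)" for \<theta> y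
          unfolding sum_fun_apply by (intro sum.cong) (simp_all add: par cscale_def)
        with 0 show "(\<Sum>i\<in>S. cscale (c i * (-1) ^ i) (F i)) \<in> {0}" by (auto simp: fun_eq_iff)
      qed
    qed
  qed (use * l in auto)
  then show "F l = 0" by simp
qed

section \<open>Invariant subspaces\<close>

text \<open>Submodules on the level of functions. The Lie algebra is real while the subspace is
  complex; therefore the complex combinations \<kappa>, \<open>\<eta>\<^sup>\<plusminus>\<close>,
  raise and lower preserve it too.\<close>

definition jacobi_invariant :: "plane_fun set \<Rightarrow> bool" where
  "jacobi_invariant U \<longleftrightarrow> cfun.subspace U \<and> (\<forall>\<xi>\<in>jacobi_algebra. \<forall>x\<in>U. jacobi_act \<xi> x \<in> U)"

lemma jacobi_act_zero: "jacobi_act \<xi> 0 = 0"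
  using jacobi_act_cscale[OF everywhere_diff_zero, of \<xi> 0] by simp

lemma jacobi_invariant_zero: "jacobi_invariant {0}"
  by (simp add: jacobi_invariant_def jacobi_act_zero)

context
  fixes U :: "plane_fun set" and F :: plane_fun
  assumes U: "jacobi_invariant U" and F: "F \<in> U"
begin

lemma jacobi_invariant_kappa: "act_kappa F \<in> U"
proof -
  \<comment> \<open>This is \<open>e\<^sup>+ - e\<^sup>-\<close>, and \<kappa> is -i times
    it.\<close>
  define \<xi> :: jacobi where "\<xi> = (vector [vector [0, 1], vector [- 1, 0]], 0, 0)"
  have "\<xi> \<in> jacobi_algebra" by (simp add: \<xi>_def jacobi_algebra_iff)
  then have "cscale (- \<i>) (jacobi_act \<xi> F) \<in> U"
    using U F unfolding jacobi_invariant_def by (blast intro: cfun.subspace_scale)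
  moreover have "cscale (- \<i>) (jacobi_act \<xi> F) = act_kappa F"
    by (rule ext, unfold cscale_def jacobi_act_decomp) (simp add: coef_defs \<xi>_def)
  ultimately show ?thesis by simp
qed

lemma jacobi_invariant_eta: "act_eta_plus F \<in> U" "act_eta_minus F \<in> U"
proof -
  \<comment> \<open>These are \<open>h\<close> and \<open>e\<^sup>+ + e\<^sup>-\<close>.\<close>
  define \<xi> \<zeta> :: jacobi where "\<xi> = (vector [vector [1, 0], vector [0, - 1]], 0, 0)"
    and "\<zeta> = (vector [vector [0, 1], vector [1, 0]], 0, 0)"
  have "\<xi> \<in> jacobi_algebra" "\<zeta> \<in> jacobi_algebra" by (simp_all add: \<xi>_def \<zeta>_def jacobi_algebra_iff)
  then have "cscale c (jacobi_act \<xi> F) + cscale d (jacobi_act \<zeta> F) \<in> U" for c d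
    using U F unfolding jacobi_invariant_def by (blast intro: cfun.subspace_scale cfun.subspace_add)
  moreover have "cscale (1/2) (jacobi_act \<xi> F) + cscale (\<i>/2) (jacobi_act \<zeta> F) = act_eta_plus F"
    by (rule ext, unfold plus_fun_apply cscale_def jacobi_act_decomp,
        simp add: coef_defs \<xi>_def \<zeta>_def algebra_simps)
  moreover have "cscale (1/2) (jacobi_act \<xi> F) + cscale (- \<i>/2) (jacobi_act \<zeta> F) = act_eta_minus F"
    by (rule ext, unfold plus_fun_apply cscale_def jacobi_act_decomp,
        simp add: coef_defs \<xi>_def \<zeta>_def algebra_simps)
  ultimately show "act_eta_plus F \<in> U" "act_eta_minus F \<in> U" by metis+
qed

lemma jacobi_invariant_raise_lower: "act_raise F \<in> U" "act_lower F \<in> U"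
proof -
  define \<xi> \<zeta> :: jacobi where "\<xi> = (0, vector [1, 0], 0)" and "\<zeta> = (0, vector [0, 1], 0)"
  have "\<xi> \<in> jacobi_algebra" "\<zeta> \<in> jacobi_algebra" by (simp_all add: \<xi>_def \<zeta>_def jacobi_algebra_iff)
  then have "cscale c (jacobi_act \<xi> F) + cscale d (jacobi_act \<zeta> F) \<in> U" for c d
    using U F unfolding jacobi_invariant_def by (blast intro: cfun.subspace_scale cfun.subspace_add)
  moreover have "cscale 1 (jacobi_act \<xi> F) + cscale \<i> (jacobi_act \<zeta> F) = act_raise F"
    by (rule ext, unfold plus_fun_apply cscale_def jacobi_act_decomp,
        simp add: coef_defs \<xi>_def \<zeta>_def algebra_simps)
  moreover have "cscale (- 1) (jacobi_act \<xi> F) + cscale \<i> (jacobi_act \<zeta> F) = act_lower F"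
    by (rule ext, unfold plus_fun_apply cscale_def jacobi_act_decomp,
        simp add: coef_defs \<xi>_def \<zeta>_def algebra_simps)
  ultimately show "act_raise F \<in> U" "act_lower F \<in> U" by metis+
qed

end

text \<open>\<kappa> separates different weights. At equal weight the eigenvalues of
  \<open>\<eta>\<^sup>-\<eta>\<^sup>+\<close> differ by a nonzero multiple of (l-l')(l+l'-1), which
  vanishes for l \<noteq> l' only if l + l' = 1. Then 2l and 2l' are not congruent modulo 4, so the
  two indices cannot both belong to \<open>osc_index q\<close>.\<close>

lemma invariant_component:
  assumes U: "jacobi_invariant U" and T: "finite T" "T \<subseteq> osc_index q" "i0 \<in> T"
    and sum: "(\<Sum>i\<in>T. cscale (c i) (osc_wave i)) \<in> U"
  shows "cscale (c i0) (osc_wave i0) \<in> U"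
proof (rule separate_components[of U T i0 "\<lambda>i. cscale (c i) (osc_wave i)"])
  show "cfun.subspace U" using U by (simp add: jacobi_invariant_def)
  fix j assume j: "j \<in> T" "j \<noteq> i0"
  \<comment> \<open>The coefficient of \<open>\<eta>\<^sup>+\<close> at m times the coefficient of
    \<open>\<eta>\<^sup>-\<close> at m+4.\<close>
  define \<nu> :: "nat \<times> int \<Rightarrow> complex" where
    "\<nu> = (\<lambda>(l, m). - (of_int m + 2 * of_nat l + 1) / 4 * ((of_int (m + 4) - 2 * of_nat l - 1) / 4))"
  have K: "(\<Sum>i\<in>T. cscale (d i * (of_int (snd i) / 2)) (cscale (c i) (osc_wave i))) \<in> U"
    if "(\<Sum>i\<in>T. cscale (d i) (cscale (c i) (osc_wave i))) \<in> U" for d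
  proof -
    have "act_kappa (\<Sum>i\<in>T. cscale (d i * c i) (osc_wave i)) = (\<Sum>i\<in>T. cscale (d i * c i) (act_kappa (osc_wave i)))"
      using linear_sum[OF act_add(3) act_cscale(3) T(1) osc_wave_dif, of "\<lambda>i. d i * c i" "\<lambda>i. i"] by blast
    also have "\<dots> = (\<Sum>i\<in>T. cscale (d i * (of_int (snd i) / 2)) (cscale (c i) (osc_wave i)))"
      by (intro sum.cong refl) (auto simp: act_kappa_osc mult_ac)
    finally show ?thesis using jacobi_invariant_kappa[OF U that] by simp
  qed
  have E: "(\<Sum>i\<in>T. cscale (d i * \<nu> i) (cscale (c i) (osc_wave i))) \<in> U"
    if "(\<Sum>i\<in>T. cscale (d i) (cscale (c i) (osc_wave i))) \<in> U" for d
  proof -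
    have everywhere_diff: "everywhere_diff (act_eta_plus (osc_wave i))" for i
      by (cases i) (simp add: act_eta_plus_osc everywhere_diff_cscale osc_wave_dif)
    have "act_eta_minus (act_eta_plus (osc_wave i)) = cscale (\<nu> i) (osc_wave i)" for i
    proof (cases i)
      case (Pair l m)
      show ?thesis unfolding Pair act_eta_plus_osc act_cscale[OF osc_wave_dif] act_eta_minus_osc by (simp add: \<nu>_def)
    qed
    note eig = this
    have "act_eta_plus (\<Sum>i\<in>T. cscale (d i * c i) (osc_wave i)) = (\<Sum>i\<in>T. cscale (d i * c i) (act_eta_plus (osc_wave i)))"
      using linear_sum[OF act_add(1) act_cscale(1) T(1) osc_wave_dif, of "\<lambda>i. d i * c i" "\<lambda>i. i"] by blast
    then have "act_eta_minus (act_eta_plus (\<Sum>i\<in>T. cscale (d i * c i) (osc_wave i)))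
        = (\<Sum>i\<in>T. cscale (d i * c i) (act_eta_minus (act_eta_plus (osc_wave i))))"
      using linear_sum[OF act_add(2) act_cscale(2) T(1) everywhere_diff, of "\<lambda>i. d i * c i" "\<lambda>i. i"] by simp
    also have "\<dots> = (\<Sum>i\<in>T. cscale (d i * \<nu> i) (cscale (c i) (osc_wave i)))"
      by (intro sum.cong refl) (simp add: eig mult_ac)
    finally show ?thesis using jacobi_invariant_eta(2)[OF U jacobi_invariant_eta(1)[OF U that]] by simp
  qed
  show "\<exists>\<mu>. \<mu> j \<noteq> \<mu> i0 \<and> (\<forall>d. (\<Sum>i\<in>T. cscale (d i) (cscale (c i) (osc_wave i))) \<in> U \<longrightarrow>
            (\<Sum>i\<in>T. cscale (d i * \<mu> i) (cscale (c i) (osc_wave i))) \<in> U)"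
  proof (cases "snd j = snd i0")
    case False
    then show ?thesis using K by (intro exI[of _ "\<lambda>i. of_int (snd i) / 2"]) simp
  next
    case True
    obtain l l' m where lm: "j = (l, m)" "i0 = (l', m)" "l \<noteq> l'" using True j(2) by (cases j; cases i0) auto
    have dv: "4 dvd m - q - 2 * int l" "4 dvd m - q - 2 * int l'" using T j lm by (auto simp: osc_index_def)
    have "\<nu> j \<noteq> \<nu> i0"
    proof
      assume "\<nu> j = \<nu> i0"
      moreover have "\<nu> (l, m) = - of_int ((m + 2 * int l + 1) * ((m + 4) - 2 * int l - 1)) / 16" for l
        unfolding \<nu>_def by (simp add: algebra_simps)
      ultimately have "of_int ((m + 2 * int l + 1) * ((m + 4) - 2 * int l - 1)) =
          (of_int ((m + 2 * int l' + 1) * ((m + 4) - 2 * int l' - 1)) :: complex)"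
        unfolding lm by (simp only: divide_cancel_right neg_equal_iff_equal) simp
      then have "(m + 2 * int l + 1) * ((m + 4) - 2 * int l - 1) = (m + 2 * int l' + 1) * ((m + 4) - 2 * int l' - 1)"
        unfolding of_int_eq_iff .
      then have "4 * ((int l - int l') * (int l + int l' - 1)) = 0" by (simp add: algebra_simps)
      then have "int l + int l' = 1" using lm(3) by simp
      with dv show False by presburger
    qed
    then show ?thesis using E by blast
  qed
qed (use T sum in auto)

section \<open>Linear independence of the weight basis\<close>

lemma span_osc_explicit:
  assumes "F \<in> cfun.span (osc_wave ` S)"
  obtains T c where "finite T" "T \<subseteq> S" "F = (\<Sum>i\<in>T. cscale (c i) (osc_wave i))"
proof -
  obtain t r where t: "finite t" "t \<subseteq> osc_wave ` S" "F = (\<Sum>a\<in>t. cscale (r a) a)"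
    using assms unfolding cfun.span_explicit by blast
  then obtain T where T: "T \<subseteq> S" "inj_on osc_wave T" "t = osc_wave ` T"
    by (auto simp: subset_image_inj)
  have "F = (\<Sum>i\<in>T. cscale (r (osc_wave i)) (osc_wave i))"
    unfolding t(3) T(3) by (simp add: sum.reindex[OF T(2)])
  moreover have "finite T" using t(1) T(2,3) by (simp add: finite_image_iff)
  ultimately show ?thesis using that[of T "\<lambda>i. r (osc_wave i)"] T(1) by simp
qed

text \<open>For the invariant space {0}, \<open>invariant_component\<close> says that a vanishing
  combination has vanishing terms. The coefficient -1 moves \<open>osc_wave i\<close> to the side of
  the combination.\<close>

lemma osc_wave_not_in_span:
  assumes "i \<in> osc_index q" "R \<subseteq> osc_index q" "i \<notin> R"
  shows "osc_wave i \<notin> cfun.span (osc_wave ` R)"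
proof
  assume "osc_wave i \<in> cfun.span (osc_wave ` R)"
  then obtain T c where T: "finite T" "T \<subseteq> R" "osc_wave i = (\<Sum>j\<in>T. cscale (c j) (osc_wave j))"
    by (rule span_osc_explicit)
  have i: "i \<notin> T" using T assms by auto
  define d where "d = c(i := - 1)"
  have "(\<Sum>j\<in>insert i T. cscale (d j) (osc_wave j)) = cscale (d i) (osc_wave i) + (\<Sum>j\<in>T. cscale (d j) (osc_wave j))"
    by (rule sum.insert[OF T(1) i])
  also have "(\<Sum>j\<in>T. cscale (d j) (osc_wave j)) = osc_wave i"
    unfolding T(3) using i by (intro sum.cong) (auto simp: d_def)
  also have "cscale (d i) (osc_wave i) + osc_wave i = 0" by (simp add: d_def)
  finally have "cscale (d i) (osc_wave i) \<in> {0}"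
    using T assms by (intro invariant_component[OF jacobi_invariant_zero, of "insert i T" q i d]) auto
  then show False using osc_wave_nonzero[of i] by (simp add: d_def)
qed

text \<open>Each clause is a move whose coefficient under \<open>\<eta>\<^sup>\<plusminus>\<close>,
  raise or lower is nonzero; the upward moves exclude l = 1 because of the factor l-1. A predicate
  fits both index sets and the condition \<open>osc_wave i \<in> U\<close>.\<close>

definition ladder_closed :: "int \<Rightarrow> (nat \<times> int \<Rightarrow> bool) \<Rightarrow> bool" where
  "ladder_closed q P \<longleftrightarrow> (\<forall>l m. (l, m) \<in> osc_index q \<longrightarrow> P (l, m) \<longrightarrow>
     (m + 2 * int l + 1 \<noteq> 0 \<longrightarrow> P (l, m + 4)) \<and>
     (m \<noteq> 2 * int l + 1 \<longrightarrow> P (l, m - 4)) \<and>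
     (l \<ge> 1 \<longrightarrow> P (l - 1, m + 2) \<and> P (l - 1, m - 2)) \<and>
     (l \<noteq> 1 \<longrightarrow> m + 2 * int l + 1 \<noteq> 0 \<longrightarrow> P (l + 1, m + 2)) \<and>
     (l \<noteq> 1 \<longrightarrow> m \<noteq> 2 * int l + 1 \<longrightarrow> P (l + 1, m - 2)))"

lemma up_coeff_eq_0_iff: "up_coeff l m = 0 \<longleftrightarrow> l = 1 \<or> m + 2 * int l + 1 = 0"
proof -
  have "4 * real l ^ 2 - 1 \<noteq> 0"
  proof
    assume "4 * real l ^ 2 - 1 = 0"
    then have "real (4 * l ^ 2) = real 1" by simp
    then have "4 * l ^ 2 = 1" unfolding of_nat_eq_iff .
    then show False by presburger
  qed
  moreover have "real_of_int m + 2 * real l + 1 = of_int (m + 2 * int l + 1)" by simp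
  ultimately show ?thesis unfolding up_coeff_def by (simp only: mult_eq_0_iff divide_eq_0_iff of_int_eq_0_iff) auto
qed

lemma coef_eq_0_iff:
  "- (of_int m + 2 * of_nat l + 1) / 4 = (0 :: complex) \<longleftrightarrow> m + 2 * int l + 1 = 0"
  "(of_int m - 2 * of_nat l - 1) / 4 = (0 :: complex) \<longleftrightarrow> m = 2 * int l + 1"
proof -
  have "of_int m + 2 * of_nat l + 1 = (of_int (m + 2 * int l + 1) :: complex)"
    "of_int m - 2 * of_nat l - 1 = (of_int (m - 2 * int l - 1) :: complex)" by simp_all
  then show "- (of_int m + 2 * of_nat l + 1) / 4 = (0 :: complex) \<longleftrightarrow> m + 2 * int l + 1 = 0"
    "(of_int m - 2 * of_nat l - 1) / 4 = (0 :: complex) \<longleftrightarrow> m = 2 * int l + 1"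
    by (simp_all only: neg_equal_0_iff_equal divide_eq_0_iff of_int_eq_0_iff) auto
qed

lemma osc_index_steps:
  assumes "(l, m) \<in> osc_index q"
  shows "(l, m + 4) \<in> osc_index q" "(l, m - 4) \<in> osc_index q"
    "(l + 1, m + 2) \<in> osc_index q" "(l + 1, m - 2) \<in> osc_index q"
    "l \<ge> 1 \<Longrightarrow> (l - 1, m + 2) \<in> osc_index q" "l \<ge> 1 \<Longrightarrow> (l - 1, m - 2) \<in> osc_index q"
  using assms unfolding osc_index_def by (simp_all add: of_nat_diff) presburger+

lemma cscale_osc_in_subspace:
  assumes "cfun.subspace U"
  shows "cscale c (osc_wave i) \<in> U \<longleftrightarrow> c = 0 \<or> osc_wave i \<in> U"
proof (cases "c = 0")
  case True
  then show ?thesis using cfun.subspace_0[OF assms] by simp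
next
  case False
  then have "osc_wave i = cscale (inverse c) (cscale c (osc_wave i))" by simp
  then show ?thesis using cfun.subspace_scale[OF assms] False by metis
qed

text \<open>An oscillator operator returns two terms of equal weight at once, and
  \<open>invariant_component\<close> splits them. At l = 0 the truncated \<open>l - 1\<close> is 0
  again, but the condition on \<open>c\<close> makes that term vanish.\<close>

lemma invariant_pair:
  assumes U: "jacobi_invariant U" and idx: "(l, m) \<in> osc_index q" and n: "n = m + 2 \<or> n = m - 2"
    and sum: "cscale c (osc_wave (l - 1, n)) + cscale d (osc_wave (l + 1, n)) \<in> U" and c: "c = 0 \<longleftrightarrow> l = 0"
  shows "l \<ge> 1 \<longrightarrow> osc_wave (l - 1, n) \<in> U" "d \<noteq> 0 \<longrightarrow> osc_wave (l + 1, n) \<in> U"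
proof -
  have s: "cfun.subspace U" using U by (simp add: jacobi_invariant_def)
  have "(l \<ge> 1 \<longrightarrow> osc_wave (l - 1, n) \<in> U) \<and> (d \<noteq> 0 \<longrightarrow> osc_wave (l + 1, n) \<in> U)"
  proof (cases "l = 0")
    case True
    then have "cscale d (osc_wave (l + 1, n)) \<in> U" using sum c by simp
    then show ?thesis using True cscale_osc_in_subspace[OF s] by auto
  next
    case False
    define e where "e i = (if fst i = l - 1 then c else d)" for i :: "nat \<times> int"
    have sum': "(\<Sum>i\<in>{(l - 1, n), (l + 1, n)}. cscale (e i) (osc_wave i)) \<in> U"
      using sum False by (subst sum.insert) (auto simp: e_def)
    have sub: "{(l - 1, n), (l + 1, n)} \<subseteq> osc_index q"
      using osc_index_steps[OF idx] n False by auto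
    have e: "cscale (e i) (osc_wave i) \<in> U" if "i \<in> {(l - 1, n), (l + 1, n)}" for i
      by (rule invariant_component[OF U _ sub that sum']) simp
    have "Suc l \<noteq> l - Suc 0" by arith
    with e[of "(l - 1, n)"] e[of "(l + 1, n)"] show ?thesis
      using False c cscale_osc_in_subspace[OF s] by (auto simp: e_def)
  qed
  then show "l \<ge> 1 \<longrightarrow> osc_wave (l - 1, n) \<in> U" "d \<noteq> 0 \<longrightarrow> osc_wave (l + 1, n) \<in> U" by auto
qed

text \<open>A nonzero coefficient can be divided out, so every move of the ladder stays inside the
  invariant space.\<close>

lemma ladder_closed_invariant:
  assumes U: "jacobi_invariant U"
  shows "ladder_closed q (\<lambda>i. osc_wave i \<in> U)"
  unfolding ladder_closed_def
proof (intro allI impI)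
  fix l m assume idx: "(l, m) \<in> osc_index q" and F: "osc_wave (l, m) \<in> U"
  have s: "cfun.subspace U" using U by (simp add: jacobi_invariant_def)
  have p: "m + 2 * int l + 1 \<noteq> 0 \<longrightarrow> osc_wave (l, m + 4) \<in> U"
    using jacobi_invariant_eta(1)[OF U F] unfolding act_eta_plus_osc cscale_osc_in_subspace[OF s] coef_eq_0_iff by blast
  have n: "m \<noteq> 2 * int l + 1 \<longrightarrow> osc_wave (l, m - 4) \<in> U"
    using jacobi_invariant_eta(2)[OF U F] unfolding act_eta_minus_osc cscale_osc_in_subspace[OF s] coef_eq_0_iff by blast
  note r = invariant_pair[OF U idx _ jacobi_invariant_raise_lower(1)[OF U F, unfolded act_raise_osc]]
  note w = invariant_pair[OF U idx _ jacobi_invariant_raise_lower(2)[OF U F, unfolded act_lower_osc]]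
  show "(m + 2 * int l + 1 \<noteq> 0 \<longrightarrow> osc_wave (l, m + 4) \<in> U) \<and>
     (m \<noteq> 2 * int l + 1 \<longrightarrow> osc_wave (l, m - 4) \<in> U) \<and>
     (l \<ge> 1 \<longrightarrow> osc_wave (l - 1, m + 2) \<in> U \<and> osc_wave (l - 1, m - 2) \<in> U) \<and>
     (l \<noteq> 1 \<longrightarrow> m + 2 * int l + 1 \<noteq> 0 \<longrightarrow> osc_wave (l + 1, m + 2) \<in> U) \<and>
     (l \<noteq> 1 \<longrightarrow> m \<noteq> 2 * int l + 1 \<longrightarrow> osc_wave (l + 1, m - 2) \<in> U)"
    using p n r w by (auto simp: up_coeff_eq_0_iff)
qed

lemma jacobi_invariant_span:
  assumes S: "S \<subseteq> osc_index q" and ladder: "ladder_closed q (\<lambda>i. i \<in> S)"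
  shows "jacobi_invariant (cfun.span (osc_wave ` S))"
  unfolding jacobi_invariant_def
proof (intro conjI ballI)
  let ?V = "cfun.span (osc_wave ` S)"
  \<comment> \<open>Every term in the image of a basis vector has coefficient 0 or an index in
    \<open>S\<close>; this alternative is what ladder closure provides.\<close>
  have base: "c = 0 \<or> i \<in> S \<Longrightarrow> cscale c (osc_wave i) \<in> ?V" for c i
    by (auto intro: cfun.span_zero cfun.span_scale cfun.span_base)
  fix \<xi> F assume "F \<in> ?V"
  then have "everywhere_diff F \<and> jacobi_act \<xi> F \<in> ?V"
  proof (induction rule: cfun.span_induct_alt)
    case base
    show ?case unfolding jacobi_act_zero using everywhere_diff_zero cfun.span_zero by blast
  next
    case (step c G H)
    then obtain l m where G: "G = osc_wave (l, m)" and lm: "(l, m) \<in> S" by auto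
    note L = ladder[unfolded ladder_closed_def, rule_format, of l m, OF _ lm]
    have idx: "(l, m) \<in> osc_index q" using lm S by blast
    have "act_eta_plus G \<in> ?V" unfolding G act_eta_plus_osc
      by (rule base) (unfold coef_eq_0_iff, use L[OF idx] in blast)
    moreover have "act_eta_minus G \<in> ?V" unfolding G act_eta_minus_osc
      by (rule base) (unfold coef_eq_0_iff, use L[OF idx] in blast)
    moreover have "act_kappa G \<in> ?V" unfolding G act_kappa_osc using base lm by blast
    moreover have "act_raise G \<in> ?V" unfolding G act_raise_osc
      by (intro cfun.span_add base)
        (use L[OF idx] in \<open>auto simp: up_coeff_eq_0_iff\<close>)
    moreover have "act_lower G \<in> ?V" unfolding G act_lower_osc
      by (intro cfun.span_add base)
        (use L[OF idx] in \<open>auto simp: up_coeff_eq_0_iff\<close>)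
    moreover have "G \<in> ?V" using lm G by (intro cfun.span_base) auto
    ultimately have "jacobi_act \<xi> G \<in> ?V"
      unfolding jacobi_act_sum_form by (intro cfun.span_add cfun.span_scale)
    moreover have d: "everywhere_diff G" "everywhere_diff H" using step G osc_wave_dif by auto
    ultimately show ?case
      using step by (simp only: jacobi_act_add[OF everywhere_diff_cscale[OF d(1)] d(2)] jacobi_act_cscale[OF d(1)])
        (blast intro: cfun.span_add cfun.span_scale everywhere_diff_add everywhere_diff_cscale d)
  qed
  then show "jacobi_act \<xi> F \<in> ?V" by blast
qed simp

text \<open>The terms of an element of U lie in U one by one. If U contains a basis vector with
  index in S - R, then \<open>linked\<close> produces all of them; if it contains none, all nonzero
  terms have index in R.\<close>

lemma no_intermediate_invariant:
  assumes S: "S \<subseteq> osc_index q" "R \<subseteq> S" and U: "jacobi_invariant U"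
    and RU: "cfun.span (osc_wave ` R) \<subseteq> U" and US: "U \<subseteq> cfun.span (osc_wave ` S)"
    and linked: "\<And>P i j. ladder_closed q P \<Longrightarrow> i \<in> S - R \<Longrightarrow> j \<in> S - R \<Longrightarrow> P i \<Longrightarrow> P j"
  shows "U = cfun.span (osc_wave ` R) \<or> U = cfun.span (osc_wave ` S)"
proof (rule disjCI)
  assume "U \<noteq> cfun.span (osc_wave ` S)"
  have s: "cfun.subspace U" using U by (simp add: jacobi_invariant_def)
  have none: "osc_wave i \<notin> U" if i: "i \<in> S - R" for i
  proof
    assume "osc_wave i \<in> U"
    then have "osc_wave j \<in> U" if "j \<in> S" for j
      using linked[OF ladder_closed_invariant[OF U] i] that RU
      using cfun.span_base[of "osc_wave j" "osc_wave ` R"] by (cases "j \<in> R") blast+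
    then have "cfun.span (osc_wave ` S) \<subseteq> U" by (intro cfun.span_minimal s) auto
    with US \<open>U \<noteq> cfun.span (osc_wave ` S)\<close> show False by blast
  qed
  have "F \<in> cfun.span (osc_wave ` R)" if F: "F \<in> U" for F
  proof -
    obtain T c where T: "finite T" "T \<subseteq> S" "F = (\<Sum>i\<in>T. cscale (c i) (osc_wave i))"
      using F US span_osc_explicit by blast
    have "cscale (c i) (osc_wave i) \<in> cfun.span (osc_wave ` R)" if i: "i \<in> T" for i
    proof -
      have "cscale (c i) (osc_wave i) \<in> U"
        using invariant_component[OF U T(1) _ i, of q c] T S F by auto
      then have "c i = 0 \<or> i \<in> R"
        using none[of i] i T(2) unfolding cscale_osc_in_subspace[OF s] by blast
      then show ?thesis by (auto intro: cfun.span_zero cfun.span_scale cfun.span_base)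
    qed
    then show ?thesis unfolding T(3) by (intro cfun.span_sum)
  qed
  with RU show "U = cfun.span (osc_wave ` R)" by blast
qed

section \<open>Connectedness of the ladder of weights\<close>

text \<open>Moves inside a row change m by 4 and are blocked only at m = -(2l+1) upwards and at m =
  2l+1 downwards. The assumptions keep these two weights off the path; its starting point counts,
  its end point does not.\<close>

lemma ladder_row:
  assumes P: "ladder_closed q P" and idx: "(l, m) \<in> osc_index q" "(l, m') \<in> osc_index q" and Pm: "P (l, m)"
    and up: "\<And>n. m \<le> n \<Longrightarrow> n < m' \<Longrightarrow> n + 2 * int l + 1 = 0 \<Longrightarrow> (l, n) \<notin> osc_index q"
    and down: "\<And>n. m' < n \<Longrightarrow> n \<le> m \<Longrightarrow> n = 2 * int l + 1 \<Longrightarrow> (l, n) \<notin> osc_index q"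
  shows "P (l, m')"
proof (cases "m \<le> m'")
  case True
  have "4 dvd m' - m" using idx by (simp add: osc_index_def) presburger
  then obtain k' where k': "m' - m = 4 * k'" by auto
  define k where "k = nat k'"
  have k: "m' = m + 4 * int k" using k' True by (simp add: k_def)
  have "j \<le> k \<Longrightarrow> P (l, m + 4 * int j)" for j
  proof (induction j)
    case (Suc j)
    have i: "(l, m + 4 * int j) \<in> osc_index q" using idx(1) by (simp add: osc_index_def) presburger
    then have "m + 4 * int j + 2 * int l + 1 \<noteq> 0" using up[of "m + 4 * int j"] Suc.prems k by auto
    then have "P (l, m + 4 * int j + 4)"
      using P i Suc unfolding ladder_closed_def by simp
    then show ?case by (simp add: algebra_simps)
  qed (use Pm in simp)
  then show ?thesis using k by simp
next
  case False
  have "4 dvd m - m'" using idx by (simp add: osc_index_def) presburger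
  then obtain k' where k': "m - m' = 4 * k'" by auto
  define k where "k = nat k'"
  have k: "m' = m - 4 * int k" using k' False by (simp add: k_def)
  have "j \<le> k \<Longrightarrow> P (l, m - 4 * int j)" for j
  proof (induction j)
    case (Suc j)
    have i: "(l, m - 4 * int j) \<in> osc_index q" using idx(1) by (simp add: osc_index_def) presburger
    then have "m - 4 * int j \<noteq> 2 * int l + 1" using down[of "m - 4 * int j"] Suc.prems k by auto
    then have "P (l, m - 4 * int j - 4)"
      using P i Suc unfolding ladder_closed_def by simp
    then show ?case by (simp add: algebra_simps)
  qed (use Pm in simp)
  then show ?thesis using k by simp
qed

text \<open>Row moves reduce the question to levels. No move leads upwards from level 1, so the
  levels 0, 1 and the levels from 2 on are handled apart: among the former the path passes through
  level 0, among the latter it descends to level 2 and climbs from there.\<close>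

lemma ladder_linked:
  fixes B :: "(nat \<times> int) set"
  assumes row: "\<And>l m m'. (l, m) \<in> B \<Longrightarrow> (l, m') \<in> B \<Longrightarrow> P (l, m) \<Longrightarrow> P (l, m')"
    and below: "\<And>l m. (l, m) \<in> B \<Longrightarrow> P (l, m) \<Longrightarrow> l \<ge> 1 \<Longrightarrow> \<exists>m'. (l - 1, m') \<in> B \<and> P (l - 1, m')"
    and above: "\<And>l m. (l, m) \<in> B \<Longrightarrow> P (l, m) \<Longrightarrow> l \<noteq> 1 \<Longrightarrow> \<exists>m'. (l + 1, m') \<in> B \<and> P (l + 1, m')"
    and ij: "i \<in> B" "j \<in> B" "P i" and level: "fst i \<le> 1 \<longleftrightarrow> fst j \<le> 1"
  shows "P j"
proof -
  define Q where "Q l \<longleftrightarrow> (\<exists>m. (l, m) \<in> B \<and> P (l, m))" for l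
  have down: "Q (l - 1)" if "Q l" "l \<ge> 1" for l using that below unfolding Q_def by blast
  have up: "Q (l + 1)" if "Q l" "l \<noteq> 1" for l using that above unfolding Q_def by blast
  have Qi: "Q (fst i)" unfolding Q_def using ij by (metis prod.collapse)
  have "Q (fst j)"
  proof (cases "fst i \<le> 1")
    case True
    have "Q 0" using Qi down[of 1] True by (cases "fst i = 0") (auto simp: le_Suc_eq)
    then show ?thesis using up[of 0] level True by (cases "fst j = 0") (auto simp: le_Suc_eq)
  next
    case False
    have "Q n" if "2 \<le> n" "n \<le> fst i" for n
      using that(2,1)
    proof (induction rule: inc_induct)
      case base
      then show ?case using Qi by simp
    next
      case (step n)
      then show ?case using down[of "Suc n"] by simp
    qed
    then have "Q 2" using False by simp
    have "Q n" if "2 \<le> n" for n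
      using that
    proof (induction rule: dec_induct)
      case (step n)
      then show ?case using up[of n] by simp
    qed (rule \<open>Q 2\<close>)
    then show ?thesis using False level by simp
  qed
  then obtain m where "(fst j, m) \<in> B" "P (fst j, m)" unfolding Q_def by blast
  then show ?thesis using row[of "fst j" m "snd j"] ij(2) by simp
qed

lemma ladder_closed_steps:
  assumes "ladder_closed q P" "(l, m) \<in> osc_index q" "P (l, m)"
  shows "l \<ge> 1 \<Longrightarrow> P (l - 1, m + 2)" "l \<ge> 1 \<Longrightarrow> P (l - 1, m - 2)"
    "l \<noteq> 1 \<Longrightarrow> m + 2 * int l + 1 \<noteq> 0 \<Longrightarrow> P (l + 1, m + 2)"
    "l \<noteq> 1 \<Longrightarrow> m \<noteq> 2 * int l + 1 \<Longrightarrow> P (l + 1, m - 2)"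
  using assms unfolding ladder_closed_def by blast+

text \<open>All weights in the index set are even, whereas the blocking weights are odd.\<close>

lemma linked_even:
  assumes P: "ladder_closed q P" and "even q" and i: "i \<in> osc_index q" "P i" and j: "j \<in> osc_index q"
    and level: "fst i \<le> 1 \<longleftrightarrow> fst j \<le> 1"
  shows "P j"
proof (rule ladder_linked[of "osc_index q" P i j])
  have even: "even m" if "(l, m) \<in> osc_index q" for l m
    using that \<open>even q\<close> by (simp add: osc_index_def) presburger
  fix l m assume lm: "(l, m) \<in> osc_index q" "P (l, m)"
  show "P (l, m')" if "(l, m') \<in> osc_index q" for m'
  proof (rule ladder_row[OF P lm(1) that lm(2)])
    show "(l, n) \<notin> osc_index q" if "n + 2 * int l + 1 = 0" for n
    proof -
      have "odd n" using that by presburger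
      then show ?thesis using even by blast
    qed
    show "(l, n) \<notin> osc_index q" if "n = 2 * int l + 1" for n
    proof -
      have "odd n" using that by presburger
      then show ?thesis using even by blast
    qed
  qed
  show "\<exists>m'. (l - 1, m') \<in> osc_index q \<and> P (l - 1, m')" if "l \<ge> 1"
    using ladder_closed_steps(1)[OF P lm that] osc_index_steps(5)[OF lm(1) that] by blast
  have "m + 2 * int l + 1 \<noteq> 0" using even[OF lm(1)] by presburger
  then show "\<exists>m'. (l + 1, m') \<in> osc_index q \<and> P (l + 1, m')" if "l \<noteq> 1"
    using ladder_closed_steps(3)[OF P lm that] osc_index_steps(3)[OF lm(1)] by blast
qed (use assms in auto)

text \<open>Weights in row l are congruent to 2l+1 modulo 4, so -(2l+1) does not occur while 2l+1
  does. Each row therefore breaks into the half lines m \<ge> 2l+1 (\<open>s\<close> true) and m <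
  2l+1 (\<open>s\<close> false).\<close>

lemma linked_lowest_weight:
  assumes P: "ladder_closed q P" and q: "4 dvd q - 1" and i: "i \<in> B" "P i" and j: "j \<in> B"
    and level: "fst i \<le> 1 \<longleftrightarrow> fst j \<le> 1"
    and B: "B = {(l, m) \<in> osc_index q. m \<ge> 2 * int l + 1 \<longleftrightarrow> s}"
  shows "P j"
proof (rule ladder_linked[of B P i j])
  have nz: "m + 2 * int l + 1 \<noteq> 0" if "(l, m) \<in> osc_index q" for l m
    using that q by (simp add: osc_index_def) presburger
  have idx: "(l, m) \<in> osc_index q" if "(l, m) \<in> B" for l m using that B by auto
  \<comment> \<open>Changing l by 1 shifts the boundary 2l+1 by 2. Moving m by 2 away from the
    boundary keeps the index on its side, whether l goes up or down.\<close>
  define d :: int where "d = (if s then 2 else - 2)"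
  have Bd: "(l - 1, m + d) \<in> B" if "(l, m) \<in> B" "l \<ge> 1" for l m
    using osc_index_steps(5,6)[OF idx[OF that(1)] that(2)] B that by (auto simp: d_def of_nat_diff)
  have Bu: "(l + 1, m + d) \<in> B" if "(l, m) \<in> B" for l m
    using osc_index_steps(3,4)[OF idx[OF that(1)]] B that by (auto simp: d_def)
  fix l m assume lm: "(l, m) \<in> B" "P (l, m)"
  note lm' = idx[OF lm(1)] lm(2)
  show "P (l, m')" if "(l, m') \<in> B" for m'
    by (rule ladder_row[OF P lm'(1) idx[OF that] lm'(2)]) (use nz B lm that in auto)
  show "\<exists>m'. (l - 1, m') \<in> B \<and> P (l - 1, m')" if "l \<ge> 1"
    using ladder_closed_steps(1,2)[OF P lm' that] Bd[OF lm(1) that] by (auto simp: d_def split: if_splits)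
  show "\<exists>m'. (l + 1, m') \<in> B \<and> P (l + 1, m')" if "l \<noteq> 1"
    using ladder_closed_steps(3)[OF P lm' that nz[OF lm'(1)]] ladder_closed_steps(4)[OF P lm' that] Bu[OF lm(1)] B lm(1)
    by (auto simp: d_def split: if_splits)
qed (use assms in auto)

text \<open>The mirror image under m \<mapsto> -m: weights in row l are congruent to 2l+3 modulo 4,
  so of the two blocking weights only -(2l+1) occurs.\<close>

lemma linked_highest_weight:
  assumes P: "ladder_closed q P" and q: "4 dvd q - 3" and i: "i \<in> B" "P i" and j: "j \<in> B"
    and level: "fst i \<le> 1 \<longleftrightarrow> fst j \<le> 1"
    and B: "B = {(l, m) \<in> osc_index q. m \<le> - (2 * int l + 1) \<longleftrightarrow> s}"
  shows "P j"
proof (rule ladder_linked[of B P i j])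
  have nz: "m \<noteq> 2 * int l + 1" if "(l, m) \<in> osc_index q" for l m
    using that q by (simp add: osc_index_def) presburger
  have idx: "(l, m) \<in> osc_index q" if "(l, m) \<in> B" for l m using that B by auto
  define d :: int where "d = (if s then - 2 else 2)"
  have Bd: "(l - 1, m + d) \<in> B" if "(l, m) \<in> B" "l \<ge> 1" for l m
    using osc_index_steps(5,6)[OF idx[OF that(1)] that(2)] B that by (auto simp: d_def of_nat_diff)
  have Bu: "(l + 1, m + d) \<in> B" if "(l, m) \<in> B" for l m
    using osc_index_steps(3,4)[OF idx[OF that(1)]] B that by (auto simp: d_def)
  fix l m assume lm: "(l, m) \<in> B" "P (l, m)"
  note lm' = idx[OF lm(1)] lm(2)
  show "P (l, m')" if "(l, m') \<in> B" for m'
    by (rule ladder_row[OF P lm'(1) idx[OF that] lm'(2)]) (use nz B lm that in auto)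
  show "\<exists>m'. (l - 1, m') \<in> B \<and> P (l - 1, m')" if "l \<ge> 1"
    using ladder_closed_steps(1,2)[OF P lm' that] Bd[OF lm(1) that] by (auto simp: d_def split: if_splits)
  show "\<exists>m'. (l + 1, m') \<in> B \<and> P (l + 1, m')" if "l \<noteq> 1"
    using ladder_closed_steps(4)[OF P lm' that nz[OF lm'(1)]] ladder_closed_steps(3)[OF P lm' that] Bu[OF lm(1)] B lm(1)
    by (auto simp: d_def split: if_splits)
qed (use assms in auto)

section \<open>Index sets from which the chains are built\<close>

lemma ladder_closed_conj: "ladder_closed q P \<Longrightarrow> ladder_closed q Q \<Longrightarrow> ladder_closed q (\<lambda>i. P i \<and> Q i)"
  unfolding ladder_closed_def by blast

lemma ladder_closed_disj: "ladder_closed q P \<Longrightarrow> ladder_closed q Q \<Longrightarrow> ladder_closed q (\<lambda>i. P i \<or> Q i)"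
  unfolding ladder_closed_def by blast

lemma ladder_closed_False: "ladder_closed q (\<lambda>i. False)"
  unfolding ladder_closed_def by blast

lemma ladder_closed_index: "ladder_closed q (\<lambda>i. i \<in> osc_index q)"
  unfolding ladder_closed_def by (intro allI impI conjI; rule osc_index_steps; assumption)

lemma ladder_closed_low: "ladder_closed q (\<lambda>i. fst i \<le> 1)"
  unfolding ladder_closed_def by auto

text \<open>By the congruence, a weight above 2l+1 is at least 2l+5. Hence m-4 still satisfies the
  bound in row l, and m-2 satisfies the bound 2l+3 in row l+1.\<close>

lemma ladder_closed_lowest_weight:
  assumes "4 dvd q - 1"
  shows "ladder_closed q (\<lambda>i. snd i \<ge> 2 * int (fst i) + 1)"
proof -
  have gap: "m \<ge> 2 * int l + 5" if "(l, m) \<in> osc_index q" "m \<ge> 2 * int l + 1" "m \<noteq> 2 * int l + 1" for l m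
    using that assms unfolding osc_index_def by simp presburger
  show ?thesis
    unfolding ladder_closed_def
  proof (intro allI impI)
    fix l m assume "(l, m) \<in> osc_index q" "snd (l, m) \<ge> 2 * int (fst (l, m)) + 1"
    with gap[of l m] show "(m + 2 * int l + 1 \<noteq> 0 \<longrightarrow> snd (l, m + 4) \<ge> 2 * int (fst (l, m + 4)) + 1) \<and>
      (m \<noteq> 2 * int l + 1 \<longrightarrow> snd (l, m - 4) \<ge> 2 * int (fst (l, m - 4)) + 1) \<and>
      (l \<ge> 1 \<longrightarrow> snd (l - 1, m + 2) \<ge> 2 * int (fst (l - 1, m + 2)) + 1 \<and> snd (l - 1, m - 2) \<ge> 2 * int (fst (l - 1, m - 2)) + 1) \<and>
      (l \<noteq> 1 \<longrightarrow> m + 2 * int l + 1 \<noteq> 0 \<longrightarrow> snd (l + 1, m + 2) \<ge> 2 * int (fst (l + 1, m + 2)) + 1) \<and>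
      (l \<noteq> 1 \<longrightarrow> m \<noteq> 2 * int l + 1 \<longrightarrow> snd (l + 1, m - 2) \<ge> 2 * int (fst (l + 1, m - 2)) + 1)"
      by (auto simp: of_nat_diff)
  qed
qed

lemma ladder_closed_highest_weight:
  assumes "4 dvd q - 3"
  shows "ladder_closed q (\<lambda>i. snd i \<le> - (2 * int (fst i) + 1))"
proof -
  have gap: "m + 4 \<le> - (2 * int l + 1)" if "(l, m) \<in> osc_index q" "m \<le> - (2 * int l + 1)" "m + 2 * int l + 1 \<noteq> 0" for l m
    using that assms unfolding osc_index_def by simp presburger
  show ?thesis
    unfolding ladder_closed_def
  proof (intro allI impI)
    fix l m assume "(l, m) \<in> osc_index q" "snd (l, m) \<le> - (2 * int (fst (l, m)) + 1)"
    with gap[of l m] show "(m + 2 * int l + 1 \<noteq> 0 \<longrightarrow> snd (l, m + 4) \<le> - (2 * int (fst (l, m + 4)) + 1)) \<and>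
      (m \<noteq> 2 * int l + 1 \<longrightarrow> snd (l, m - 4) \<le> - (2 * int (fst (l, m - 4)) + 1)) \<and>
      (l \<ge> 1 \<longrightarrow> snd (l - 1, m + 2) \<le> - (2 * int (fst (l - 1, m + 2)) + 1) \<and> snd (l - 1, m - 2) \<le> - (2 * int (fst (l - 1, m - 2)) + 1)) \<and>
      (l \<noteq> 1 \<longrightarrow> m + 2 * int l + 1 \<noteq> 0 \<longrightarrow> snd (l + 1, m + 2) \<le> - (2 * int (fst (l + 1, m + 2)) + 1)) \<and>
      (l \<noteq> 1 \<longrightarrow> m \<noteq> 2 * int l + 1 \<longrightarrow> snd (l + 1, m - 2) \<le> - (2 * int (fst (l + 1, m - 2)) + 1))"
      by (auto simp: of_nat_diff)
  qed
qed

section \<open>Quotient modules\<close>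

lemma span_osc_dif: "F \<in> cfun.span (osc_wave ` S) \<Longrightarrow> everywhere_diff F"
proof (induction rule: cfun.span_induct_alt)
  case (step c G H)
  then have "everywhere_diff G" using osc_wave_dif by auto
  with step show ?case by (intro everywhere_diff_add everywhere_diff_cscale)
qed (rule everywhere_diff_zero)

lemma invariant_osc_span: "jacobi_invariant (cfun.span (osc_wave ` osc_index q))"
  by (rule jacobi_invariant_span[OF order_refl ladder_closed_index])

text \<open>Linear extension of \<open>jacobi_act_bracket_wave\<close> from the basis. Membership in
  the span is carried through the induction, since it yields the differentiability on which
  linearity depends.\<close>

lemma jacobi_act_bracket:
  assumes \<xi>: "\<xi> \<in> jacobi_algebra" and \<zeta>: "\<zeta> \<in> jacobi_algebra"
    and F: "F \<in> cfun.span (osc_wave ` osc_index q)"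
  shows "jacobi_act (jacobi_bracket \<xi> \<zeta>) F = jacobi_act \<xi> (jacobi_act \<zeta> F) - jacobi_act \<zeta> (jacobi_act \<xi> F)"
proof -
  let ?V = "cfun.span (osc_wave ` osc_index q)"
  have inv: "everywhere_diff (jacobi_act \<xi>' F)" if "\<xi>' \<in> jacobi_algebra" "F \<in> ?V" for \<xi>' F
    using invariant_osc_span[of q] that unfolding jacobi_invariant_def by (blast intro: span_osc_dif)
  have "F \<in> ?V \<and> jacobi_act (jacobi_bracket \<xi> \<zeta>) F = jacobi_act \<xi> (jacobi_act \<zeta> F) - jacobi_act \<zeta> (jacobi_act \<xi> F)"
    using F
  proof (induction rule: cfun.span_induct_alt)
    case base
    show ?case unfolding jacobi_act_zero by (intro conjI cfun.span_zero) simp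
  next
    case (step c G H)
    then obtain l m where G: "G = osc_wave (l, m)" by auto
    have GV: "G \<in> ?V" using step by (intro cfun.span_base)
    have HV: "H \<in> ?V" and H: "jacobi_act (jacobi_bracket \<xi> \<zeta>) H = jacobi_act \<xi> (jacobi_act \<zeta> H) - jacobi_act \<zeta> (jacobi_act \<xi> H)"
      using step by blast+
    have d: "everywhere_diff G" "everywhere_diff H" using GV HV span_osc_dif by blast+
    note dG = inv[OF \<xi> GV] inv[OF \<zeta> GV] and dH = inv[OF \<xi> HV] inv[OF \<zeta> HV]
    have "jacobi_act (jacobi_bracket \<xi> \<zeta>) G = jacobi_act \<xi> (jacobi_act \<zeta> G) - jacobi_act \<zeta> (jacobi_act \<xi> G)"
      unfolding G osc_wave_def split by (rule jacobi_act_bracket_wave[OF \<xi> \<zeta> deriv_osc])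
    then have "jacobi_act (jacobi_bracket \<xi> \<zeta>) (cscale c G + H) =
        jacobi_act \<xi> (jacobi_act \<zeta> (cscale c G + H)) - jacobi_act \<zeta> (jacobi_act \<xi> (cscale c G + H))"
      unfolding jacobi_act_add[OF everywhere_diff_cscale[OF d(1)] d(2)] jacobi_act_cscale[OF d(1)]
        jacobi_act_add[OF everywhere_diff_cscale[OF dG(1)] dH(1)] jacobi_act_cscale[OF dG(1)]
        jacobi_act_add[OF everywhere_diff_cscale[OF dG(2)] dH(2)] jacobi_act_cscale[OF dG(2)] H
      by (simp add: cfun.scale_right_diff_distrib)
    then show ?case using GV HV by (blast intro: cfun.span_add cfun.span_scale)
  qed
  then show ?thesis by blast
qed

text \<open>
  Both \<open>H_module q\<close> (with \<open>\<pi>\<close> the identity) and its subquotients (with \<open>\<pi>\<close> the passage to cosets)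
  are images of an invariant space of functions.
\<close>

locale jacobi_image =
  fixes M :: "('v, 'm) jacobi_module_scheme" (structure) and V :: "plane_fun set" and \<pi> :: "plane_fun \<Rightarrow> 'v"
  assumes V: "jacobi_invariant V"
    and bracket: "\<And>\<xi> \<zeta> F. \<xi> \<in> jacobi_algebra \<Longrightarrow> \<zeta> \<in> jacobi_algebra \<Longrightarrow> F \<in> V \<Longrightarrow>
      jacobi_act (jacobi_bracket \<xi> \<zeta>) F = jacobi_act \<xi> (jacobi_act \<zeta> F) - jacobi_act \<zeta> (jacobi_act \<xi> F)"
    and everywhere_diff: "\<And>F. F \<in> V \<Longrightarrow> everywhere_diff F"
    and carrier: "carrier M = \<pi> ` V" and zero: "\<zero> = \<pi> 0"
    and add: "\<And>F G. F \<in> V \<Longrightarrow> G \<in> V \<Longrightarrow> \<pi> F \<oplus> \<pi> G = \<pi> (F + G)"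
    and smult: "\<And>c F. F \<in> V \<Longrightarrow> c \<odot>\<^bsub>M\<^esub> \<pi> F = \<pi> (cscale c F)"
    and lie: "\<And>\<xi> F. \<xi> \<in> jacobi_algebra \<Longrightarrow> F \<in> V \<Longrightarrow> lie_action M \<xi> (\<pi> F) = \<pi> (jacobi_act \<xi> F)"
begin

lemma subspace: "cfun.subspace V"
  using V by (simp add: jacobi_invariant_def)

lemmas V_intros = cfun.subspace_0[OF subspace] cfun.subspace_add[OF subspace] cfun.subspace_scale[OF subspace]
  cfun.subspace_neg[OF subspace] cfun.subspace_diff[OF subspace]

lemma act_closed: "\<xi> \<in> jacobi_algebra \<Longrightarrow> F \<in> V \<Longrightarrow> jacobi_act \<xi> F \<in> V"
  using V by (simp add: jacobi_invariant_def)

lemma is_abelian_group: "abelian_group M"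
proof (rule abelian_groupI)
  fix x y z assume "x \<in> carrier M" "y \<in> carrier M" "z \<in> carrier M"
  then obtain F G H where *: "F \<in> V" "G \<in> V" "H \<in> V" "x = \<pi> F" "y = \<pi> G" "z = \<pi> H"
    unfolding carrier by blast
  then show "x \<oplus> y \<in> carrier M" "x \<oplus> y \<oplus> z = x \<oplus> (y \<oplus> z)" "x \<oplus> y = y \<oplus> x" "\<zero> \<oplus> x = x"
    unfolding carrier zero by (simp_all only: add V_intros add.assoc add.commute[of F] add_0 imageI)
  have "\<pi> (- F) \<oplus> x = \<zero>" using * unfolding zero by (simp only: add V_intros add.left_inverse)
  then show "\<exists>y\<in>carrier M. y \<oplus> x = \<zero>" unfolding carrier using * V_intros by blast
qed (auto simp: carrier zero V_intros)

lemma a_inv: "F \<in> V \<Longrightarrow> \<ominus> \<pi> F = \<pi> (- F)"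
proof -
  assume F: "F \<in> V"
  have "\<pi> (- F) \<oplus> \<pi> F = \<zero>" using F unfolding zero by (simp only: add V_intros add.left_inverse)
  then show ?thesis
    using abelian_group.minus_equality[OF is_abelian_group] F V_intros unfolding carrier by blast
qed

lemma is_module: "Module.module (ring_of_type_algebra :: complex ring) M"
proof (rule moduleI[OF cring_from_type_algebra is_abelian_group])
  fix a b :: complex and x y assume "x \<in> carrier M" "y \<in> carrier M"
  then obtain F G where *: "F \<in> V" "G \<in> V" "x = \<pi> F" "y = \<pi> G" unfolding carrier by blast
  show "a \<odot>\<^bsub>M\<^esub> x \<in> carrier M"
    unfolding carrier using * by (simp only: smult V_intros imageI)
  show "(a \<oplus>\<^bsub>ring_of_type_algebra\<^esub> b) \<odot>\<^bsub>M\<^esub> x = a \<odot>\<^bsub>M\<^esub> x \<oplus> b \<odot>\<^bsub>M\<^esub> x"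
    using * by (simp add: ring_of_type_algebra_def smult add V_intros cfun.scale_left_distrib)
  show "a \<odot>\<^bsub>M\<^esub> (x \<oplus> y) = a \<odot>\<^bsub>M\<^esub> x \<oplus> a \<odot>\<^bsub>M\<^esub> y"
    using * by (simp add: smult add V_intros cfun.scale_right_distrib)
  show "(a \<otimes>\<^bsub>ring_of_type_algebra\<^esub> b) \<odot>\<^bsub>M\<^esub> x = a \<odot>\<^bsub>M\<^esub> (b \<odot>\<^bsub>M\<^esub> x)"
    using * by (simp add: ring_of_type_algebra_def smult V_intros)
  show "\<one>\<^bsub>ring_of_type_algebra\<^esub> \<odot>\<^bsub>M\<^esub> x = x"
    using * by (simp add: ring_of_type_algebra_def smult)
qed

lemma is_jacobi_module: "is_jacobi_module M"
proof (intro is_jacobi_module.intro is_module is_jacobi_module_axioms.intro)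
  fix \<xi> \<zeta> :: jacobi and x y and c :: complex and t :: real
  assume \<xi>: "\<xi> \<in> jacobi_algebra" and x: "x \<in> carrier M"
  obtain F where F: "F \<in> V" "x = \<pi> F" using x unfolding carrier by blast
  show "lie_action M \<xi> x \<in> carrier M"
    unfolding carrier using F \<xi> by (simp add: lie act_closed)
  show "lie_action M \<xi> (c \<odot>\<^bsub>M\<^esub> x) = c \<odot>\<^bsub>M\<^esub> lie_action M \<xi> x"
    using F \<xi> by (simp add: lie smult act_closed V_intros jacobi_act_cscale everywhere_diff)
  have "t *\<^sub>R \<xi> \<in> jacobi_algebra"
    using \<xi> by (cases \<xi>) (simp add: jacobi_algebra_iff)
  then show "lie_action M (t *\<^sub>R \<xi>) x = complex_of_real t \<odot>\<^bsub>M\<^esub> lie_action M \<xi> x"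
    using F \<xi> by (simp add: lie smult act_closed V_intros jacobi_act_scale_left)
  {
    assume "y \<in> carrier M"
    then obtain G where G: "G \<in> V" "y = \<pi> G" unfolding carrier by blast
    show "lie_action M \<xi> (x \<oplus> y) = lie_action M \<xi> x \<oplus> lie_action M \<xi> y"
      using F G \<xi> by (simp add: lie add act_closed V_intros jacobi_act_add everywhere_diff)
  }
  assume \<zeta>: "\<zeta> \<in> jacobi_algebra"
  have "\<xi> + \<zeta> \<in> jacobi_algebra"
    using \<xi> \<zeta> by (cases \<xi>; cases \<zeta>) (simp add: jacobi_algebra_iff)
  then show "lie_action M (\<xi> + \<zeta>) x = lie_action M \<xi> x \<oplus> lie_action M \<zeta> x"
    using F \<xi> \<zeta> by (simp add: lie add act_closed V_intros jacobi_act_add_left)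
  have "jacobi_bracket \<xi> \<zeta> \<in> jacobi_algebra"
    using \<xi> \<zeta> by (cases \<xi>; cases \<zeta>)
      (simp add: jacobi_algebra_iff matrix_matrix_mult_def sum_2 algebra_simps)
  then show "lie_action M (jacobi_bracket \<xi> \<zeta>) x =
      lie_action M \<xi> (lie_action M \<zeta> x) \<ominus> lie_action M \<zeta> (lie_action M \<xi> x)"
    using F \<xi> \<zeta> by (simp add: lie act_closed bracket a_minus_def a_inv add V_intros)
qed

text \<open>Half of the correspondence theorem: pulling back along \<pi> turns an abstract submodule
  into an invariant space of functions, where the weight basis is available.\<close>

lemma submodule_preimage:
  assumes N: "jacobi_submodule N M"
  shows "jacobi_invariant {F \<in> V. \<pi> F \<in> N}" "N = \<pi> ` {F \<in> V. \<pi> F \<in> N}" "\<pi> 0 \<in> N"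
proof -
  have sub: "submodule N (ring_of_type_algebra :: complex ring) M"
    and act: "\<And>\<xi> x. \<xi> \<in> jacobi_algebra \<Longrightarrow> x \<in> N \<Longrightarrow> lie_action M \<xi> x \<in> N"
    using N by (auto simp: jacobi_submodule_def)
  note E = module.submoduleE[OF is_module sub]
  show 0: "\<pi> 0 \<in> N"
    using subgroup.one_closed[OF submodule.axioms(1)[OF sub]] by (simp add: zero[symmetric])
  show "N = \<pi> ` {F \<in> V. \<pi> F \<in> N}" using E(1) unfolding carrier by auto
  show "jacobi_invariant {F \<in> V. \<pi> F \<in> N}"
    unfolding jacobi_invariant_def cfun.subspace_def
  proof (intro conjI ballI allI)
    show "0 \<in> {F \<in> V. \<pi> F \<in> N}" using 0 V_intros by simp
    fix F assume F: "F \<in> {F \<in> V. \<pi> F \<in> N}"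
    show "F + G \<in> {F \<in> V. \<pi> F \<in> N}" if "G \<in> {F \<in> V. \<pi> F \<in> N}" for G
      using E(5)[of "\<pi> F" "\<pi> G"] F that V_intros by (simp add: add)
    show "cscale c F \<in> {F \<in> V. \<pi> F \<in> N}" for c
      using E(4)[of c "\<pi> F"] F V_intros by (simp add: smult ring_of_type_algebra_def)
    show "jacobi_act \<xi> F \<in> {F \<in> V. \<pi> F \<in> N}" if "\<xi> \<in> jacobi_algebra" for \<xi>
      using act[OF that, of "\<pi> F"] F that act_closed by (simp add: lie)
  qed
qed

lemma submodule_image:
  assumes U: "jacobi_invariant U" "U \<subseteq> V"
  shows "jacobi_submodule (\<pi> ` U) M"
  unfolding jacobi_submodule_def
proof (intro conjI ballI)
  have s: "cfun.subspace U" using U by (simp add: jacobi_invariant_def)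
  show "submodule (\<pi> ` U) (ring_of_type_algebra :: complex ring) M"
  proof (rule module.submoduleI[OF is_module])
    show "\<pi> ` U \<subseteq> carrier M" using U(2) carrier by blast
    show "\<zero> \<in> \<pi> ` U" unfolding zero using cfun.subspace_0[OF s] by blast
    fix x assume "x \<in> \<pi> ` U"
    then obtain F where F: "F \<in> U" "x = \<pi> F" by blast
    then have FV: "F \<in> V" using U(2) by blast
    show "\<ominus> x \<in> \<pi> ` U" unfolding F(2) a_inv[OF FV] by (intro imageI cfun.subspace_neg[OF s] F)
    show "a \<odot>\<^bsub>M\<^esub> x \<in> \<pi> ` U" for a unfolding F(2) smult[OF FV] by (intro imageI cfun.subspace_scale[OF s] F)
    fix y assume "y \<in> \<pi> ` U"
    then obtain G where G: "G \<in> U" "y = \<pi> G" by blast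
    then have GV: "G \<in> V" using U(2) by blast
    show "x \<oplus> y \<in> \<pi> ` U" unfolding F(2) G(2) add[OF FV GV] by (intro imageI cfun.subspace_add[OF s] F G)
  qed
  fix \<xi> x assume \<xi>: "\<xi> \<in> jacobi_algebra" and "x \<in> \<pi> ` U"
  then obtain F where F: "F \<in> U" "x = \<pi> F" by blast
  have "jacobi_act \<xi> F \<in> U" using U(1) F(1) \<xi> by (simp add: jacobi_invariant_def)
  then show "lie_action M \<xi> x \<in> \<pi> ` U" using F U(2) lie[OF \<xi>, of F] by auto
qed

end

text \<open>The order of the summands matches the right cosets from which
  \<open>jacobi_quotient\<close> is formed.\<close>

definition fun_coset :: "plane_fun set \<Rightarrow> plane_fun \<Rightarrow> plane_fun set" where
  "fun_coset W F = (\<lambda>G. G + F) ` W"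

lemma mem_fun_coset_iff: "G \<in> fun_coset W F \<longleftrightarrow> G - F \<in> W"
  unfolding fun_coset_def by (metis (no_types, lifting) add_diff_cancel_right' diff_add_cancel image_iff)

lemma fun_coset_eq_iff:
  assumes "cfun.subspace W"
  shows "fun_coset W F = fun_coset W G \<longleftrightarrow> F - G \<in> W"
proof
  have "F - F \<in> W" using cfun.subspace_0[OF assms] by simp
  then have "F \<in> fun_coset W F" unfolding mem_fun_coset_iff .
  moreover assume "fun_coset W F = fun_coset W G"
  ultimately show "F - G \<in> W" unfolding mem_fun_coset_iff[symmetric] by simp
next
  assume FG: "F - G \<in> W"
  have "H - F \<in> W \<longleftrightarrow> H - G \<in> W" for H
  proof
    assume "H - F \<in> W"
    from cfun.subspace_add[OF assms this FG] show "H - G \<in> W" by simp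
  next
    assume "H - G \<in> W"
    from cfun.subspace_diff[OF assms this FG] show "H - F \<in> W" by simp
  qed
  then show "fun_coset W F = fun_coset W G" unfolding set_eq_iff mem_fun_coset_iff by blast
qed

lemma fun_coset_zero: "fun_coset W 0 = W"
  by (simp add: fun_coset_def)

text \<open>Operations on the quotient are defined as unions over all representatives. Compatibility
  of \<open>h\<close> with W makes all cosets in the union equal, which is well-definedness.\<close>

lemma fun_coset_union:
  assumes W: "cfun.subspace W" and "\<And>G. G \<in> fun_coset W F \<Longrightarrow> h G - H \<in> W"
  shows "(\<Union>G\<in>fun_coset W F. fun_coset W (h G)) = fun_coset W H"
proof -
  have "F \<in> fun_coset W F" using cfun.subspace_0[OF W] by (simp add: mem_fun_coset_iff)
  moreover have "fun_coset W (h G) = fun_coset W H" if "G \<in> fun_coset W F" for G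
    unfolding fun_coset_eq_iff[OF W] by (rule assms(2)[OF that])
  ultimately show ?thesis by blast
qed

lemma jacobi_image_quotient:
  assumes V: "jacobi_invariant V" "V \<subseteq> cfun.span (osc_wave ` osc_index q)"
    and W: "jacobi_invariant W" "W \<subseteq> V"
  shows "jacobi_image (jacobi_quotient (H_module q\<lparr>carrier := V\<rparr>) W) V (fun_coset W)"
proof
  have s: "cfun.subspace W" and sV: "cfun.subspace V" using W V by (simp_all add: jacobi_invariant_def)
  let ?M = "H_module q\<lparr>carrier := V\<rparr>"
  have fun_coset: "W +>\<^bsub>?M\<^esub> F = fun_coset W F" for F
    unfolding a_r_coset_def' by (auto simp: H_module_def fun_coset_def)
  show everywhere_diff: "everywhere_diff F" if "F \<in> V" for F using that V(2) span_osc_dif by blast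
  show "jacobi_invariant V" by (rule V)
  show "jacobi_act (jacobi_bracket \<xi> \<zeta>) F = jacobi_act \<xi> (jacobi_act \<zeta> F) - jacobi_act \<zeta> (jacobi_act \<xi> F)"
    if "\<xi> \<in> jacobi_algebra" "\<zeta> \<in> jacobi_algebra" "F \<in> V" for \<xi> \<zeta> F
    using that V(2) jacobi_act_bracket by blast
  show "carrier (jacobi_quotient ?M W) = fun_coset W ` V"
    unfolding jacobi_quotient_def A_RCOSETS_def' fun_coset by (auto simp: H_module_def)
  show "\<zero>\<^bsub>jacobi_quotient ?M W\<^esub> = fun_coset W 0"
    by (simp add: jacobi_quotient_def fun_coset_zero)
  show "fun_coset W F \<oplus>\<^bsub>jacobi_quotient ?M W\<^esub> fun_coset W G = fun_coset W (F + G)" for F G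
  proof -
    have "fun_coset W F \<oplus>\<^bsub>jacobi_quotient ?M W\<^esub> fun_coset W G = (\<Union>h\<in>fun_coset W F. \<Union>k\<in>fun_coset W G. {h + k})"
      by (simp add: jacobi_quotient_def set_add_def' H_module_def)
    also have "\<dots> = fun_coset W (F + G)"
    proof safe
      fix h k assume "h \<in> fun_coset W F" "k \<in> fun_coset W G"
      then have "(h - F) + (k - G) \<in> W" using cfun.subspace_add[OF s] unfolding mem_fun_coset_iff by blast
      then show "h + k \<in> fun_coset W (F + G)" unfolding mem_fun_coset_iff by (simp add: algebra_simps)
    next
      fix x assume "x \<in> fun_coset W (F + G)"
      then have "x - G \<in> fun_coset W F" unfolding mem_fun_coset_iff by (simp add: algebra_simps)
      moreover have "G \<in> fun_coset W G" using cfun.subspace_0[OF s] by (simp add: mem_fun_coset_iff)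
      ultimately show "x \<in> (\<Union>h\<in>fun_coset W F. \<Union>k\<in>fun_coset W G. {h + k})" by force
    qed
    finally show ?thesis .
  qed
  show "c \<odot>\<^bsub>jacobi_quotient ?M W\<^esub> fun_coset W F = fun_coset W (cscale c F)" for c F
  proof -
    have "cscale c G - cscale c F \<in> W" if "G \<in> fun_coset W F" for G
      using cfun.subspace_scale[OF s, of "G - F" c] that by (simp add: mem_fun_coset_iff cfun.scale_right_diff_distrib)
    from fun_coset_union[OF s this] show ?thesis
      unfolding jacobi_quotient_def fun_coset by (simp add: H_module_def)
  qed
  show "lie_action (jacobi_quotient ?M W) \<xi> (fun_coset W F) = fun_coset W (jacobi_act \<xi> F)"
    if \<xi>: "\<xi> \<in> jacobi_algebra" and F: "F \<in> V" for \<xi> F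
  proof -
    have "jacobi_act \<xi> G - jacobi_act \<xi> F \<in> W" if "G \<in> fun_coset W F" for G
    proof -
      have GF: "G - F \<in> W" using that by (simp add: mem_fun_coset_iff)
      have "jacobi_act \<xi> G = jacobi_act \<xi> ((G - F) + F)" by simp
      also have "\<dots> = jacobi_act \<xi> (G - F) + jacobi_act \<xi> F"
        using GF W F everywhere_diff by (intro jacobi_act_add) auto
      finally show ?thesis using W(1) GF \<xi> by (simp add: jacobi_invariant_def)
    qed
    from fun_coset_union[OF s this] show ?thesis
      unfolding jacobi_quotient_def fun_coset by (simp add: H_module_def)
  qed
qed

text \<open>The preimage of a submodule of the quotient is an invariant space between W and V, hence
  one of these two; correspondingly the submodule is zero or everything.\<close>

lemma quotient_irreducible:
  assumes V: "jacobi_invariant V" "V \<subseteq> cfun.span (osc_wave ` osc_index q)"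
    and W: "jacobi_invariant W" "W \<subset> V"
    and maximal: "\<And>U. jacobi_invariant U \<Longrightarrow> W \<subseteq> U \<Longrightarrow> U \<subseteq> V \<Longrightarrow> U = W \<or> U = V"
  shows "jacobi_irreducible (jacobi_quotient (H_module q\<lparr>carrier := V\<rparr>) W)"
proof -
  let ?Q = "jacobi_quotient (H_module q\<lparr>carrier := V\<rparr>) W"
  have s: "cfun.subspace W" using W by (simp add: jacobi_invariant_def)
  interpret jacobi_image ?Q V "fun_coset W"
    using V W by (intro jacobi_image_quotient) auto
  obtain F where F: "F \<in> V" "F \<notin> W" using W by blast
  then have "fun_coset W F \<noteq> fun_coset W 0" unfolding fun_coset_eq_iff[OF s] by simp
  then have nonzero: "carrier ?Q \<noteq> {\<zero>\<^bsub>?Q\<^esub>}" unfolding carrier zero using F by blast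
  have "N = {\<zero>\<^bsub>?Q\<^esub>} \<or> N = carrier ?Q" if N: "jacobi_submodule N ?Q" for N
  proof -
    note P = submodule_preimage[OF N]
    have WU: "W \<subseteq> {F \<in> V. fun_coset W F \<in> N}"
    proof
      fix G assume G: "G \<in> W"
      then have "fun_coset W G = fun_coset W 0" unfolding fun_coset_eq_iff[OF s] by simp
      then show "G \<in> {F \<in> V. fun_coset W F \<in> N}" using G W P(3) by auto
    qed
    from maximal[OF P(1) WU] consider "{F \<in> V. fun_coset W F \<in> N} = W" | "{F \<in> V. fun_coset W F \<in> N} = V" by blast
    then show ?thesis
    proof cases
      case 1
      have "fun_coset W ` W = {fun_coset W 0}"
        using fun_coset_eq_iff[OF s, of _ 0] cfun.subspace_0[OF s] by auto
      then show ?thesis using P(2) unfolding 1 zero by simp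
    next
      case 2
      then show ?thesis using P(2) unfolding carrier by simp
    qed
  qed
  then show ?thesis unfolding jacobi_irreducible_def using is_jacobi_module nonzero by blast
qed

section \<open>The composition series\<close>

lemma span_Union_span: "cfun.span (\<Union>l\<in>I. cfun.span (A l)) = cfun.span (\<Union>l\<in>I. A l)"
proof
  show "cfun.span (\<Union>l\<in>I. cfun.span (A l)) \<subseteq> cfun.span (\<Union>l\<in>I. A l)"
    by (intro cfun.span_minimal UN_least cfun.span_mono UN_upper) auto
  show "cfun.span (\<Union>l\<in>I. A l) \<subseteq> cfun.span (\<Union>l\<in>I. cfun.span (A l))"
    by (intro cfun.span_mono UN_mono) (auto intro: cfun.span_base)
qed

lemma span_Un_span: "cfun.span (cfun.span A \<union> cfun.span B) = cfun.span (A \<union> B)"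
proof
  show "cfun.span (cfun.span A \<union> cfun.span B) \<subseteq> cfun.span (A \<union> B)"
    by (intro cfun.span_minimal Un_least cfun.span_mono) auto
  show "cfun.span (A \<union> B) \<subseteq> cfun.span (cfun.span A \<union> cfun.span B)"
    by (intro cfun.span_mono) (auto intro: cfun.span_base)
qed

lemma subspace_sum_H_part:
  "subspace_sum I (H_part q) = cfun.span (osc_wave ` {i \<in> osc_index q. fst i \<in> I})"
  unfolding subspace_sum_def H_part_eq_span span_Union_span
  by (rule arg_cong[of _ _ cfun.span]) auto

lemma subspace_sum_H_part_minus:
  "subspace_sum I (H_part_minus q) =
    cfun.span (osc_wave ` {i \<in> osc_index q. fst i \<in> I \<and> snd i \<ge> 2 * int (fst i) + 1})"
  unfolding subspace_sum_def H_part_minus_def span_weight_vectors span_Union_span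
  by (rule arg_cong[of _ _ cfun.span]) auto

lemma subspace_sum_H_part_plus:
  "subspace_sum I (H_part_plus q) =
    cfun.span (osc_wave ` {i \<in> osc_index q. fst i \<in> I \<and> snd i \<le> - (2 * int (fst i) + 1)})"
  unfolding subspace_sum_def H_part_plus_def span_weight_vectors span_Union_span
  by (rule arg_cong[of _ _ cfun.span]) auto

lemma H_total_eq_span: "H_total q = cfun.span (osc_wave ` osc_index q)"
  unfolding H_total_def subspace_sum_H_part by simp

lemma jacobi_image_H_module: "jacobi_image (H_module q) (cfun.span (osc_wave ` osc_index q)) (\<lambda>F. F)"
  by unfold_locales
    (simp_all add: invariant_osc_span jacobi_act_bracket span_osc_dif H_module_def H_total_eq_span)

text \<open>Reduces the theorem to index sets: ladder closure gives invariance, linear independence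
  keeps the inclusions strict, and linkedness of the differences makes the quotients
  irreducible.\<close>

lemma composition_series_osc:
  assumes Ss: "Ss \<noteq> []" "hd Ss = {}" "last Ss = osc_index q"
    and closed: "\<And>S. S \<in> set Ss \<Longrightarrow> S \<subseteq> osc_index q \<and> ladder_closed q (\<lambda>i. i \<in> S)"
    and step: "\<And>k. Suc k < length Ss \<Longrightarrow> Ss ! k \<subset> Ss ! Suc k"
    and linked: "\<And>k P i j. Suc k < length Ss \<Longrightarrow> ladder_closed q P \<Longrightarrow> i \<in> Ss ! Suc k - Ss ! k \<Longrightarrow>
      j \<in> Ss ! Suc k - Ss ! k \<Longrightarrow> P i \<Longrightarrow> P j"
  shows "composition_series (H_module q) (map (\<lambda>S. cfun.span (osc_wave ` S)) Ss)"
proof -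
  interpret jacobi_image "H_module q" "cfun.span (osc_wave ` osc_index q)" "\<lambda>F. F"
    by (rule jacobi_image_H_module)
  let ?V = "\<lambda>S. cfun.span (osc_wave ` S)"
  have inv: "jacobi_invariant (?V S)" "?V S \<subseteq> ?V (osc_index q)" if "S \<in> set Ss" for S
    using closed[OF that] by (auto intro: jacobi_invariant_span cfun.span_mono[THEN subsetD] dest: image_mono)
  show ?thesis
    unfolding composition_series_def
  proof (intro conjI ballI allI impI)
    show "map ?V Ss \<noteq> []" using Ss by simp
    show "hd (map ?V Ss) = {\<zero>\<^bsub>H_module q\<^esub>}" using Ss(1,2) by (simp add: hd_map H_module_def)
    show "last (map ?V Ss) = carrier (H_module q)" using Ss by (simp add: last_map H_module_def H_total_eq_span)
    show "jacobi_submodule U (H_module q)" if "U \<in> set (map ?V Ss)" for U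
      using that inv submodule_image by auto
    fix k assume "Suc k < length (map ?V Ss)"
    then have k: "Suc k < length Ss" by simp
    let ?R = "Ss ! k" and ?S = "Ss ! Suc k"
    have mem: "?R \<in> set Ss" "?S \<in> set Ss" using k by auto
    have RS: "?R \<subset> ?S" by (rule step[OF k])
    then obtain i where i: "i \<in> ?S" "i \<notin> ?R" by blast
    have "?V ?R \<subseteq> ?V ?S" using RS by (intro cfun.span_mono) auto
    moreover have "osc_wave i \<in> ?V ?S" using i by (intro cfun.span_base imageI)
    moreover have "osc_wave i \<notin> ?V ?R"
      using closed[OF mem(1)] closed[OF mem(2)] i by (intro osc_wave_not_in_span) auto
    ultimately have strict: "?V ?R \<subset> ?V ?S" by blast
    then show "map ?V Ss ! k \<subset> map ?V Ss ! Suc k" using k by simp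
    have "jacobi_irreducible (jacobi_quotient (H_module q\<lparr>carrier := ?V ?S\<rparr>) (?V ?R))"
    proof (rule quotient_irreducible[OF inv[OF mem(2)] inv(1)[OF mem(1)] strict])
      fix U assume U: "jacobi_invariant U" "?V ?R \<subseteq> U" "U \<subseteq> ?V ?S"
      show "U = ?V ?R \<or> U = ?V ?S"
        using closed[OF mem(2)] RS linked[OF k] by (intro no_intermediate_invariant[OF _ _ U]) blast+
    qed
    then show "jacobi_irreducible (jacobi_quotient (H_module q\<lparr>carrier := map ?V Ss ! Suc k\<rparr>) (map ?V Ss ! k))"
      using k by simp
  qed
qed

lemma composition_series_even:
  assumes "even q"
  shows "composition_series (H_module q) [{0}, subspace_sum {0, 1} (H_part q), H_total q]"
proof -
  let ?L = "{i \<in> osc_index q. fst i \<le> 1}"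
  have L: "{i \<in> osc_index q. fst i \<in> {0, 1}} = ?L" by auto
  \<comment> \<open>Weight q occurs at every even level; levels 0 and 2 witness that both inclusions
    are strict.\<close>
  have wit: "(0, q) \<in> osc_index q" "(2, q) \<in> osc_index q" by (simp_all add: osc_index_def)
  have "composition_series (H_module q) (map (\<lambda>S. cfun.span (osc_wave ` S)) [{}, ?L, osc_index q])"
  proof (rule composition_series_osc)
    show "S \<subseteq> osc_index q \<and> ladder_closed q (\<lambda>i. i \<in> S)" if "S \<in> set [{}, ?L, osc_index q]" for S
      using that ladder_closed_False ladder_closed_index ladder_closed_conj[OF ladder_closed_index ladder_closed_low]
      by auto
    fix k assume "Suc k < length [{}, ?L, osc_index q]"
    then have k: "k = 0 \<or> k = 1" by auto
    show "[{}, ?L, osc_index q] ! k \<subset> [{}, ?L, osc_index q] ! Suc k"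
      using k wit by (force simp: psubset_eq)
    fix P i j
    assume "ladder_closed q P" "i \<in> [{}, ?L, osc_index q] ! Suc k - [{}, ?L, osc_index q] ! k"
      "j \<in> [{}, ?L, osc_index q] ! Suc k - [{}, ?L, osc_index q] ! k" "P i"
    then show "P j" using k assms by (intro linked_even[of q P i j]) auto
  qed auto
  then show ?thesis
    unfolding subspace_sum_H_part L H_total_eq_span by (simp only: list.map image_empty cfun.span_empty)
qed

lemma composition_series_lowest_weight:
  "composition_series (H_module 1)
    [{0}, subspace_sum {0, 1} (H_part_minus 1), subspace_sum {0, 1} (H_part 1),
     cfun.span (subspace_sum {0, 1} (H_part 1) \<union> subspace_sum {2..} (H_part_minus 1)), H_total 1]"
proof -
  let ?w = "\<lambda>i :: nat \<times> int. snd i \<ge> 2 * int (fst i) + 1"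
  let ?I = "osc_index 1"
  let ?A = "{i \<in> ?I. fst i \<le> 1 \<and> ?w i}" and ?B = "{i \<in> ?I. fst i \<le> 1}" and ?C = "{i \<in> ?I. fst i \<le> 1 \<or> ?w i}"
  let ?Ss = "[{}, ?A, ?B, ?C, ?I]"
  note sets = subspace_sum_H_part subspace_sum_H_part_minus H_total_eq_span span_Un_span image_Un[symmetric]
  have A: "{i \<in> ?I. fst i \<in> {0, 1} \<and> ?w i} = ?A" and B: "{i \<in> ?I. fst i \<in> {0, 1}} = ?B"
    and C: "?B \<union> {i \<in> ?I. fst i \<in> {2..} \<and> ?w i} = ?C" by auto
  have w: "ladder_closed 1 ?w" by (rule ladder_closed_lowest_weight) simp
  have "composition_series (H_module 1) (map (\<lambda>S. cfun.span (osc_wave ` S)) ?Ss)"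
  proof (rule composition_series_osc)
    show "S \<subseteq> ?I \<and> ladder_closed 1 (\<lambda>i. i \<in> S)" if "S \<in> set ?Ss" for S
      using that ladder_closed_False ladder_closed_index
        ladder_closed_conj[OF ladder_closed_index ladder_closed_low]
        ladder_closed_conj[OF ladder_closed_index ladder_closed_conj[OF ladder_closed_low w]]
        ladder_closed_conj[OF ladder_closed_index ladder_closed_disj[OF ladder_closed_low w]]
      by auto
    fix k assume "Suc k < length ?Ss"
    then have k: "k = 0 \<or> k = 1 \<or> k = 2 \<or> k = 3" by auto
    \<comment> \<open>The weights 1 and 5 are the lowest weights 2l+1 at levels 0 and 2; the other
      two lie four below them.\<close>
    have "(0, 1) \<in> ?A" "(0, - 3) \<in> ?B - ?A" "(2, 5) \<in> ?C - ?B" "(2, 1) \<in> ?I - ?C"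
      by (simp_all add: osc_index_def)
    then have chain: "{} \<subset> ?A" "?A \<subset> ?B" "?B \<subset> ?C" "?C \<subset> ?I" by blast+
    have "[S0, S1, S2, S3, S4] ! k \<subset> [S0, S1, S2, S3, S4] ! Suc k"
      if "S0 \<subset> S1" "S1 \<subset> S2" "S2 \<subset> S3" "S3 \<subset> S4" for S0 S1 S2 S3 S4 :: "(nat \<times> int) set"
      using k that by (elim disjE) simp_all
    from this[OF chain] show "?Ss ! k \<subset> ?Ss ! Suc k" .
    fix P i j assume P: "ladder_closed 1 P" "P i" and ij: "i \<in> ?Ss ! Suc k - ?Ss ! k" "j \<in> ?Ss ! Suc k - ?Ss ! k"
    \<comment> \<open>The half line with \<open>s\<close> true serves the first and third quotient,
      the one with \<open>s\<close> false the second and fourth.\<close>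
    have "P j" if "i \<in> {(l, m) \<in> ?I. m \<ge> 2 * int l + 1 \<longleftrightarrow> s}" "j \<in> {(l, m) \<in> ?I. m \<ge> 2 * int l + 1 \<longleftrightarrow> s}"
      "fst i \<le> 1 \<longleftrightarrow> fst j \<le> 1" for s
      by (rule linked_lowest_weight[OF P(1) _ that(1) P(2) that(2,3) refl]) simp
    note link = this
    show "P j" using k ij link[of True] link[of False] by (auto simp: split_beta)
  qed auto
  then show ?thesis
    unfolding sets A B C by (simp only: list.map image_empty cfun.span_empty)
qed

lemma composition_series_highest_weight:
  "composition_series (H_module 3)
    [{0}, subspace_sum {0, 1} (H_part_plus 3), subspace_sum {0, 1} (H_part 3),
     cfun.span (subspace_sum {0, 1} (H_part 3) \<union> subspace_sum {2..} (H_part_plus 3)), H_total 3]"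
proof -
  let ?w = "\<lambda>i :: nat \<times> int. snd i \<le> - (2 * int (fst i) + 1)"
  let ?I = "osc_index 3"
  let ?A = "{i \<in> ?I. fst i \<le> 1 \<and> ?w i}" and ?B = "{i \<in> ?I. fst i \<le> 1}" and ?C = "{i \<in> ?I. fst i \<le> 1 \<or> ?w i}"
  let ?Ss = "[{}, ?A, ?B, ?C, ?I]"
  note sets = subspace_sum_H_part subspace_sum_H_part_plus H_total_eq_span span_Un_span image_Un[symmetric]
  have A: "{i \<in> ?I. fst i \<in> {0, 1} \<and> ?w i} = ?A" and B: "{i \<in> ?I. fst i \<in> {0, 1}} = ?B"
    and C: "?B \<union> {i \<in> ?I. fst i \<in> {2..} \<and> ?w i} = ?C" by auto
  have w: "ladder_closed 3 ?w" by (rule ladder_closed_highest_weight) simp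
  have "composition_series (H_module 3) (map (\<lambda>S. cfun.span (osc_wave ` S)) ?Ss)"
  proof (rule composition_series_osc)
    show "S \<subseteq> ?I \<and> ladder_closed 3 (\<lambda>i. i \<in> S)" if "S \<in> set ?Ss" for S
      using that ladder_closed_False ladder_closed_index
        ladder_closed_conj[OF ladder_closed_index ladder_closed_low]
        ladder_closed_conj[OF ladder_closed_index ladder_closed_conj[OF ladder_closed_low w]]
        ladder_closed_conj[OF ladder_closed_index ladder_closed_disj[OF ladder_closed_low w]]
      by auto
    fix k assume "Suc k < length ?Ss"
    then have k: "k = 0 \<or> k = 1 \<or> k = 2 \<or> k = 3" by auto
    \<comment> \<open>The weights -1 and -5 are the highest weights -(2l+1) at levels 0 and 2; the
      weight 3 exceeds this bound at both levels.\<close>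
    have "(0, - 1) \<in> ?A" "(0, 3) \<in> ?B - ?A" "(2, - 5) \<in> ?C - ?B" "(2, 3) \<in> ?I - ?C"
      by (simp_all add: osc_index_def)
    then have chain: "{} \<subset> ?A" "?A \<subset> ?B" "?B \<subset> ?C" "?C \<subset> ?I" by blast+
    have "[S0, S1, S2, S3, S4] ! k \<subset> [S0, S1, S2, S3, S4] ! Suc k"
      if "S0 \<subset> S1" "S1 \<subset> S2" "S2 \<subset> S3" "S3 \<subset> S4" for S0 S1 S2 S3 S4 :: "(nat \<times> int) set"
      using k that by (elim disjE) simp_all
    from this[OF chain] show "?Ss ! k \<subset> ?Ss ! Suc k" .
    fix P i j assume P: "ladder_closed 3 P" "P i" and ij: "i \<in> ?Ss ! Suc k - ?Ss ! k" "j \<in> ?Ss ! Suc k - ?Ss ! k"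
    have "P j" if "i \<in> {(l, m) \<in> ?I. m \<le> - (2 * int l + 1) \<longleftrightarrow> s}" "j \<in> {(l, m) \<in> ?I. m \<le> - (2 * int l + 1) \<longleftrightarrow> s}"
      "fst i \<le> 1 \<longleftrightarrow> fst j \<le> 1" for s
      by (rule linked_highest_weight[OF P(1) _ that(1) P(2) that(2,3) refl]) simp
    note link = this
    show "P j" using k ij link[of True] link[of False] by (auto simp: split_beta)
  qed auto
  then show ?thesis
    unfolding sets A B C by (simp only: list.map image_empty cfun.span_empty)
qed

theorem theorem2:
  fixes q :: int
  assumes "q \<in> {0, 1, 2, 3}"
  shows "direct_family UNIV (H_part q) \<and>
    is_jacobi_module (H_module q) \<and>
    (q = 0 \<or> q = 2 \<longrightarrow>
      composition_series (H_module q)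
        [{0},
         subspace_sum {0, 1} (H_part q),
         H_total q]) \<and>
    (q = 1 \<longrightarrow>
      composition_series (H_module q)
        [{0},
         subspace_sum {0, 1} (H_part_minus q),
         subspace_sum {0, 1} (H_part q),
         cfun.span (subspace_sum {0, 1} (H_part q) \<union> subspace_sum {2..} (H_part_minus q)),
         H_total q]) \<and>
    (q = 3 \<longrightarrow>
      composition_series (H_module q)
        [{0},
         subspace_sum {0, 1} (H_part_plus q),
         subspace_sum {0, 1} (H_part q),
         cfun.span (subspace_sum {0, 1} (H_part q) \<union> subspace_sum {2..} (H_part_plus q)),
         H_total q])"
  using direct_family_H_part jacobi_image.is_jacobi_module[OF jacobi_image_H_module]
    composition_series_even[of q] composition_series_lowest_weight composition_series_highest_weight
  by auto

end
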